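(* Let $z\in\mathbb{C}$, let $\alpha,\beta>0$ with $\alpha\beta=1$, and let $\chi$ be a real primitive Dirichlet character modulo $q$. (i) If $\chi$ is even, then \begin{align*} &\sqrt{\alpha}\,e^{\frac{z^2}{8}}\int_{0}^{\infty}e^{-\frac{\pi\alpha^2 x^2}{q}}\sin\left(\frac{\sqrt{\pi}\,\alpha xz}{\sqrt{q}}\right)\frac{\sum_{r=1}^{q-1}\chi(r)e^{-\frac{2\pi r x}{q}}}{1-e^{-2\pi x}}\, dx\\ &=\sqrt{\beta}\,e^{-\frac{z^2}{8}}\int_{0}^{\infty}e^{-\frac{\pi\beta^2 x^2}{q}}\sinh\left(\frac{\sqrt{\pi}\,\beta xz}{\sqrt{q}}\right)\frac{\sum_{r=1}^{q-1}\chi(r)e^{-\frac{2\pi r x}{q}}}{1-e^{-2\pi x}}\, dx\\ &=\frac{z\sqrt{q}}{16\pi^{2}}\int_{0}^{\infty}\Gamma\left(\frac{3+it}{4}\right)\Gamma\left(\frac{3-it}{4}\right)\Xi\left(\frac{t}{2},\chi\right)\Delta\left(\alpha,z,\frac{1+it}{2}\right)\, dt. \end{align*} (ii) If $\chi$ is odd, then \begin{align*} &\sqrt{\alpha}\,e^{\frac{z^2}{8}}\int_{0}^{\infty}e^{-\frac{\pi\alpha^2 x^2}{q}}\cos\left(\frac{\sqrt{\pi}\,\alpha xz}{\sqrt{q}}\right)\frac{\sum_{r=1}^{q-1}\chi(r)e^{-\frac{2\pi r x}{q}}}{1-e^{-2\pi x}}\, dx\\ &=\sqrt{\beta}\,e^{-\frac{z^2}{8}}\int_{0}^{\infty}e^{-\frac{\pi\beta^2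 x^2}{q}}\cosh\left(\frac{\sqrt{\pi}\,\beta xz}{\sqrt{q}}\right)\frac{\sum_{r=1}^{q-1}\chi(r)e^{-\frac{2\pi r x}{q}}}{1-e^{-2\pi x}}\, dx\\ &=\frac{1}{16\pi^{3/2}}\int_{0}^{\infty}\Gamma\left(\frac{1+it}{4}\right)\Gamma\left(\frac{1-it}{4}\right)\Xi\left(\frac{t}{2},\chi\right)\nabla\left(\alpha,z,\frac{1+it}{2}\right)\, dt. \end{align*}
   Context: For a primitive Dirichlet character $\chi$ modulo $q$, let $a=0$ if $\chi(-1)=1$ and $a=1$ if $\chi(-1)=-1$; $\xi(s,\chi):=(\pi/q)^{-(s+a)/2}\Gamma\left(\frac{s+a}{2}\right)L(s,\chi)$ and $\Xi(t,\chi):=\xi(\tfrac12+it,\chi)$. ${}_1F_1(a;c;w)$ is Kummer's confluent hypergeometric function. For $x>0$, $z,s\in\mathbb{C}$: $\omega(x,z,s):=x^{\frac12-s}e^{-\frac{z^2}{8}}\,{}_1F_1\left(1-\frac{s}{2};\frac32;\frac{z^2}{4}\right)$, $\Delta(x,z,s):=\omega(x,z,s)+\omega(x,z,1-s)$; $\rho(x,z,s):=x^{\frac12-s}e^{-\frac{z^2}{8}}\,{}_1F_1\left(\frac{1-s}{2};\frac12;\frac{z^2}{4}\right)$, $\nabla(x,z,s):=\rho(x,z,s)+\rho(x,z,1-s)$.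
   Formalization: The modulus is assumed to satisfy q > 1: for q = 1 the trivial character is even, real and primitive, the sum over r from 1 to q-1 is empty so the first two members of (i) are 0, but the third member is nonzero for z > 0. *)

theory Defs
  imports "HOL-Complex_Analysis.Complex_Analysis"
begin

text \<open>
  Dirichlet characters modulo \<open>q\<close> are taken as functions on all of \<open>\<int>\<close> (periodic and vanishing
  off the residues coprime to \<open>q\<close>), so that \<open>chi (-1)\<close> makes sense literally.
\<close>

definition dirichlet_character :: "nat \<Rightarrow> (int \<Rightarrow> complex) \<Rightarrow> bool" where
  "dirichlet_character q chi \<longleftrightarrow>
     q > 0 \<and>
     (\<forall>n. chi (n + int q) = chi n) \<and>
     (\<forall>m n. chi (m * n) = chi m * chi n) \<and>
     (\<forall>n. chi n \<noteq> 0 \<longleftrightarrow> coprime n (int q))"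

text \<open>A character is primitive if no character of a proper divisor of the modulus induces it.\<close>

definition primitive_dirichlet_character :: "nat \<Rightarrow> (int \<Rightarrow> complex) \<Rightarrow> bool" where
  "primitive_dirichlet_character q chi \<longleftrightarrow>
     dirichlet_character q chi \<and>
     \<not> (\<exists>d \<psi>. d dvd q \<and> d < q \<and> dirichlet_character d \<psi> \<and>
               (\<forall>n. coprime n (int q) \<longrightarrow> chi n = \<psi> n))"

definition real_character :: "(int \<Rightarrow> complex) \<Rightarrow> bool" where
  "real_character chi \<longleftrightarrow> (\<forall>n. chi n \<in> \<real>)"

definition even_character :: "(int \<Rightarrow> complex) \<Rightarrow> bool" where
  "even_character chi \<longleftrightarrow> chi (-1) = 1"

definition odd_character :: "(int \<Rightarrow> complex) \<Rightarrow> bool" where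
  "odd_character chi \<longleftrightarrow> chi (-1) = -1"

text \<open>
  \<open>L(s, chi)\<close> is the meromorphic continuation to the whole plane of the Dirichlet series, which
  converges absolutely for \<open>Re s > 1\<close>. The word ``nicely'' pins the value at a pole to \<open>0\<close> and
  excludes removable singularities, which makes the continuation unique as a total function.
\<close>

definition dirichlet_L :: "(int \<Rightarrow> complex) \<Rightarrow> complex \<Rightarrow> complex" where
  "dirichlet_L chi =
     (THE f. f nicely_meromorphic_on UNIV \<and>
             (\<forall>s. Re s > 1 \<longrightarrow>
                (\<lambda>n. chi (int (Suc n)) * of_nat (Suc n) powr (-s)) sums f s))"

text \<open>
  Any such continuation of the Dirichlet series is the \<open>L\<close>-function; in particular any entire one.
\<close>

lemma dirichlet_L_eqI:
  assumes f: "f nicely_meromorphic_on UNIV"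
    and series: "\<And>s. Re s > 1 \<Longrightarrow> (\<lambda>n. chi (int (Suc n)) * of_nat (Suc n) powr (-s)) sums f s"
  shows "dirichlet_L chi = f"
  unfolding dirichlet_L_def
proof (rule the_equality)
  show "f nicely_meromorphic_on UNIV \<and> (\<forall>s. Re s > 1 \<longrightarrow>
          (\<lambda>n. chi (int (Suc n)) * of_nat (Suc n) powr (-s)) sums f s)"
    using assms by blast
next
  fix g
  assume g: "g nicely_meromorphic_on UNIV \<and> (\<forall>s. Re s > 1 \<longrightarrow>
          (\<lambda>n. chi (int (Suc n)) * of_nat (Suc n) powr (-s)) sums g s)"
  have eq: "g s = f s" if "Re s > 1" for s
    using g series that sums_unique2 by blast
  have mero: "(\<lambda>z. g z - f z) meromorphic_on UNIV"
    using f g by (auto simp: nicely_meromorphic_on_def intro!: meromorphic_intros)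
  have near2: "eventually (\<lambda>z. g z - f z = 0) (at 2)"
  proof -
    have "eventually (\<lambda>z::complex. z \<in> {z. Re z > 1}) (at 2)"
      by (intro eventually_at_in_open' open_halfspace_Re_gt) auto
    thus ?thesis by eventually_elim (use eq in auto)
  qed
  have "\<not> eventually (\<lambda>z. g z - f z \<noteq> 0) (cosparse UNIV)"
  proof
    assume "eventually (\<lambda>z. g z - f z \<noteq> 0) (cosparse UNIV)"
    hence "eventually (\<lambda>z. g z - f z \<noteq> 0) (at 2)"
      by (auto simp: eventually_cosparse_open_eq)
    with near2 have "eventually (\<lambda>z::complex. False) (at 2)"
      by eventually_elim auto
    thus False by simp
  qed
  hence "eventually (\<lambda>z. g z - f z = 0) (cosparse UNIV)"
    using meromorphic_imp_constant_or_avoid[OF mero, of 0] by auto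
  hence ev: "eventually (\<lambda>w. g w = f w) (at z)" for z
    by (auto simp: eventually_cosparse_open_eq)
  show "g = f"
  proof
    fix z
    have pole: "is_pole g z \<longleftrightarrow> is_pole f z"
      by (rule is_pole_cong[OF ev refl])
    have lim: "(g \<longlongrightarrow> l) (at z) \<longleftrightarrow> (f \<longlongrightarrow> l) (at z)" for l
      by (rule tendsto_cong[OF ev])
    have fz: "is_pole f z \<and> f z = 0 \<or> f \<midarrow>z\<rightarrow> f z" and gz: "is_pole g z \<and> g z = 0 \<or> g \<midarrow>z\<rightarrow> g z"
      using f g by (auto simp: nicely_meromorphic_on_def)
    show "g z = f z"
    proof (cases "is_pole f z")
      case True
      hence "\<not> f \<midarrow>z\<rightarrow> l" for l
        using not_tendsto_and_filterlim_at_infinity[of "at z" f] by (auto simp: is_pole_def)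
      thus ?thesis using fz gz lim by auto
    next
      case False
      hence "f \<midarrow>z\<rightarrow> f z" "f \<midarrow>z\<rightarrow> g z" using fz gz pole lim by auto
      thus ?thesis using LIM_unique by blast
    qed
  qed
qed

definition character_parity :: "(int \<Rightarrow> complex) \<Rightarrow> nat" where
  "character_parity chi = (if chi (-1) = 1 then 0 else 1)"

definition xi_char :: "nat \<Rightarrow> (int \<Rightarrow> complex) \<Rightarrow> complex \<Rightarrow> complex" where
  "xi_char q chi s =
     (let a = of_nat (character_parity chi)
      in of_real (pi / real q) powr (- (s + a) / 2) * Gamma ((s + a) / 2) * dirichlet_L chi s)"

definition Xi_char :: "nat \<Rightarrow> (int \<Rightarrow> complex) \<Rightarrow> complex \<Rightarrow> complex" where
  "Xi_char q chi t = xi_char q chi (1/2 + \<i> * t)"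

definition kummer_1F1 :: "complex \<Rightarrow> complex \<Rightarrow> complex \<Rightarrow> complex" where
  "kummer_1F1 a c w = (\<Sum>n. pochhammer a n / pochhammer c n * w ^ n / fact n)"

definition omega_fn :: "real \<Rightarrow> complex \<Rightarrow> complex \<Rightarrow> complex" where
  "omega_fn x z s =
     of_real x powr (1/2 - s) * exp (- z\<^sup>2 / 8) * kummer_1F1 (1 - s/2) (3/2) (z\<^sup>2 / 4)"

definition Delta_fn :: "real \<Rightarrow> complex \<Rightarrow> complex \<Rightarrow> complex" where
  "Delta_fn x z s = omega_fn x z s + omega_fn x z (1 - s)"

definition rho_fn :: "real \<Rightarrow> complex \<Rightarrow> complex \<Rightarrow> complex" where
  "rho_fn x z s =
     of_real x powr (1/2 - s) * exp (- z\<^sup>2 / 8) * kummer_1F1 ((1 - s)/2) (1/2) (z\<^sup>2 / 4)"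

definition Nabla_fn :: "real \<Rightarrow> complex \<Rightarrow> complex \<Rightarrow> complex" where
  "Nabla_fn x z s = rho_fn x z s + rho_fn x z (1 - s)"

definition char_kernel :: "nat \<Rightarrow> (int \<Rightarrow> complex) \<Rightarrow> real \<Rightarrow> complex" where
  "char_kernel q chi x =
     (\<Sum>r = 1..q-1. chi (int r) * of_real (exp (- 2 * pi * real r * x / real q)))
       / of_real (1 - exp (- 2 * pi * x))"

end

theory Submission
  imports Defs "HOL-Number_Theory.Number_Theory" "HOL-Probability.Sinc_Integral" "HOL-Real_Asymp.Real_Asymp"
begin

text \<open>
  By the classification of real primitive characters and the sign of the quadratic Gauss sum, the Gauss sum of
  \<open>chi\<close> is \<open>sqrt q\<close> or \<open>\<i> * sqrt q\<close>. Combined with the partial fractions of the cotangent it shows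
  that \<open>char_kernel q chi\<close> is, up to scaling, its own sine transform (even \<open>chi\<close>) or cosine transform (odd
  \<open>chi\<close>). Inserting this into the first integral and interchanging the integrations reduces the first
  identity to the Gaussian integral. The Mellin transform of the kernel is \<open>Gamma s * L(s, chi)\<close> up to an
  exponential factor, so the self-reciprocity is also the functional equation of \<open>L\<close>; the Mellin transform of
  the Gaussian times \<open>sinh\<close> or \<open>cosh\<close> is a Kummer function, and Parseval's formula on the critical line
  gives the integral over \<open>\<Xi>\<close>.
\<close>

section \<open>Real primitive characters\<close>

text \<open>The square of the Gauss sum is elementary, its sign is not. For an odd prime modulus the
  sign is decided by a numerical lower bound for a related sum over odd squares. For composite
  moduli it has to survive products: if both factors are odd characters, the product of their Gauss
  sums carries \<open>\<i> * \<i> = -1\<close>, and quadratic reciprocity, extended to pairs of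
  coprime real characters, supplies exactly the compensating sign. Both parts of the theorem are one
  argument with an index \<open>h\<close>: \<open>h = 1\<close> (sinh and sine) belongs to even
  characters, \<open>h = 0\<close> (cosh and cosine) to odd ones, so the parity exponent in
  \<open>xi_char\<close> is \<open>1 - h\<close>. Since \<open>dirichlet_L\<close> is a definite
  description, an entire continuation has to be exhibited first: the Mellin transform provides it
  for positive real part, the functional equation for the rest. Parseval's formula inverts only the
  Gaussian side, whose Mellin transform decays quadratically on vertical lines; the kernel side
  enters through its absolutely convergent integral.\<close>

definition real_primitive :: "nat \<Rightarrow> (int \<Rightarrow> complex) \<Rightarrow> bool" where
  "real_primitive q chi \<longleftrightarrow> primitive_dirichlet_character q chi \<and> real_character chi"

lemma real_primitiveD:
  assumes "real_primitive q chi"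
  shows "dirichlet_character q chi" "real_character chi" "primitive_dirichlet_character q chi"
  using assms by (auto simp: real_primitive_def primitive_dirichlet_character_def)

section \<open>Elementary properties of Dirichlet characters\<close>

context
  fixes q chi assumes chi: "dirichlet_character q chi"
begin

lemma dirichlet_character_modulus_pos: "q > 0"
  using chi by (simp add: dirichlet_character_def)

lemma dirichlet_character_mult: "chi (m * n) = chi m * chi n"
  using chi by (simp add: dirichlet_character_def)

lemma dirichlet_character_eq_0_iff: "chi n = 0 \<longleftrightarrow> \<not> coprime n (int q)"
  using chi by (auto simp: dirichlet_character_def)

lemma dirichlet_character_one: "chi 1 = 1"
proof -
  have "chi 1 * chi 1 = chi 1" using dirichlet_character_mult[of 1 1] by simp
  moreover have "chi 1 \<noteq> 0" by (simp add: dirichlet_character_eq_0_iff)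
  ultimately show ?thesis by simp
qed

lemma dirichlet_character_periodic: "chi (n + int q * k) = chi n"
proof -
  have nat: "chi (n + int q * int j) = chi n" for n j
  proof (induction j)
    case (Suc j)
    have "chi (n + int q * int (Suc j)) = chi (n + int q * int j + int q)" by (simp add: algebra_simps)
    thus ?case using Suc chi by (simp add: dirichlet_character_def)
  qed simp
  show ?thesis
  proof (cases "k \<ge> 0")
    case True thus ?thesis using nat[of n "nat k"] by simp
  next
    case False thus ?thesis using nat[of "n + int q * k" "nat (-k)"] by (simp add: algebra_simps)
  qed
qed

lemma dirichlet_character_cong: "[m = n] (mod int q) \<Longrightarrow> chi m = chi n"
  by (metis cong_iff_lin dirichlet_character_periodic)

lemma dirichlet_character_power: "chi (m ^ k) = chi m ^ k"
  by (induction k) (auto simp: dirichlet_character_mult dirichlet_character_one)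

lemma dirichlet_character_minus_one: "chi (-1) = 1 \<or> chi (-1) = -1"
  using dirichlet_character_mult[of "-1" "-1"] dirichlet_character_one
  by (simp add: square_eq_1_iff)

lemma dirichlet_character_uminus: "chi (-n) = chi (-1) * chi n"
  using dirichlet_character_mult[of "-1" n] by simp

lemma dirichlet_character_unit_inverse:
  assumes "coprime n (int q)"
  obtains m where "[n * m = 1] (mod int q)" "chi n * chi m = 1" "coprime m (int q)"
proof -
  obtain m where m: "[n * m = 1] (mod int q)" using assms cong_solve_coprime_int by blast
  have "chi (n * m) = 1" using dirichlet_character_cong[OF m] dirichlet_character_one by simp
  moreover have "coprime m (int q)" using m
    by (metis assms coprime_iff_invertible_int mult.commute)
  ultimately show ?thesis using m that by (simp add: dirichlet_character_mult)
qed

text \<open>By Euler's theorem a positive power of \<open>chi n\<close> equals 1. Modulus 1 is split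
  off because the \<open>residues\<close> locale demands a larger modulus.\<close>

lemma dirichlet_character_norm: "coprime n (int q) \<Longrightarrow> norm (chi n) = 1"
proof -
  assume n: "coprime n (int q)"
  have "[n ^ totient q = 1] (mod int q)"
  proof (cases "q = 1")
    case False
    hence "residues (int q)" using dirichlet_character_modulus_pos by (simp add: residues_def)
    thus ?thesis using residues.euler_theorem n by fastforce
  qed simp
  hence "chi n ^ totient q = 1" 
    using dirichlet_character_cong dirichlet_character_power dirichlet_character_one by metis
  moreover have "totient q > 0" using dirichlet_character_modulus_pos by simp
  ultimately show ?thesis
    by (metis norm_ge_zero norm_one norm_power power_eq_1_iff less_irrefl)
qed

lemma real_character_cases:
  assumes "real_character chi"
  shows "coprime n (int q) \<Longrightarrow> chi n = 1 \<or> chi n = -1"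
proof -
  assume "coprime n (int q)"
  hence "norm (chi n) = 1" by (rule dirichlet_character_norm)
  moreover obtain x where "chi n = of_real x" using assms by (auto simp: real_character_def Reals_def)
  ultimately show ?thesis by (auto simp: abs_eq_iff')
qed

end

lemma dirichlet_characterI:
  assumes "q > 0" "\<And>n. chi (n + int q) = chi n" "\<And>m n. chi (m * n) = chi m * chi n"
    "\<And>n. chi n \<noteq> 0 \<longleftrightarrow> coprime n (int q)"
  shows "dirichlet_character q chi"
  using assms by (auto simp: dirichlet_character_def)

lemma dirichlet_character_times:
  assumes "dirichlet_character q1 chi1" "dirichlet_character q2 chi2"
  shows "dirichlet_character (q1 * q2) (\<lambda>n. chi1 n * chi2 n)"
proof (rule dirichlet_characterI)
  fix n
  show "chi1 (n + int (q1 * q2)) * chi2 (n + int (q1 * q2)) = chi1 n * chi2 n"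
    using dirichlet_character_periodic[OF assms(1), of n "int q2"]
      dirichlet_character_periodic[OF assms(2), of n "int q1"] by (simp add: mult.commute)
qed (use assms in \<open>auto simp: dirichlet_character_mult dirichlet_character_eq_0_iff
       dirichlet_character_modulus_pos\<close>)

lemma real_primitive_one_iff: "real_primitive 1 chi \<longleftrightarrow> chi = (\<lambda>_. 1)"
proof
  assume "real_primitive 1 chi"
  hence d: "dirichlet_character 1 chi" by (rule real_primitiveD)
  show "chi = (\<lambda>_. 1)"
  proof
    fix n show "chi n = 1"
      using dirichlet_character_cong[OF d, of n 1] dirichlet_character_one[OF d] by simp
  qed
qed (auto simp: real_primitive_def primitive_dirichlet_character_def dirichlet_character_def
      real_character_def)

text \<open>The first factor is \<open>chi\<close> evaluated at the solution of the congruences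
  \<open>x = n (mod q1)\<close>, \<open>x = 1 (mod q2)\<close>.\<close>

lemma real_primitive_factor:
  assumes rp: "real_primitive (q1 * q2) chi" and cop: "coprime q1 q2"
  obtains chi1 chi2 where "real_primitive q1 chi1" "real_primitive q2 chi2"
    "\<And>n. chi n = chi1 n * chi2 n"
proof -
  have d: "dirichlet_character (q1 * q2) chi" using rp by (rule real_primitiveD)
  have pos: "q1 > 0" "q2 > 0" using dirichlet_character_modulus_pos[OF d] by auto
  define ok where "ok = (\<lambda>q1 q2 u. [u = 1] (mod int q1) \<and> [u = 0] (mod int q2))"
  define f where "f = (\<lambda>u n. chi (n * u + (1 - u)))"
  \<comment> \<open>The residue \<open>u\<close> is idempotent modulo the product, and
    \<open>1 - u\<close> is the complementary idempotent with the two moduli exchanged. Stated for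
    arbitrary moduli, the fact produces both factors.\<close>
  have f_dc: "dirichlet_character q1 (f u) \<and> real_character (f u)"
    if ok: "ok q1 q2 u" and q: "q1 * q2 = Q" "Q = int_q" "coprime q1 q2"
      and D: "dirichlet_character Q chi" and pos: "q1 > 0" for q1 q2 Q int_q u
  proof -
    have u1: "int q1 dvd u - 1" and u2: "int q2 dvd u"
      using ok by (auto simp: ok_def cong_iff_dvd_diff)
    have Q: "int Q = int q1 * int q2" using q by auto
    have uu: "int Q dvd u * (u - 1)" unfolding Q using u1 u2 by (metis mult.commute mult_dvd_mono)
    show ?thesis
    proof (intro conjI dirichlet_characterI)
      show "real_character (f u)" using rp by (auto simp: f_def real_primitive_def real_character_def)
      fix n
      have "int Q dvd int q1 * u" unfolding Q using u2 by auto
      thus "f u (n + int q1) = f u n" unfolding f_def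
        by (intro dirichlet_character_cong[OF D]) (auto simp: cong_iff_dvd_diff algebra_simps)
      have "coprime (n * u + (1 - u)) (int q1) \<longleftrightarrow> coprime n (int q1)"
      proof (rule coprime_cong_cong_left)
        have "n * u + (1 - u) - n = (u - 1) * (n - 1)" by (simp add: algebra_simps)
        thus "[n * u + (1 - u) = n] (mod int q1)" using u1 by (simp add: cong_iff_dvd_diff)
      qed
      moreover have "coprime (n * u + (1 - u)) (int q2)"
      proof -
        have "[n * u + (1 - u) = 1] (mod int q2)"
          using u2 by (auto simp: cong_iff_dvd_diff algebra_simps)
        thus ?thesis using coprime_cong_cong_left coprime_1_left by blast
      qed
      ultimately show "f u n \<noteq> 0 \<longleftrightarrow> coprime n (int q1)"
        unfolding f_def using dirichlet_character_eq_0_iff[OF D] Q by auto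
    next
      fix m n
      have "(m * u + (1 - u)) * (n * u + (1 - u)) - (m * n * u + (1 - u))
          = u * (u - 1) * (m * n - m - n + 1)" by (simp add: algebra_simps)
      hence "[(m * u + (1 - u)) * (n * u + (1 - u)) = m * n * u + (1 - u)] (mod int Q)"
        using uu by (simp add: cong_iff_dvd_diff)
      thus "f u (m * n) = f u m * f u n" unfolding f_def
        using dirichlet_character_cong[OF D] dirichlet_character_mult[OF D] by metis
    qed (use pos in auto)
  qed
  obtain u where u: "ok q1 q2 u"
    using cop binary_chinese_remainder_int[of "int q1" "int q2" 1 0] by (auto simp: ok_def)
  have v: "ok q2 q1 (1 - u)"
    using u by (auto simp: ok_def cong_iff_dvd_diff dvd_diff_commute)
  have d1: "dirichlet_character q1 (f u)" "real_character (f u)"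
    using f_dc[OF u refl refl cop d pos(1)] by auto
  have d2: "dirichlet_character q2 (f (1-u))" "real_character (f (1-u))"
    using f_dc[OF v _ refl _ d pos(2)] cop by (auto simp: mult.commute coprime_commute)
  have prod: "chi n = f u n * f (1-u) n" for n
  proof -
    have "int (q1*q2) dvd u * (u - 1)"
      using u by (auto simp: ok_def cong_iff_dvd_diff mult.commute intro: mult_dvd_mono)
    moreover have "(n * u + (1 - u)) * (n * (1 - u) + (1 - (1 - u))) - n
        = - u * (u - 1) * (n - 1)^2" by (simp add: algebra_simps power2_eq_square)
    ultimately have "[n = (n * u + (1 - u)) * (n * (1 - u) + (1 - (1 - u)))] (mod int (q1*q2))"
      by (subst cong_sym_eq) (simp add: cong_iff_dvd_diff)
    thus ?thesis unfolding f_def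
      using dirichlet_character_cong[OF d] dirichlet_character_mult[OF d] by metis
  qed
  \<comment> \<open>If a proper divisor \<open>d\<close> of \<open>q1\<close> induced
    \<open>f1\<close>, then \<open>d * q2\<close> would induce \<open>chi\<close>. The moduli are
    again variables, so that the argument covers either factor.\<close>
  have prim: "primitive_dirichlet_character q1 f1"
    if "dirichlet_character q1 f1" "dirichlet_character q2 f2" "\<And>n. chi n = f1 n * f2 n"
      "primitive_dirichlet_character (q1 * q2) chi" "coprime q1 q2" "q2 > 0" for q1 q2 f1 f2
    unfolding primitive_dirichlet_character_def
  proof (intro conjI notI)
    show "dirichlet_character q1 f1" by fact
    assume "\<exists>d \<psi>. d dvd q1 \<and> d < q1 \<and> dirichlet_character d \<psi> \<and>
               (\<forall>n. coprime n (int q1) \<longrightarrow> f1 n = \<psi> n)"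
    then obtain d \<psi> where *: "d dvd q1" "d < q1" "dirichlet_character d \<psi>"
      "\<And>n. coprime n (int q1) \<Longrightarrow> f1 n = \<psi> n" by blast
    have "d * q2 dvd q1 * q2" "d * q2 < q1 * q2" using * that by auto
    moreover have "dirichlet_character (d * q2) (\<lambda>n. \<psi> n * f2 n)"
      by (intro dirichlet_character_times * that)
    moreover have "chi n = \<psi> n * f2 n" if "coprime n (int (q1 * q2))" for n
      using that *(4) \<open>\<And>n. chi n = f1 n * f2 n\<close> by simp
    ultimately show False using \<open>primitive_dirichlet_character (q1 * q2) chi\<close>
      unfolding primitive_dirichlet_character_def by blast
  qed
  have P: "primitive_dirichlet_character (q1 * q2) chi" using rp by (rule real_primitiveD)
  have "primitive_dirichlet_character q1 (f u)"
    by (rule prim[OF d1(1) d2(1) prod P cop pos(2)])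
  moreover have "primitive_dirichlet_character q2 (f (1-u))"
    by (rule prim[OF d2(1) d1(1) _ _ _ pos(1)])
       (use prod P cop in \<open>auto simp: mult.commute coprime_commute\<close>)
  ultimately show ?thesis using that[of "f u" "f (1-u)"] d1 d2 prod by (auto simp: real_primitive_def)
qed

section \<open>Classification of real primitive characters\<close>

lemma primitive_not_induced:
  assumes "primitive_dirichlet_character q chi" "d dvd q" "dirichlet_character d \<psi>"
    "\<And>n. coprime n (int q) \<Longrightarrow> chi n = \<psi> n"
  shows "d = q"
proof -
  have "q > 0" using assms(1) by (auto simp: primitive_dirichlet_character_def dirichlet_character_def)
  hence "d \<le> q" using assms(2) by (simp add: dvd_imp_le)
  moreover have "\<not> d < q" using assms unfolding primitive_dirichlet_character_def by blast
  ultimately show ?thesis by simp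
qed

text \<open>The units congruent to 1 modulo \<open>p\<close> have odd order (a power of
  \<open>p\<close>), so a character with values 1 and -1 is trivial on them. Hence
  \<open>chi\<close> has period \<open>p\<close>, and primitivity forces \<open>k = 1\<close>.
  Modulo \<open>p\<close> the character is 1 on nonzero squares and -1 somewhere, which leaves only
  the Legendre symbol.\<close>

lemma real_primitive_odd_prime_power:
  assumes rp: "real_primitive (p ^ k) chi" and p: "prime p" "odd p" and k: "k > 0"
  shows "k = 1 \<and> chi = (\<lambda>n. of_int (Legendre n (int p)))"
proof -
  have d: "dirichlet_character (p ^ k) chi" and r: "real_character chi"
    and P: "primitive_dirichlet_character (p ^ k) chi" using rp by (auto dest: real_primitiveD)
  have p2: "p > 2" using p prime_ge_2_nat[of p] by (cases "p = 2") auto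
  have "prime (int p)" using p by simp
  hence copp: "coprime n (int p) \<longleftrightarrow> \<not> int p dvd n" for n
    using prime_imp_coprime[of "int p" n] coprime_common_divisor[of n "int p" "int p"] p(1)
    by (auto simp: coprime_commute prime_int_iff)
  have cop: "coprime n (int (p ^ k)) \<longleftrightarrow> \<not> int p dvd n" for n
    using copp k by simp
  have unit: "chi n = 1" if "[n = 1] (mod int p)" for n
  proof -
    \<comment> \<open>Each \<open>p\<close>-th power gains a factor \<open>p\<close>: the difference
      from 1 gets multiplied by a geometric sum of \<open>p\<close> terms, all of them 1 modulo
      \<open>p\<close>.\<close>
    have "[n ^ (p ^ j) = 1] (mod int p ^ Suc j)" for j
    proof (induction j)
      case (Suc j)
      then obtain t where "n ^ (p ^ j) = 1 + int p ^ Suc j * t" 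
        using cong_iff_lin[of 1 "n ^ (p ^ j)" "int p ^ Suc j"] cong_sym[OF Suc] by auto
      moreover have "n ^ (p ^ Suc j) = (n ^ (p ^ j)) ^ p"
        by (subst power_mult[symmetric]) (simp add: mult.commute)
      ultimately have "n ^ (p ^ Suc j) = (1 + int p ^ Suc j * t) ^ p" by simp
      also have "[\<dots> = 1] (mod int p ^ Suc (Suc j))"
      proof -
        have "(1 + int p ^ Suc j * t) ^ p - 1
          = (int p ^ Suc j * t) * (\<Sum>i<p. (1 + int p ^ Suc j * t) ^ i)"
          using power_diff_1_eq[of "1 + int p ^ Suc j * t" p] by simp
        moreover have "[(\<Sum>i<p. (1 + int p ^ Suc j * t) ^ i) = (\<Sum>i<p. 1)] (mod int p)"
        proof (intro cong_sum)
          fix i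
          have "[1 + int p ^ Suc j * t = 1] (mod int p)" by (simp add: cong_iff_dvd_diff)
          thus "[(1 + int p ^ Suc j * t) ^ i = 1] (mod int p)" using cong_pow by fastforce
        qed
        hence "[(\<Sum>i<p. (1 + int p ^ Suc j * t) ^ i) = int p] (mod int p)" by simp
        hence "int p dvd (\<Sum>i<p. (1 + int p ^ Suc j * t) ^ i)"
          using cong_trans[of _ "int p" "int p" 0] by (simp add: cong_0_iff)
        hence "int p ^ Suc j * int p dvd (int p ^ Suc j * t) * (\<Sum>i<p. (1 + int p ^ Suc j * t) ^ i)"
          by (intro mult_dvd_mono) auto
        ultimately show ?thesis by (simp add: cong_iff_dvd_diff mult.commute)
      qed
      finally show ?case .
    qed (use that in simp)
    from this[of "k-1"] have "[n ^ (p ^ (k-1)) = 1] (mod int (p ^ k))" using k by simp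
    hence "chi n ^ (p ^ (k-1)) = 1"
      using dirichlet_character_cong[OF d] dirichlet_character_power[OF d] dirichlet_character_one[OF d]
      by metis
    moreover have "coprime n (int p)" using cong_imp_coprime[OF cong_sym[OF that]] by simp
    hence "\<not> int p dvd n" using copp by simp
    hence "chi n = 1 \<or> chi n = -1" using real_character_cases[OF d r] cop by blast
    moreover have "odd (p ^ (k-1))" using p by simp
    ultimately show ?thesis by auto
  qed
  have cong: "chi m = chi n" if mn: "[m = n] (mod int p)" for m n
  proof (cases "int p dvd n")
    case True
    hence "int p dvd m" using cong_dvd_iff[OF mn] mn True by (meson cong_0_iff cong_trans)
    thus ?thesis using True cop dirichlet_character_eq_0_iff[OF d] by metis
  next
    case False
    then obtain n' where n': "[n * n' = 1] (mod int (p^k))" "chi n * chi n' = 1"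
      using dirichlet_character_unit_inverse[OF d] cop by metis
    have "[n * n' = 1] (mod int p)" using n'(1) k by (auto intro: cong_dvd_modulus simp: dvd_power)
    hence "[m * n' = 1] (mod int p)" using mn by (metis cong_scalar_right cong_trans)
    hence "chi m * chi n' = 1" using unit dirichlet_character_mult[OF d] by metis
    hence "chi m * chi n' = chi n * chi n'" using n'(2) by simp
    moreover have "chi n' \<noteq> 0" using n'(2) by auto
    ultimately show ?thesis by simp
  qed
  have dp: "dirichlet_character p chi"
  proof (rule dirichlet_characterI)
    show "chi (n + int p) = chi n" for n by (rule cong) (simp add: cong_def)
    show "chi n \<noteq> 0 \<longleftrightarrow> coprime n (int p)" for n
      using dirichlet_character_eq_0_iff[OF d, of n] cop[of n] copp[of n] by blast
  qed (use p dirichlet_character_mult[OF d] in \<open>auto simp: prime_gt_0_nat\<close>)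
  have "p = p ^ k"
    by (rule primitive_not_induced[OF P _ dp]) (use k in auto)
  hence k1: "k = 1" using p prime_gt_1_nat power_inject_exp[of p 1 k] by auto
  have pc: "int p dvd n \<Longrightarrow> chi n = 0" for n
    using dirichlet_character_eq_0_iff[OF d] cop by blast
  have sq: "chi n = 1" if n: "QuadRes (int p) n" "\<not> int p dvd n" for n
  proof -
    obtain y where y: "[y^2 = n] (mod int p)" using n by (auto simp: QuadRes_def)
    have "\<not> int p dvd y"
    proof
      assume "int p dvd y"
      hence "int p dvd y^2" by (simp add: power2_eq_square)
      thus False using n(2) y by (meson cong_0_iff cong_sym cong_trans)
    qed
    hence "chi y = 1 \<or> chi y = -1" using real_character_cases[OF d r] cop by blast
    hence "chi (y^2) = 1" using dirichlet_character_power[OF d] by auto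
    thus ?thesis using cong[OF y] by simp
  qed
  have ex: "\<exists>g. chi g = -1"
  proof (rule ccontr)
    assume "\<nexists>g. chi g = -1"
    hence *: "chi n = 1" if "coprime n (int (p^k))" for n using real_character_cases[OF d r that] by auto
    have "1 = p ^ k" by (rule primitive_not_induced[OF P, of 1 "\<lambda>_. 1"]) 
      (use * real_primitive_one_iff in \<open>auto dest: real_primitiveD\<close>)
    thus False using k1 p2 by simp
  qed
  then obtain g where g: "chi g = -1" by blast
  have gp: "\<not> int p dvd g" using g pc by fastforce
  have euler: "[Legendre n p = n ^ ((p-1) div 2)] (mod int p)" for n
    using euler_criterion[OF p(1) p2] by simp
  \<comment> \<open>Euler's criterion gives multiplicativity modulo \<open>p\<close> only; the two
    sides differ by at most 2 in absolute value, which is less than \<open>p\<close>.\<close>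
  have Lmult: "Legendre (m * n) p = Legendre m p * Legendre n p" for m n
  proof -
    have "[Legendre (m * n) p = Legendre m p * Legendre n p] (mod int p)"
      using cong_trans[OF euler[of "m*n"]] cong_sym[OF cong_mult[OF euler[of m] euler[of n]]]
      by (simp add: power_mult_distrib)
    hence "int p dvd Legendre (m * n) p - Legendre m p * Legendre n p"
      by (simp add: cong_iff_dvd_diff)
    moreover have "\<bar>Legendre (m * n) p - Legendre m p * Legendre n p\<bar> \<le> 2"
      by (auto simp: Legendre_def)
    ultimately show ?thesis using p2 zdvd_imp_le[of "int p" "\<bar>Legendre (m * n) p - Legendre m p * Legendre n p\<bar>"] by auto
  qed
  have Lcases: "\<not> int p dvd n \<Longrightarrow> Legendre n p = 1 \<and> QuadRes p n \<or> Legendre n p = -1 \<and> \<not> QuadRes p n" for n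
    by (auto simp: Legendre_def cong_0_iff)
  have "chi n = of_int (Legendre n (int p))" for n
  proof (cases "int p dvd n")
    case True thus ?thesis by (simp add: pc Legendre_def cong_0_iff)
  next
    case np: False
    show ?thesis
    proof (cases "QuadRes p n")
      case True thus ?thesis using sq[OF True np] Lcases[OF np] by auto
    next
      case False
      \<comment> \<open>Since \<open>chi\<close> is 1 on squares, \<open>g\<close> is a nonresidue;
        a nonresidue times \<open>g\<close> is a residue, where the value of \<open>chi\<close> is
        already known.\<close>
      have "Legendre (n * g) p = 1"
        using Lmult[of n g] Lcases[OF np] Lcases[OF gp] False sq[of g] gp g by auto
      moreover have "\<not> int p dvd n * g" using np gp p(1) by (simp add: prime_dvd_mult_iff)
      ultimately have "chi (n * g) = 1" using sq Lcases by fastforce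
      thus ?thesis using g Lcases[OF np] False dirichlet_character_mult[OF d, of n g]
        by (simp add: minus_equation_iff)
    qed
  qed
  thus ?thesis using k1 by auto
qed

text \<open>\<open>chi4\<close> and \<open>chi8\<close> are the Kronecker symbols of discriminant -4
  and 8; their product is the one of discriminant -8.\<close>

definition chi4 :: "int \<Rightarrow> complex" where
  "chi4 n = (if n mod 4 = 1 then 1 else if n mod 4 = 3 then -1 else 0)"

definition chi8 :: "int \<Rightarrow> complex" where
  "chi8 n = (if n mod 8 = 1 \<or> n mod 8 = 7 then 1 else if n mod 8 = 3 \<or> n mod 8 = 5 then -1 else 0)"

text \<open>Lifting of square roots at the prime 2. If the square of \<open>x\<close> misses
  \<open>n\<close> by \<open>2 ^ (k + 3) * t\<close>, then the correction
  \<open>2 ^ (k + 2) * t\<close> leaves an error with the factor \<open>t + x * t\<close>, which is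
  even because \<open>x\<close> is odd.\<close>

lemma exists_sqrt_mod_two_power:
  assumes "[n = 1] (mod (8::int))"
  shows "\<exists>x. odd x \<and> [x\<^sup>2 = n] (mod 2 ^ (k + 3))"
proof (induction k)
  case 0
  show ?case using assms by (intro exI[of _ 1]) (auto simp: cong_sym_eq)
next
  case (Suc k)
  then obtain x t where x: "odd x" "x\<^sup>2 = n + 2 ^ (k + 3) * t"
    using cong_iff_lin[of n _ "2 ^ (k + 3)"] by (auto simp: cong_sym_eq)
  define y where "y = x + 2 ^ (k + 2) * t"
  obtain s where s: "x = 2 * s + 1" using x(1) by (elim oddE)
  have "y\<^sup>2 - n = 2 ^ (k+3) * (t + x * t + 2 ^ (k+1) * t\<^sup>2)"
    using x(2) by (simp add: y_def power2_sum power_add power2_eq_square algebra_simps)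
  also have "t + x * t = 2 * (t * (s + 1))" by (simp add: s algebra_simps)
  also have "2 ^ (k+3) * (2 * (t * (s + 1)) + 2 ^ (k+1) * t\<^sup>2)
      = 2 ^ (Suc k + 3) * (t * (s + 1) + 2 ^ k * t\<^sup>2)" by (simp add: power_add algebra_simps)
  finally have "[y\<^sup>2 = n] (mod 2 ^ (Suc k + 3))" by (simp add: cong_iff_dvd_diff)
  moreover have "odd y" using x(1) by (simp add: y_def)
  ultimately show ?case by blast
qed

text \<open>Every number that is 1 modulo 8 is a square modulo \<open>2 ^ k\<close>, and
  \<open>chi\<close> is 1 on odd squares. So \<open>chi\<close> has period 8, \<open>k\<close> is at
  most 3, and the values at 3 and 5 determine everything, the value at 7 being their
  product.\<close>

lemma real_primitive_two_power:
  assumes rp: "real_primitive (2 ^ k) chi" and k: "k > 0"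
  shows "k = 2 \<and> chi = chi4 \<or> k = 3 \<and> (chi = chi8 \<or> chi = (\<lambda>n. chi4 n * chi8 n))"
proof -
  have d: "dirichlet_character (2 ^ k) chi" and r: "real_character chi"
    and P: "primitive_dirichlet_character (2 ^ k) chi" using rp by (auto dest: real_primitiveD)
  have cop: "coprime n (int (2 ^ j)) \<longleftrightarrow> odd n" if "j > 0" for n j
    using that by (simp add: coprime_commute)
  have even0: "even n \<Longrightarrow> chi n = 0" for n
    using dirichlet_character_eq_0_iff[OF d, of n] cop[OF k, of n] by blast
  have odd1: "odd n \<Longrightarrow> chi n = 1 \<or> chi n = -1" for n
    using real_character_cases[OF d r, of n] cop[OF k, of n] by blast
  have unit: "chi n = 1" if n: "[n = 1] (mod 8)" for n
  proof -
    obtain x where x: "odd x" "[x\<^sup>2 = n] (mod 2 ^ (k + 3))"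
      using exists_sqrt_mod_two_power[OF n] by blast
    have "[x\<^sup>2 = n] (mod int (2 ^ k))"
      by (rule cong_dvd_modulus[OF x(2)]) (simp add: power_add)
    hence "chi n = chi x ^ 2"
      using dirichlet_character_cong[OF d] dirichlet_character_power[OF d] by metis
    thus ?thesis using odd1[OF x(1)] by auto
  qed
  have per: "chi m = chi n" if mn: "[m = n] (mod 8)" for m n
  proof (cases "even n")
    case True
    hence "even m" using mn
unfolding cong_def by presburger
    thus ?thesis using True even0 by simp
  next
    case False
    \<comment> \<open>Odd numbers are their own inverses modulo 8, so \<open>m * n\<close> and
      \<open>n * n\<close> both reduce to 1.\<close>
    have "n mod 8 = 1 \<or> n mod 8 = 3 \<or> n mod 8 = 5 \<or> n mod 8 = 7" using False by presburger
    moreover have "n * n mod 8 = (n mod 8) * (n mod 8) mod 8" by (simp add: mod_mult_eq)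
    ultimately have "[n * n = 1] (mod 8)" by (auto simp: cong_def)
    moreover from this have "[m * n = 1] (mod 8)" using mn by (meson cong_scalar_right cong_trans)
    ultimately have "chi (m * n) = chi (n * n)" using unit by metis
    moreover have "chi n \<noteq> 0" using odd1[OF False] by auto
    ultimately show ?thesis by (simp add: dirichlet_character_mult[OF d])
  qed
  have dc: "dirichlet_character (2 ^ j) chi" if "j > 0" "\<And>n. chi (n + 2 ^ j) = chi n" for j
  proof (rule dirichlet_characterI)
    show "chi (n + int (2 ^ j)) = chi n" for n using that(2)[of n] by simp
    show "chi n \<noteq> 0 \<longleftrightarrow> coprime n (int (2 ^ j))" for n
      using odd1[of n] even0[of n] cop[OF that(1), of n] by auto
  qed (use dirichlet_character_mult[OF d] in auto)
  have k3: "k \<le> 3"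
  proof (rule ccontr)
    assume "\<not> k \<le> 3"
    moreover have "dirichlet_character (2 ^ 3) chi"
      by (rule dc) (auto intro: per simp: cong_def)
    moreover have "(2::nat) ^ 3 dvd 2 ^ k" using \<open>\<not> k \<le> 3\<close> by (intro le_imp_power_dvd) auto
    ultimately have "(2::nat) ^ 3 = 2 ^ k" using primitive_not_induced[OF P] by blast
    thus False using \<open>\<not> k \<le> 3\<close> using power_strict_increasing[of 3 k "2::nat"] by simp
  qed
  have one: "chi 1 = 1" by (rule dirichlet_character_one[OF d])
  have c7: "chi 7 = chi 3 * chi 5"
    using per[of "3*5" 7] dirichlet_character_mult[OF d, of 3 5] by (simp add: cong_def)
  have red: "chi n = chi (n mod 8)" for n by (rule per) (simp add: cong_def)
  have m8: "even n \<or> n mod 8 = 1 \<or> n mod 8 = 3 \<or> n mod 8 = 5 \<or> n mod 8 = 7" for n :: int by presburger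
  have nontriv: "\<not> (chi 3 = 1 \<and> chi 5 = 1)"
  proof
    assume *: "chi 3 = 1 \<and> chi 5 = 1"
    have "chi n = 1" if "odd n" for n
      using m8[of n] that * c7 one by (subst red) auto
    hence "1 = (2::nat) ^ k"
      using cop[OF k] real_primitive_one_iff
      by (intro primitive_not_induced[OF P, of 1 "\<lambda>_. 1"]) (auto dest: real_primitiveD)
    thus False using k power_strict_increasing[of 0 k "2::nat"] by simp
  qed
  have cases: "k = 1 \<or> k = 2 \<or> k = 3" using k k3 by auto
  have eqI: "chi = f" if "\<And>n. f n = f (n mod 8)" "\<And>n. even n \<Longrightarrow> f n = 0"
    "f 1 = 1" "f 3 = chi 3" "f 5 = chi 5" "f 7 = chi 3 * chi 5" for f
  proof
    fix n
    have "odd n \<Longrightarrow> chi (n mod 8) = f (n mod 8)" using m8[of n] that(3-6) one c7 by auto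
    thus "chi n = f n" using red[of n] that(1)[of n] that(2)[of n] even0[of n] by (cases "even n") auto
  qed
  have small: "chi 5 = 1" if "k \<le> 2"
  proof -
    have "int (2 ^ k) dvd 2 ^ 2" using le_imp_power_dvd[OF that, of "2::int"] by simp
    hence "[5 = 1] (mod int (2 ^ k))" by (simp add: cong_iff_dvd_diff)
    thus ?thesis using dirichlet_character_cong[OF d, of 5 1] one by simp
  qed
  have c3: "chi 3 = 1 \<or> chi 3 = -1" and c5: "chi 5 = 1 \<or> chi 5 = -1" by (rule odd1; simp)+
  have e4: "chi4 n = chi4 (n mod 8)" for n :: int
    by (simp add: chi4_def mod_mod_cancel)
  have e4': "even n \<Longrightarrow> chi4 n = 0" for n
    by (auto simp: chi4_def; presburger)
  have e8': "even n \<Longrightarrow> chi8 n = 0" for n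
    by (auto simp: chi8_def; presburger)
  consider "k = 1" | "k = 2" | "k = 3" using cases by blast
  thus ?thesis
  proof cases
    case 1
    hence "[3 = 1] (mod int (2 ^ k))" by (simp add: cong_iff_dvd_diff)
    hence "chi 3 = 1" using dirichlet_character_cong[OF d, of 3 1] one by simp
    moreover have "chi 5 = 1" using small 1 by simp
    ultimately show ?thesis using nontriv by blast
  next
    case 2
    have "chi = chi4"
      by (rule eqI[where f = chi4, OF e4 e4']) (use 2 small nontriv c3 in \<open>auto simp: chi4_def\<close>)
    thus ?thesis using 2 by simp
  next
    case 3
    \<comment> \<open>The value 1 at 5 would give period 4, as \<open>n + 4\<close> equals
      \<open>5 * n\<close> modulo 8 for odd \<open>n\<close>; this contradicts primitivity modulo
      8.\<close>
    have "chi 5 = -1"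
    proof (rule ccontr)
      assume "chi 5 \<noteq> -1"
      hence c51: "chi 5 = 1" using c5 by simp
      have "dirichlet_character (2 ^ 2) chi"
      proof (rule dc)
        fix n :: int
        show "chi (n + 2 ^ 2) = chi n"
        proof (cases "even n")
          case False
          have "[n + 4 = 5 * n] (mod 8)" using False by (auto simp: cong_iff_dvd_diff elim!: oddE)
          hence "chi (n + 4) = chi 5 * chi n" using per dirichlet_character_mult[OF d] by metis
          thus ?thesis using c51 by simp
        qed (simp add: even0)
      qed auto
      moreover have "(2::nat) ^ 2 dvd 2 ^ k" using 3 by simp
      ultimately have "(2::nat) ^ 2 = 2 ^ k" using primitive_not_induced[OF P] by blast
      thus False using 3 by simp
    qed
    note c51 = this
    from c3 have "chi = chi8 \<or> chi = (\<lambda>n. chi4 n * chi8 n)"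
    proof
      assume "chi 3 = -1"
      hence "chi = chi8" by (intro eqI e8') (use c51 in \<open>auto simp: chi8_def\<close>)
      thus ?thesis by blast
    next
      assume c31: "chi 3 = 1"
      have "chi = (\<lambda>n. chi4 n * chi8 n)"
      proof (rule eqI)
        show "chi4 n * chi8 n = chi4 (n mod 8) * chi8 (n mod 8)" for n
          by (subst e4) (simp add: chi8_def)
      qed (use c31 c51 e8' in \<open>auto simp: chi8_def chi4_def\<close>)
      thus ?thesis by blast
    qed
    thus ?thesis using 3 by simp
  qed
qed

text \<open>Reduces a statement that is stable under coprime products to Legendre symbols and three
  characters of modulus 4 or 8. The induction splits off the full power of one prime; the factor at
  that prime is again primitive and therefore one of these.\<close>

theorem real_primitive_induct [consumes 1, case_names one odd_prime four eight eight' times]: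
  fixes P :: "nat \<Rightarrow> (int \<Rightarrow> complex) \<Rightarrow> bool"
  assumes rp: "real_primitive q chi"
    and one: "P 1 (\<lambda>_. 1)"
    and odd_prime: "\<And>p. prime p \<Longrightarrow> odd p \<Longrightarrow> real_primitive p (\<lambda>n. of_int (Legendre n (int p))) \<Longrightarrow>
           P p (\<lambda>n. of_int (Legendre n (int p)))"
    and four: "real_primitive 4 chi4 \<Longrightarrow> P 4 chi4"
    and eight: "real_primitive 8 chi8 \<Longrightarrow> P 8 chi8"
    and eight': "real_primitive 8 (\<lambda>n. chi4 n * chi8 n) \<Longrightarrow> P 8 (\<lambda>n. chi4 n * chi8 n)"
    and times: "\<And>q1 q2 chi1 chi2. coprime q1 q2 \<Longrightarrow> real_primitive q1 chi1 \<Longrightarrow> real_primitive q2 chi2 \<Longrightarrow>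
           P q1 chi1 \<Longrightarrow> P q2 chi2 \<Longrightarrow> P (q1 * q2) (\<lambda>n. chi1 n * chi2 n)"
  shows "P q chi"
  using rp
proof (induction q arbitrary: chi rule: less_induct)
  case (less q)
  have q: "q > 0" using less.prems by (auto dest: real_primitiveD dirichlet_character_modulus_pos)
  show ?case
  proof (cases "q = 1")
    case True
    thus ?thesis using less.prems one real_primitive_one_iff by simp
  next
    case False
    then obtain p where p: "prime p" "p dvd q" using prime_factor_nat by blast
    define k where "k = multiplicity p q"
    obtain m where m: "q = p ^ k * m" "\<not> p dvd m"
      using multiplicity_decompose'[of q p] q p prime_gt_1_nat[OF p(1)] unfolding k_def by auto
    have k: "k > 0" using p q by (simp add: k_def prime_multiplicity_gt_zero_iff)
    have cop: "coprime (p ^ k) m" using m(2) p(1) by (simp add: prime_imp_coprime)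
    obtain chi1 chi2 where c: "real_primitive (p ^ k) chi1" "real_primitive m chi2"
      "\<And>n. chi n = chi1 n * chi2 n"
      using real_primitive_factor[OF less.prems[unfolded m(1)] cop] by blast
    have "P (p ^ k) chi1"
    proof (cases "odd p")
      case True
      hence "k = 1 \<and> chi1 = (\<lambda>n. of_int (Legendre n (int p)))"
        using real_primitive_odd_prime_power[OF c(1) p(1) _ k] by blast
      thus ?thesis using odd_prime[OF p(1) True] c(1) by auto
    next
      case False
      hence "p = 2" using p(1) prime_odd_nat prime_ge_2_nat[of p] by force
      thus ?thesis
        using real_primitive_two_power[of k chi1] c(1) k four eight eight' by auto
    qed
    moreover have "m < q" using m q k p(1) prime_gt_1_nat[of p] one_less_power[of p k] by simp
    hence "P m chi2" using less.IH c(2) by blast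
    ultimately have "P (p ^ k * m) (\<lambda>n. chi1 n * chi2 n)" using times[OF cop c(1,2)] by blast
    moreover have "chi = (\<lambda>n. chi1 n * chi2 n)" using c(3) by auto
    ultimately show ?thesis using m(1) by simp
  qed
qed

section \<open>Supplementary laws and reciprocity for coprime real characters\<close>

lemma Legendre_eqI:
  assumes "prime p" "2 < p" "[Legendre a (int p) = x] (mod int p)" "x = 1 \<or> x = -1"
  shows "Legendre a (int p) = x"
proof -
  have "int p dvd Legendre a (int p) - x" using assms(3) by (simp add: cong_iff_dvd_diff)
  moreover have "Legendre a (int p) \<in> {-1, 0, 1}" by (simp add: Legendre_def)
  hence "\<bar>Legendre a (int p) - x\<bar> \<le> 2" using assms(4) by auto
  ultimately have "Legendre a (int p) - x = 0"
    using assms(2) dvd_imp_le_int[of "Legendre a (int p) - x" "int p"] by force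
  thus ?thesis by simp
qed

lemma Legendre_minus_one:
  assumes "prime p" "2 < p"
  shows "Legendre (-1) (int p) = (-1) ^ ((p - 1) div 2)"
  using euler_criterion[OF assms, of "-1"]
  by (intro Legendre_eqI[OF assms]) (auto simp: minus_one_power_iff)

text \<open>Gauss's lemma with multiplier 2. For \<open>x\<close> up to \<open>(p - 1) / 2\<close>
  the number \<open>2 * x\<close> stays below \<open>p\<close>, so the exceptional set consists of
  the \<open>x\<close> above \<open>(p - 1) / 4\<close>; the parity of its size is read off from
  \<open>p\<close> modulo 8.\<close>

lemma Legendre_two:
  assumes "prime p" "2 < p"
  shows "of_int (Legendre 2 (int p)) = chi8 (int p)"
proof -
  have odd: "odd p" using assms prime_odd_nat by blast
  interpret GAUSS p 2
    by standard (use assms in \<open>auto simp: cong_def\<close>)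
  have C: "C = (\<lambda>x. x * 2) ` A" unfolding C_def B_def image_image
  proof (rule image_cong[OF refl])
    fix x assume "x \<in> A"
    thus "x * 2 mod int p = x * 2" by (intro mod_pos_pos_trivial) (auto simp: A_def)
  qed
  have "E = (\<lambda>x. x * 2) ` {(int p - 1) div 4 <.. (int p - 1) div 2}"
    unfolding E_def C A_def using assms(2) by (auto simp: image_iff)
  hence card: "card E = nat ((int p - 1) div 2 - (int p - 1) div 4)"
    by (simp add: card_image inj_on_def)
  define k where "k = int p div 8"
  have p8: "int p mod 8 = 1 \<or> int p mod 8 = 3 \<or> int p mod 8 = 5 \<or> int p mod 8 = 7"
    using odd by presburger
  have pk: "int p = 8 * k + int p mod 8" and k0: "k \<ge> 0" by (auto simp: k_def)
  have L: "Legendre 2 (int p) = (-1) ^ card E" by (rule gauss_lemma)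
  show ?thesis using p8
  proof (elim disjE)
    assume m: "int p mod 8 = 1"
    have "card E = nat (2 * k)" unfolding card using pk m by (simp add: algebra_simps)
    thus ?thesis using m k0 by (simp add: L chi8_def even_nat_iff minus_one_power_iff)
  next
    assume m: "int p mod 8 = 3"
    have "card E = nat (2 * k + 1)" unfolding card using pk m by (simp add: algebra_simps)
    thus ?thesis using m k0 by (simp add: L chi8_def even_nat_iff minus_one_power_iff)
  next
    assume m: "int p mod 8 = 5"
    have "card E = nat (2 * k + 1)" unfolding card using pk m by (simp add: algebra_simps)
    thus ?thesis using m k0 by (simp add: L chi8_def even_nat_iff minus_one_power_iff)
  next
    assume m: "int p mod 8 = 7"
    have "card E = nat (2 * k + 2)" unfolding card using pk m by (simp add: algebra_simps)
    thus ?thesis using m k0 by (simp add: L chi8_def even_nat_iff minus_one_power_iff)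
  qed
qed

text \<open>Quadratic reciprocity with the sign expressed by the two parities alone. As parities
  multiply, this form passes to products of characters.\<close>

definition reciprocal :: "nat \<Rightarrow> (int \<Rightarrow> complex) \<Rightarrow> nat \<Rightarrow> (int \<Rightarrow> complex) \<Rightarrow> bool" where
  "reciprocal q1 chi1 q2 chi2 \<longleftrightarrow>
     chi1 (int q2) * chi2 (int q1) = (if chi1 (-1) = -1 \<and> chi2 (-1) = -1 then -1 else 1)"

lemma reciprocal_commute: "reciprocal q1 chi1 q2 chi2 \<longleftrightarrow> reciprocal q2 chi2 q1 chi1"
  by (auto simp: reciprocal_def mult.commute)

lemma reciprocal_one: "dirichlet_character q chi \<Longrightarrow> reciprocal q chi 1 (\<lambda>_. 1)"
  by (simp add: reciprocal_def dirichlet_character_one)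

lemma reciprocal_times:
  assumes "dirichlet_character q chi" "dirichlet_character q1 chi1" "dirichlet_character q2 chi2"
    and "reciprocal q chi q1 chi1" "reciprocal q chi q2 chi2"
  shows "reciprocal q chi (q1 * q2) (\<lambda>n. chi1 n * chi2 n)"
proof -
  have "chi (int (q1 * q2)) * (chi1 (int q) * chi2 (int q))
      = (chi (int q1) * chi1 (int q)) * (chi (int q2) * chi2 (int q))"
    by (simp add: dirichlet_character_mult[OF assms(1)])
  thus ?thesis using assms(4,5) dirichlet_character_minus_one[OF assms(1)]
      dirichlet_character_minus_one[OF assms(2)] dirichlet_character_minus_one[OF assms(3)]
    unfolding reciprocal_def by auto
qed

text \<open>Quadratic reciprocity for primes and the supplementary laws for -1 and 2 are the base
  cases of the induction over the second character; \<open>reciprocal_times\<close> does the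
  rest.\<close>

lemma reciprocal_odd_prime:
  assumes p: "prime p" "odd p" and rp: "real_primitive p (\<lambda>n. of_int (Legendre n (int p)))"
    and q: "real_primitive q chi" and cop: "coprime p q"
  shows "reciprocal p (\<lambda>n. of_int (Legendre n (int p))) q chi"
  using q cop
proof (induction rule: real_primitive_induct)
  case one
  show ?case using rp by (intro reciprocal_one) (auto dest: real_primitiveD)
next
  have p2: "p > 2" using p prime_ge_2_nat[of p] by (cases "p = 2") auto
  define a where "a = (p - 1) div 2"
  have m1: "Legendre (-1) (int p) = (-1) ^ a" using Legendre_minus_one[OF p(1) p2] by (simp add: a_def)
  have Lm: "Legendre (m * n) (int p) = Legendre m (int p) * Legendre n (int p)" for m n
    using dirichlet_character_mult[OF real_primitiveD(1)[OF rp], of m n]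
    by (metis of_int_eq_iff of_int_mult)
  have L2: "Legendre 2 (int p) * Legendre 2 (int p) = 1"
    using p2 by (auto simp: Legendre_def cong_def)
  have L4: "Legendre 4 (int p) = 1" using Lm[of 2 2] L2 by simp
  have L8: "of_int (Legendre 8 (int p)) * chi8 (int p) = 1"
    using Lm[of 2 4] L4 L2 by (simp add: Legendre_two[OF p(1) p2, symmetric] flip: of_int_mult)
  have p4: "int p mod 4 = 1 \<or> int p mod 4 = 3" using p(2) by presburger
  have c4: "chi4 (int p) = (-1) ^ a"
  proof -
    have "p = 2 * a + 1" using p(2) p2 by (auto simp: a_def elim!: oddE)
    hence "int p = 2 * int a + 1" by simp
    moreover have "even a \<Longrightarrow> (2 * int a + 1) mod 4 = 1" "odd a \<Longrightarrow> (2 * int a + 1) mod 4 = 3"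
      by presburger+
    ultimately show ?thesis by (cases "even a") (auto simp: chi4_def)
  qed
  have c: "chi4 (-1) = -1" "chi8 (-1) = 1" by (auto simp: chi4_def chi8_def)
  have a: "(-1::complex) ^ a = 1 \<or> (-1::complex) ^ a = -1" by (simp add: minus_one_power_iff)
  {
    case four
    show ?case using a by (auto simp: reciprocal_def L4 c c4 m1)
  next
    case eight
    show ?case using L8 by (auto simp: reciprocal_def c)
  next
    case eight'
    show ?case using L8 a by (auto simp: reciprocal_def c c4 m1 mult.assoc mult.left_commute)
  next
    case (odd_prime l)
    have l2: "l > 2" using odd_prime prime_ge_2_nat[of l] by (cases "l = 2") auto
    define b where "b = (l - 1) div 2"
    have ne: "p \<noteq> l" using odd_prime by auto
    have "Legendre (int p) (int l) * Legendre (int l) (int p) = (-1) ^ (a * b)"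
      using Quadratic_Reciprocity[OF p(1) p2 odd_prime(1) l2 ne] by (simp add: a_def b_def)
    hence "of_int (Legendre (int l) (int p)) * of_int (Legendre (int p) (int l)) = (-1::complex) ^ (a * b)"
      by (metis mult.commute of_int_mult of_int_power of_int_minus of_int_1)
    moreover have "Legendre (-1) (int l) = (-1) ^ b"
      using Legendre_minus_one[OF odd_prime(1) l2] by (simp add: b_def)
    ultimately show ?case using m1
      by (auto simp: reciprocal_def minus_one_power_iff simp flip: of_int_mult split: if_splits)
  next
    case (times q1 q2 chi1 chi2)
    thus ?case using rp by (intro reciprocal_times) (auto dest: real_primitiveD)
  }
qed

text \<open>A modulus coprime to an even one is odd, so the induction over \<open>chi\<close> meets
  only odd primes, where the previous case applies with the roles exchanged; the moduli 4 and 8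
  contradict coprimality.\<close>

lemma reciprocal_even:
  assumes "real_primitive q' psi" "even q'"
    and q: "real_primitive q chi" and cop: "coprime q' q"
  shows "reciprocal q' psi q chi"
  using q cop
proof (induction rule: real_primitive_induct)
  case one
  show ?case using assms(1) by (intro reciprocal_one) (auto dest: real_primitiveD)
next
  case (odd_prime p)
  have "reciprocal p (\<lambda>n. of_int (Legendre n (int p))) q' psi"
    by (rule reciprocal_odd_prime) (use odd_prime assms in \<open>auto simp: coprime_commute\<close>)
  thus ?case by (simp add: reciprocal_commute)
next
  case (times q1 q2 chi1 chi2)
  thus ?case using assms(1) by (intro reciprocal_times) (auto dest: real_primitiveD)
qed (use assms(2) coprime_common_divisor_nat[of q' _ 2] in force)+

theorem real_primitive_reciprocity:
  assumes "real_primitive q1 chi1" "real_primitive q2 chi2" "coprime q1 q2"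
  shows "reciprocal q1 chi1 q2 chi2"
  using assms(1,3)
proof (induction rule: real_primitive_induct)
  case one
  show ?case using assms(2) reciprocal_one reciprocal_commute by (blast dest: real_primitiveD)
next
  case (odd_prime p)
  thus ?case using reciprocal_odd_prime assms(2) by blast
next
  case (times r1 r2 c1 c2)
  have "reciprocal q2 chi2 (r1 * r2) (\<lambda>n. c1 n * c2 n)"
    by (rule reciprocal_times) (use times assms in \<open>auto simp: reciprocal_commute dest: real_primitiveD\<close>)
  thus ?case by (simp add: reciprocal_commute)
qed (use assms(2) in \<open>auto intro!: reciprocal_even\<close>)

section \<open>A lower bound for a Gauss sum over odd squares\<close>

lemma sin_ge_linear:
  assumes "0 \<le> x" "x \<le> pi / 2"
  shows "2 * x / pi \<le> sin x"
proof -
  have "concave_on {0..pi/2} (sin :: real \<Rightarrow> real)"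
    by (rule f''_le0_imp_concave[where f' = cos and f'' = "\<lambda>x. - sin x"])
       (auto intro!: derivative_eq_intros sin_ge_zero)
  hence "(1 - 2 * x / pi) * sin 0 + (2 * x / pi) * sin (pi / 2)
      \<le> sin ((1 - 2 * x / pi) *\<^sub>R 0 + (2 * x / pi) *\<^sub>R (pi / 2))"
    using assms by (intro concave_onD[where A = "{0..pi/2}"]) (auto simp: field_simps)
  thus ?thesis by simp
qed

lemma norm_sum_telescope_le:
  fixes w :: "nat \<Rightarrow> real" and E :: "nat \<Rightarrow> complex"
  assumes "J < m" and w0: "\<And>j. j < m \<Longrightarrow> w j \<ge> 0"
    and dec: "\<And>j. Suc j < m \<Longrightarrow> w (Suc j) \<le> w j" and E: "\<And>j. norm (E j) \<le> 1"
  shows "norm (\<Sum>j=J..<m. of_real (w j) * (E (Suc j) - E j)) \<le> 2 * w J"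
proof -
  define S where "S = (\<lambda>n. \<Sum>j=J..<n. of_real (w j) * (E (Suc j) - E j))"
  \<comment> \<open>After removal of the boundary term \<open>w n * E (Suc n)\<close> each further
    summand costs exactly the drop \<open>w n - w (Suc n)\<close>, so the bound telescopes.\<close>
  have *: "norm (S (Suc n) - of_real (w n) * E (Suc n)) \<le> 2 * w J - w n" if "J \<le> n" "n < m" for n
    using that
  proof (induction n rule: dec_induct)
    case base
    have "S (Suc J) - of_real (w J) * E (Suc J) = - of_real (w J) * E J"
      by (simp add: S_def algebra_simps)
    thus ?case using base w0[of J] E[of J] mult_left_le[of "norm (E J)" "w J"] by (simp add: norm_mult)
  next
    case (step n)
    have "S (Suc (Suc n)) - of_real (w (Suc n)) * E (Suc (Suc n))
        = (S (Suc n) - of_real (w n) * E (Suc n)) + of_real (w n - w (Suc n)) * E (Suc n)"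
      using step by (simp add: S_def algebra_simps)
    also have "norm \<dots> \<le> (2 * w J - w n) + (w n - w (Suc n))"
    proof (intro norm_triangle_mono)
      have "norm (complex_of_real (w n - w (Suc n)) * E (Suc n)) \<le> (w n - w (Suc n)) * 1"
        unfolding norm_mult norm_of_real using dec[of n] step E[of "Suc n"] by (intro mult_mono) auto
      thus "norm (complex_of_real (w n - w (Suc n)) * E (Suc n)) \<le> w n - w (Suc n)" by simp
    qed (use step in auto)
    finally show ?case by simp
  qed
  obtain n where n: "m = Suc n" "J \<le> n" using assms(1) by (cases m) auto
  have "norm (S m) \<le> norm (S m - of_real (w n) * E m) + norm (of_real (w n) * E m)"
    using norm_triangle_ineq[of "S m - of_real (w n) * E m" "of_real (w n) * E m"] by simp
  also have "norm (of_real (w n) * E m) \<le> w n"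
    using w0[of n] E[of m] mult_left_le[of "norm (E m)" "w n"] n by (simp add: norm_mult)
  finally show ?thesis using *[of n] n by (simp add: S_def)
qed

text \<open>The even squares next to \<open>(2 j + 1)^2\<close> differ from it by 1 plus or minus
  \<open>2 (2 j + 1)\<close>. Hence each term is a weight \<open>1 / (2 sin)\<close> times a
  difference of two consecutive unimodular numbers. The angles stay within \<open>pi / 2\<close>, so
  the weights decrease and the first one controls the sum; Jordan's inequality estimates it.\<close>

lemma norm_sum_cis_squares_le:
  assumes "p = 2 * m + 1" "J < m"
  shows "norm (\<Sum>j=J..<m. cis (pi * (2 * real j + 1)\<^sup>2 / (4 * real p))) \<le> real p / (2 * real J + 1)"
proof -
  define \<theta> where "\<theta> = pi / (4 * real p)"
  have p: "real p > 0" using assms by simp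
  define w where "w = (\<lambda>j. 1 / (2 * sin (2 * \<theta> * (2 * real j + 1))))"
  define E where "E = (\<lambda>j. - \<i> * cis (-\<theta>) * cis (\<theta> * (2 * real j)\<^sup>2))"
  have ang: "0 < 2 * \<theta> * (2 * real j + 1)" "2 * \<theta> * (2 * real j + 1) \<le> pi / 2" if "j < m" for j
  proof -
    have "real (2 * j + 1) \<le> real p" using assms(1) that by (intro of_nat_mono) auto
    hence "(2 * real j + 1) / real p \<le> 1" using p by (simp add: divide_simps)
    hence "pi / 2 * ((2 * real j + 1) / real p) \<le> pi / 2 * 1" by (intro mult_left_mono) auto
    thus "2 * \<theta> * (2 * real j + 1) \<le> pi / 2" by (simp add: \<theta>_def field_simps)
    show "0 < 2 * \<theta> * (2 * real j + 1)" using p by (simp add: \<theta>_def add_nonneg_pos)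
  qed
  have sin_pos: "sin (2 * \<theta> * (2 * real j + 1)) > 0" if "j < m" for j
    using ang[OF that] pi_gt_zero by (intro sin_gt_zero) linarith+
  have eq: "cis (\<theta> * (2 * real j + 1)\<^sup>2) = of_real (w j) * (E (Suc j) - E j)" if "j < m" for j
  proof -
    define u where "u = 2 * \<theta> * (2 * real j + 1)"
    define v where "v = \<theta> * (2 * real j + 1)\<^sup>2"
    have "- \<theta> + \<theta> * (2 * real (Suc j))\<^sup>2 = v + u" "- \<theta> + \<theta> * (2 * real j)\<^sup>2 = v - u"
      by (simp_all add: u_def v_def power2_eq_square algebra_simps)
    hence "E (Suc j) = - \<i> * cis (v + u)" "E j = - \<i> * cis (v - u)"
      by (simp_all only: E_def cis_mult mult.assoc)
    hence "E (Suc j) - E j = 2 * sin u * cis v"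
      by (simp add: complex_eq_iff cos_add sin_add cos_diff sin_diff)
    moreover have "sin u \<noteq> 0" using sin_pos[OF that] by (simp add: u_def)
    ultimately show ?thesis by (simp add: w_def flip: u_def v_def)
  qed
  have "norm (\<Sum>j=J..<m. of_real (w j) * (E (Suc j) - E j)) \<le> 2 * w J"
  proof (rule norm_sum_telescope_le[OF assms(2)])
    show "norm (E j) \<le> 1" for j by (simp add: E_def norm_mult)
    show "0 \<le> w j" if "j < m" for j using sin_pos[OF that] by (simp add: w_def)
    fix j assume j: "Suc j < m"
    have "2 * \<theta> * (2 * real j + 1) \<le> 2 * \<theta> * (2 * real (Suc j) + 1)"
      using p by (intro mult_left_mono) (auto simp: \<theta>_def)
    hence "sin (2 * \<theta> * (2 * real j + 1)) \<le> sin (2 * \<theta> * (2 * real (Suc j) + 1))"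
      using ang[of j] ang[of "Suc j"] j by (intro sin_monotone_2pi_le) auto
    thus "w (Suc j) \<le> w j"
      unfolding w_def using sin_pos[of j] sin_pos[of "Suc j"] j by (intro divide_left_mono) auto
  qed
  also have "2 * w J \<le> real p / (2 * real J + 1)"
  proof -
    have "(2 * real J + 1) / real p = 2 * (2 * \<theta> * (2 * real J + 1)) / pi"
      using p by (simp add: \<theta>_def field_simps)
    also have "\<dots> \<le> sin (2 * \<theta> * (2 * real J + 1))"
      using ang[OF assms(2)] by (intro sin_ge_linear) auto
    finally have "1 / sin (2 * \<theta> * (2 * real J + 1)) \<le> 1 / ((2 * real J + 1) / real p)"
      using p by (intro divide_left_mono mult_pos_pos sin_pos[OF assms(2)]) (auto intro!: divide_pos_pos add_nonneg_pos)
    thus ?thesis by (simp add: w_def)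
  qed
  also have "(\<Sum>j=J..<m. of_real (w j) * (E (Suc j) - E j)) = (\<Sum>j=J..<m. cis (pi * (2 * real j + 1)\<^sup>2 / (4 * real p)))"
    by (intro sum.cong refl) (simp add: eq[symmetric] \<theta>_def)
  finally show ?thesis .
qed

text \<open>For odd \<open>p\<close> this is \<open>cis (pi * p / 4)\<close> times the quadratic
  Gauss sum whose frequency is the inverse of 2 modulo \<open>p\<close>, after completing the
  square. The shifted form is symmetric and involves only odd squares.\<close>

definition half_gauss_sum :: "nat \<Rightarrow> complex" where
  "half_gauss_sum p = (\<Sum>r<p. cis (pi * (2 * real r - real p)\<^sup>2 / (4 * real p)))"

text \<open>\<open>2 r - p\<close> runs through the odd numbers from \<open>- p\<close> to
  \<open>p - 2\<close>. Opposite numbers give equal terms, and only \<open>- p\<close> has no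
  partner.\<close>

lemma half_gauss_sum_fold:
  assumes "p = 2 * m + 1"
  shows "half_gauss_sum p = cis (pi * real p / 4) + 2 * (\<Sum>j<m. cis (pi * (2 * real j + 1)\<^sup>2 / (4 * real p)))"
proof -
  define f where "f = (\<lambda>r::nat. cis (pi * (2 * real r - real p)\<^sup>2 / (4 * real p)))"
  define g where "g = (\<lambda>j::nat. cis (pi * (2 * real j + 1)\<^sup>2 / (4 * real p)))"
  have "half_gauss_sum p = f 0 + (\<Sum>r<m + m. f (Suc r))"
  proof -
    have "p = Suc (m + m)" using assms by simp
    thus ?thesis unfolding half_gauss_sum_def f_def by (simp only: sum.lessThan_Suc_shift)
  qed
  also have "(\<Sum>r<m + n. f (Suc r)) = (\<Sum>r<m. f (Suc r)) + (\<Sum>r<n. f (Suc (m + r)))" for n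
    by (induction n) (auto simp: algebra_simps)
  also have "(\<Sum>r<m. f (Suc (m + r))) = (\<Sum>j<m. g j)"
    by (intro sum.cong refl) (simp add: f_def g_def assms algebra_simps)
  also have "(\<Sum>r<m. f (Suc r)) = (\<Sum>r<m. f (Suc (m - Suc r)))"
    by (rule sum.nat_diff_reindex[symmetric])
  also have "\<dots> = (\<Sum>j<m. g j)"
  proof (intro sum.cong refl)
    fix r assume "r \<in> {..<m}"
    hence "real (Suc (m - Suc r)) = real m - real r" by auto
    thus "f (Suc (m - Suc r)) = g r" unfolding f_def g_def
      by (simp add: assms power2_eq_square algebra_simps)
  qed
  also have "f 0 = cis (pi * real p / 4)"
    by (simp add: f_def power2_eq_square)
  finally show ?thesis by (simp add: g_def)
qed

text \<open>Estermann's argument: the terms with \<open>(2 j + 1)\<^sup>2 \<le> 3 p\<close> have nonnegative projection on the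
  direction \<open>cis (pi / 4)\<close>, and the remaining oscillating tail is bounded by partial summation.\<close>

lemma half_gauss_sum_lower_bound:
  assumes p: "p = 2 * m + 1" and m: "m > 0"
  shows "Re (cis (-(pi/4)) * half_gauss_sum p) > - sqrt (real p)"
proof -
  define x where "x = sqrt (real p)"
  have x2: "x^2 = real p" and x0: "x > 0" using p by (auto simp: x_def)
  have p3: "real p \<ge> 3" using p m by simp
  have x1: "x > 1" using p3 by (simp add: x_def)
  define c where "c = (\<lambda>j::nat. cos (pi * (2 * real j + 1)\<^sup>2 / (4 * real p) - pi / 4))"
  have Re_eq: "Re (cis (-(pi/4)) * cis y) = cos (y - pi/4)" for y by (simp add: cis_mult)
  have "Re (cis (-(pi/4)) * half_gauss_sum p) = cos (pi * real p / 4 - pi/4) + 2 * (\<Sum>j<m. c j)"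
  proof -
    have "cis (-(pi/4)) * half_gauss_sum p = cis (-(pi/4)) * cis (pi * real p / 4)
       + of_real 2 * (\<Sum>j<m. cis (-(pi/4)) * cis (pi * (2 * real j + 1)\<^sup>2 / (4 * real p)))"
      unfolding half_gauss_sum_fold[OF p] by (simp add: ring_distribs sum_distrib_left mult_ac)
    moreover have "Re (of_real 2 * S) = 2 * Re S" for S by simp
    ultimately show ?thesis by (simp only: plus_complex.sel Re_sum Re_eq c_def)
  qed
  hence start: "Re (cis (-(pi/4)) * half_gauss_sum p) \<ge> -1 + 2 * (\<Sum>j<m. c j)" by simp
  have c_eq: "c j = cos (pi / 4 * ((2 * real j + 1)\<^sup>2 / real p - 1))" for j
    unfolding c_def using p3 by (intro arg_cong[of _ _ cos]) (simp add: field_simps)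
  have c0: "c j \<ge> 0" if "(2 * real j + 1)\<^sup>2 \<le> 3 * real p" for j
  proof -
    have "(2 * real j + 1)\<^sup>2 / real p \<le> 3" using that p3 by (simp add: field_simps)
    define y where "y = pi / 4 * ((2 * real j + 1)\<^sup>2 / real p - 1)"
    have "y \<le> pi / 4 * 2" unfolding y_def
      using \<open>(2 * real j + 1)\<^sup>2 / real p \<le> 3\<close> by (intro mult_left_mono) auto
    moreover have "pi / 4 * (-1) \<le> y" unfolding y_def by (intro mult_left_mono) auto
    ultimately have "- (pi / 2) \<le> y" "y \<le> pi / 2" using pi_gt_zero by linarith+
    thus ?thesis unfolding c_eq y_def[symmetric] by (rule cos_ge_zero)
  qed
  \<comment> \<open>For these \<open>j\<close> the angle is at most \<open>pi / 4\<close> in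
    absolute value; 7/10 is a rational bound below \<open>cos (pi / 4)\<close>.\<close>
  have c1: "c j \<ge> 7/10" if "(2 * real j + 1)\<^sup>2 \<le> 2 * real p" for j
  proof -
    define y where "y = pi / 4 * ((2 * real j + 1)\<^sup>2 / real p - 1)"
    have "(2 * real j + 1)\<^sup>2 / real p \<le> 2" using that p3 by (simp add: field_simps)
    hence "y \<le> pi / 4 * 1" unfolding y_def by (intro mult_left_mono) auto
    moreover have "pi / 4 * (-1) \<le> y" unfolding y_def by (intro mult_left_mono) auto
    ultimately have "\<bar>y\<bar> \<le> pi / 4" by simp
    hence "cos (pi/4) \<le> cos \<bar>y\<bar>" by (intro cos_monotone_0_pi_le) auto
    moreover have "7/10 \<le> sqrt 2 / 2"
      using real_le_rsqrt[of "14/10" 2] by (simp add: power2_eq_square)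
    moreover have "c j = cos y" by (simp only: c_eq y_def)
    ultimately show ?thesis by (simp add: cos_45)
  qed
  \<comment> \<open>From index \<open>J\<close> on the cosine may be negative; these terms are left
    to the bound from partial summation.\<close>
  define J where "J = (LEAST j. (2 * real j + 1)\<^sup>2 > 3 * real p)"
  have exJ: "(2 * real p + 1)\<^sup>2 > 3 * real p" 
    using p3 by (simp add: power2_eq_square algebra_simps add_pos_nonneg)
  have J: "(2 * real J + 1)\<^sup>2 > 3 * real p"
    unfolding J_def by (rule LeastI[where P = "\<lambda>j. (2 * real j + 1)\<^sup>2 > 3 * real p", OF exJ])
  have less_J: "(2 * real j + 1)\<^sup>2 \<le> 3 * real p" if "j < J" for j
    using not_less_Least[OF that[unfolded J_def]] by simp
  show ?thesis
  proof (cases "J < m")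
    case False
    hence "(\<Sum>j<m. c j) \<ge> 0" using c0 less_J by (intro sum_nonneg) auto
    thus ?thesis using start x1 unfolding x_def by linarith
  next
    case True
    have split: "(\<Sum>j<m. c j) = (\<Sum>j<J. c j) + (\<Sum>j=J..<m. c j)"
      using True sum.atLeastLessThan_concat[of 0 J m c] by (simp add: atLeast0LessThan)
    have "\<bar>\<Sum>j=J..<m. c j\<bar> \<le> real p / (2 * real J + 1)"
    proof -
      have "(\<Sum>j=J..<m. c j) = Re (cis (-(pi/4)) * (\<Sum>j=J..<m. cis (pi * (2 * real j + 1)\<^sup>2 / (4 * real p))))"
        unfolding sum_distrib_left Re_sum Re_eq c_def by simp
      also have "\<bar>\<dots>\<bar> \<le> norm (cis (-(pi/4)) * (\<Sum>j=J..<m. cis (pi * (2 * real j + 1)\<^sup>2 / (4 * real p))))"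
        by (rule abs_Re_le_cmod)
      also have "\<dots> \<le> real p / (2 * real J + 1)"
        using norm_sum_cis_squares_le[OF p True] by (simp add: norm_mult)
      finally show ?thesis .
    qed
    \<comment> \<open>\<open>2 J + 1\<close> exceeds \<open>sqrt 3 * x\<close>, and 5/3 is a
      rational bound below \<open>sqrt 3\<close>.\<close>
    also have "real p / (2 * real J + 1) \<le> 3/5 * x"
    proof -
      have "(5/3 * x)^2 \<le> (2 * real J + 1)^2" using J x2 by (simp add: power_mult_distrib power2_eq_square)
      hence "5/3 * x \<le> 2 * real J + 1" by (rule power2_le_imp_le) simp
      hence "real p \<le> 3/5 * x * (2 * real J + 1)"
        using x2 x0 mult_left_mono[of "5/3 * x" "2 * real J + 1" "3/5 * x"] by (simp add: power2_eq_square)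
      thus ?thesis by (simp add: divide_le_eq)
    qed
    finally have tail: "(\<Sum>j=J..<m. c j) \<ge> - (3/5 * x)" by simp
    have "J > 0" using J p3 by (intro gr0I) simp
    \<comment> \<open>\<open>J < m\<close> forces \<open>3 p < (p - 2)^2\<close> and thus
      \<open>p > 6\<close>. The closing comparison of \<open>17/10 + 11/50 x\<close> with
      \<open>x\<close> requires \<open>x > 85/39\<close>, and 23/10 is above that.\<close>
    have x23: "x \<ge> 23/10"
    proof -
      have "J + 1 \<le> m" using True by simp
      hence "2 * real J + 1 \<le> real p - 2" using p by simp
      hence "(2 * real J + 1)\<^sup>2 \<le> (real p - 2)\<^sup>2" by (intro power_mono) auto
      hence "3 * real p < (real p - 2)^2" using J by linarith
      hence "real p * (7 - real p) < 4" by (simp add: power2_eq_square algebra_simps)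
      hence "real p > 6"
        using mult_nonneg_nonneg[of "real p - 3" "6 - real p"] p3
        by (cases "real p \<le> 6") (simp_all add: algebra_simps)
      thus ?thesis using x2 x0 by (intro power2_le_imp_le[of "23/10"]) (auto simp: power2_eq_square)
    qed
    \<comment> \<open>\<open>K\<close> counts the odd numbers below \<open>7/5 * x\<close>, a
      rational stand-in for \<open>sqrt 2 * x\<close>. Each of them contributes at least 7/10 to the
      sum.\<close>
    define K where "K = nat \<lceil>(7/5 * x - 1) / 2\<rceil>"
    have K1: "real K \<ge> (7/5 * x - 1) / 2" by (simp add: K_def of_nat_ceiling)
    have K2: "real K < (7/5 * x - 1) / 2 + 1" 
    proof -
      have "0 \<le> \<lceil>(7/5 * x - 1) / 2\<rceil>" using x1 by simp
      hence "real K = of_int \<lceil>(7/5 * x - 1) / 2\<rceil>" by (simp add: K_def)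
      thus ?thesis using ceiling_correct[of "(7/5 * x - 1) / 2"] by linarith
    qed
    have jK: "(2 * real j + 1)\<^sup>2 \<le> 2 * real p" if "j < K" for j
    proof -
      have "real (j + 1) \<le> real K" using that by (intro of_nat_mono) simp
      hence "2 * real j + 1 \<le> 7/5 * x" using K2 by (simp add: field_simps)
      hence "(2 * real j + 1)\<^sup>2 \<le> (7/5 * x)\<^sup>2" by (intro power_mono) auto
      thus ?thesis using x2 by (simp add: power_mult_distrib power2_eq_square)
    qed
    have KJ: "K \<le> J"
    proof (rule ccontr)
      assume "\<not> K \<le> J"
      thus False using jK[of J] J p3 by simp
    qed
    have "(\<Sum>j<J. c j) \<ge> (\<Sum>j<K. c j)"
      using KJ c0 less_J by (intro sum_mono2) auto
    moreover have "(\<Sum>j<K. c j) \<ge> (\<Sum>j<K. 7/10)" using c1 jK by (intro sum_mono) auto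
    moreover have "7/10 * real K \<ge> 49/100 * x - 7/20" using K1 by (simp add: field_simps)
    ultimately have "(\<Sum>j<J. c j) \<ge> 49/100 * x - 7/20" by simp
    hence "Re (cis (-(pi/4)) * half_gauss_sum p) \<ge> - 17/10 - 11/50 * x"
      using start split tail by (simp add: field_simps)
    moreover have "- 17/10 - 11/50 * x > - x" using x23 by simp
    ultimately show ?thesis unfolding x_def by linarith
  qed
qed

section \<open>Quadratic Gauss sums\<close>

definition unit_char :: "nat \<Rightarrow> int \<Rightarrow> complex" where
  "unit_char q k = cis (2 * pi * real_of_int k / real q)"

lemma unit_char_0 [simp]: "unit_char q 0 = 1"
  by (simp add: unit_char_def)

lemma unit_char_add: "unit_char q (a + b) = unit_char q a * unit_char q b"
  by (simp add: unit_char_def cis_mult add_divide_distrib distrib_left)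

lemma unit_char_cong:
  assumes "q > 0" "[a = b] (mod int q)"
  shows "unit_char q a = unit_char q b"
proof -
  obtain t where "a = b + int q * t" using assms(2) cong_iff_lin[of b a] by (auto simp: cong_sym_eq)
  moreover have "unit_char q (int q * t) = 1"
    using assms(1) cis_multiple_2pi[of "of_int t"] by (simp add: unit_char_def mult.assoc)
  ultimately show ?thesis by (simp add: unit_char_add)
qed

lemma unit_char_cancel: "c > 0 \<Longrightarrow> unit_char (q * c) (k * int c) = unit_char q k"
  by (simp add: unit_char_def mult.assoc)

lemma unit_char_of_nat_mult: "unit_char q (k * int n) = unit_char q k ^ n"
  by (induction n) (auto simp: unit_char_add distrib_left mult.commute)

lemma cnj_unit_char: "cnj (unit_char q k) = unit_char q (-k)"
  by (simp add: unit_char_def cis_cnj)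

text \<open>As many values as the modulus, pairwise incongruent, form a complete residue system;
  multiplication by a unit and the Chinese remainder theorem are both treated this way.\<close>

lemma sum_residues_reindex:
  fixes f :: "int \<Rightarrow> complex"
  assumes "q > 0" "finite I" "card I = q" "inj_on (\<lambda>i. g i mod int q) I"
    and "\<And>a b. [a = b] (mod int q) \<Longrightarrow> f a = f b"
  shows "(\<Sum>i\<in>I. f (g i)) = (\<Sum>r\<in>{0..<int q}. f r)"
proof -
  have "(\<lambda>i. g i mod int q) ` I = {0..<int q}"
    using assms(1) by (intro card_subset_eq) (auto simp: card_image[OF assms(4)] assms(3))
  hence "(\<Sum>r\<in>{0..<int q}. f r) = (\<Sum>i\<in>I. f (g i mod int q))"
    using sum.reindex[OF assms(4), of f] by simp
  also have "\<dots> = (\<Sum>i\<in>I. f (g i))" by (intro sum.cong refl assms(5)) (simp add: cong_def)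
  finally show ?thesis by simp
qed

lemma sum_unit_residues_reindex:
  fixes f :: "int \<Rightarrow> complex"
  assumes "q > 0" "coprime a (int q)" "\<And>a b. [a = b] (mod int q) \<Longrightarrow> f a = f b"
  shows "(\<Sum>r\<in>{0..<int q}. f (a * r)) = (\<Sum>r\<in>{0..<int q}. f r)"
proof (rule sum_residues_reindex[OF assms(1)])
  show "inj_on (\<lambda>i. a * i mod int q) {0..<int q}"
  proof (rule inj_onI)
    fix i j assume *: "i \<in> {0..<int q}" "j \<in> {0..<int q}" "a * i mod int q = a * j mod int q"
    hence "[a * i = a * j] (mod int q)" by (simp add: cong_def)
    hence "[i = j] (mod int q)" using cong_mult_lcancel[OF assms(2)] by blast
    thus "i = j" using * by (simp add: cong_def)
  qed
qed (use assms(3) in auto)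

lemma sum_residues_product:
  fixes f :: "int \<Rightarrow> complex"
  assumes "q1 > 0" "q2 > 0" "coprime q1 q2" "\<And>a b. [a = b] (mod int (q1 * q2)) \<Longrightarrow> f a = f b"
  shows "(\<Sum>r\<in>{0..<int (q1 * q2)}. f r)
       = (\<Sum>r1\<in>{0..<int q1}. \<Sum>r2\<in>{0..<int q2}. f (r1 * int q2 + r2 * int q1))"
proof -
  have cop: "coprime (int q2) (int q1)" "coprime (int q1) (int q2)"
    using assms(3) by (auto simp: coprime_commute)
  have "(\<Sum>(r1, r2)\<in>{0..<int q1} \<times> {0..<int q2}. f (r1 * int q2 + r2 * int q1)) = (\<Sum>r\<in>{0..<int (q1 * q2)}. f r)"
    unfolding case_prod_unfold
  proof (rule sum_residues_reindex)
    show "inj_on (\<lambda>i. (fst i * int q2 + snd i * int q1) mod int (q1 * q2)) ({0..<int q1} \<times> {0..<int q2})"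
    proof (rule inj_onI, clarify)
      fix a b c d assume r: "a \<in> {0..<int q1}" "b \<in> {0..<int q2}" "c \<in> {0..<int q1}" "d \<in> {0..<int q2}"
        and "(fst (a, b) * int q2 + snd (a, b) * int q1) mod int (q1 * q2)
           = (fst (c, d) * int q2 + snd (c, d) * int q1) mod int (q1 * q2)"
      hence *: "[a * int q2 + b * int q1 = c * int q2 + d * int q1] (mod int q1 * int q2)"
        by (simp add: cong_def)
      have "[a * int q2 + b * int q1 = c * int q2 + d * int q1] (mod int q1)"
        using * cong_modulus_mult by blast
      hence "[a * int q2 = c * int q2] (mod int q1)" by (auto simp: cong_def)
      hence "[a = c] (mod int q1)" using cong_mult_rcancel[OF cop(1)] by blast
      moreover have "[a * int q2 + b * int q1 = c * int q2 + d * int q1] (mod int q2)"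
        using * cong_modulus_mult[of _ _ "int q2" "int q1"] by (simp add: mult.commute)
      hence "[b * int q1 = d * int q1] (mod int q2)" by (auto simp: cong_def)
      hence "[b = d] (mod int q2)" using cong_mult_rcancel[OF cop(2)] by blast
      ultimately show "a = c \<and> b = d" using r by (auto simp: cong_def)
    qed
  qed (use assms in \<open>auto simp: card_cartesian_product\<close>)
  thus ?thesis by (simp add: sum.cartesian_product)
qed

text \<open>Asked for every frequency \<open>k\<close>, including those sharing a factor with
  \<open>q\<close>, where it says that the sum vanishes. The transform of the kernel runs through
  all frequencies of a period and uses it in this strength.\<close>

definition gauss_property :: "nat \<Rightarrow> (int \<Rightarrow> complex) \<Rightarrow> bool" where
  "gauss_property q chi \<longleftrightarrow> (\<forall>k. (\<Sum>r\<in>{0..<int q}. chi r * unit_char q (k * r))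
     = chi k * of_real (sqrt (real q)) * (if chi (-1) = 1 then 1 else \<i>))"

text \<open>With residues written as \<open>r1 * q2 + r2 * q1\<close> the sum factors and leaves
  \<open>chi1 q2 * chi2 q1\<close>. When both characters are odd, reciprocity makes this -1 and so
  turns \<open>\<i> * \<i>\<close> into 1, as an even product requires; otherwise it is 1.\<close>

lemma gauss_property_times:
  assumes d: "dirichlet_character q1 chi1" "dirichlet_character q2 chi2" and cop: "coprime q1 q2"
    and rec: "reciprocal q1 chi1 q2 chi2" and G: "gauss_property q1 chi1" "gauss_property q2 chi2"
  shows "gauss_property (q1 * q2) (\<lambda>n. chi1 n * chi2 n)"
  unfolding gauss_property_def
proof
  fix k
  have pos: "q1 > 0" "q2 > 0" using d dirichlet_character_modulus_pos by auto
  have dt: "dirichlet_character (q1 * q2) (\<lambda>n. chi1 n * chi2 n)"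
    by (rule dirichlet_character_times[OF d])
  define \<epsilon> where "\<epsilon> = (\<lambda>c :: int \<Rightarrow> complex. if c (-1) = 1 then 1 else \<i>)"
  have "(\<Sum>r\<in>{0..<int (q1 * q2)}. chi1 r * chi2 r * unit_char (q1 * q2) (k * r))
      = (\<Sum>r1\<in>{0..<int q1}. \<Sum>r2\<in>{0..<int q2}. 
          chi1 (r1 * int q2 + r2 * int q1) * chi2 (r1 * int q2 + r2 * int q1)
          * unit_char (q1 * q2) (k * (r1 * int q2 + r2 * int q1)))"
    by (rule sum_residues_product[OF pos cop])
       (use pos dirichlet_character_cong[OF dt] in \<open>auto intro!: arg_cong2[where f = "(*)"] unit_char_cong intro: cong_scalar_left\<close>)
  also have "\<dots> = (\<Sum>r1\<in>{0..<int q1}. \<Sum>r2\<in>{0..<int q2}.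
      (chi1 (int q2) * chi2 (int q1)) * (chi1 r1 * unit_char q1 (k * r1)) * (chi2 r2 * unit_char q2 (k * r2)))"
  proof (intro sum.cong refl)
    fix r1 r2
    have "chi1 (r1 * int q2 + r2 * int q1) = chi1 r1 * chi1 (int q2)"
      using dirichlet_character_periodic[OF d(1), of "r1 * int q2" r2]
      by (simp add: dirichlet_character_mult[OF d(1)] mult.commute[of r2])
    moreover have "chi2 (r1 * int q2 + r2 * int q1) = chi2 r2 * chi2 (int q1)"
      using dirichlet_character_periodic[OF d(2), of "r2 * int q1" r1]
      by (simp add: dirichlet_character_mult[OF d(2)] mult.commute[of r1] add.commute)
    moreover have "unit_char (q1 * q2) (k * (r1 * int q2 + r2 * int q1)) = unit_char q1 (k * r1) * unit_char q2 (k * r2)"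
      using unit_char_cancel[OF pos(2), of q1 "k * r1"] unit_char_cancel[OF pos(1), of q2 "k * r2"]
      by (simp add: distrib_left unit_char_add mult.assoc mult.commute[of q1 q2])
    ultimately show "chi1 (r1 * int q2 + r2 * int q1) * chi2 (r1 * int q2 + r2 * int q1)
          * unit_char (q1 * q2) (k * (r1 * int q2 + r2 * int q1)) = 
          (chi1 (int q2) * chi2 (int q1)) * (chi1 r1 * unit_char q1 (k * r1)) * (chi2 r2 * unit_char q2 (k * r2))"
      by simp
  qed
  also have "\<dots> = (chi1 (int q2) * chi2 (int q1)) * (\<Sum>r1\<in>{0..<int q1}. chi1 r1 * unit_char q1 (k * r1))
      * (\<Sum>r2\<in>{0..<int q2}. chi2 r2 * unit_char q2 (k * r2))"
    by (subst sum_distrib_left, subst sum_product) (rule refl)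
  also have "\<dots> = (chi1 (int q2) * chi2 (int q1)) * (chi1 k * of_real (sqrt (real q1)) * \<epsilon> chi1)
      * (chi2 k * of_real (sqrt (real q2)) * \<epsilon> chi2)"
    using G by (simp add: gauss_property_def \<epsilon>_def)
  also have "\<dots> = (chi1 k * chi2 k) * of_real (sqrt (real (q1 * q2)))
      * ((chi1 (int q2) * chi2 (int q1)) * \<epsilon> chi1 * \<epsilon> chi2)"
    by (simp add: real_sqrt_mult)
  also have "(chi1 (int q2) * chi2 (int q1)) * \<epsilon> chi1 * \<epsilon> chi2 = \<epsilon> (\<lambda>n. chi1 n * chi2 n)"
    using rec dirichlet_character_minus_one[OF d(1)] dirichlet_character_minus_one[OF d(2)]
    by (auto simp: \<epsilon>_def reciprocal_def)
  finally show "(\<Sum>r\<in>{0..<int (q1 * q2)}. chi1 r * chi2 r * unit_char (q1 * q2) (k * r))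
     = chi1 k * chi2 k * of_real (sqrt (real (q1 * q2))) * (if chi1 (-1) * chi2 (-1) = 1 then 1 else \<i>)"
    by (simp add: \<epsilon>_def)
qed

lemma atLeastLessThan_int_4: "{0..<4::int} = {0,1,2,3}" by auto
lemma atLeastLessThan_int_8: "{0..<8::int} = {0,1,2,3,4,5,6,7}" by auto

lemma unit_char_8_values:
  fixes w :: complex
  defines "w \<equiv> of_real (sqrt 2 / 2) * (1 + \<i>)"
  shows "unit_char 8 1 = w" "w * w = \<i>"
proof -
  show "unit_char 8 1 = w"
    by (simp add: unit_char_def w_def complex_eq_iff cos_45 sin_45)
  have "(of_real (sqrt 2) :: complex) * of_real (sqrt 2) = 2"
    by (simp flip: of_real_mult)
  thus "w * w = \<i>" by (simp add: w_def algebra_simps)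
qed

lemma gauss_property_chi4: "gauss_property 4 chi4"
  unfolding gauss_property_def
proof
  fix k :: int
  define j where "j = k mod 4"
  have u1: "unit_char 4 1 = \<i>" by (simp add: unit_char_def cis_conv_exp[symmetric])
  have uj: "unit_char 4 (k * int n) = (unit_char 4 j) ^ n" for n
    using unit_char_cong[of 4 k j] by (simp add: unit_char_of_nat_mult j_def cong_def)
  have s: "(\<Sum>r\<in>{0..<int 4}. chi4 r * unit_char 4 (k * r)) = unit_char 4 j - unit_char 4 j ^ 3"
    using uj[of 1] uj[of 3] by (simp add: atLeastLessThan_int_4 chi4_def)
  have c: "chi4 k = chi4 j" by (simp add: chi4_def j_def)
  have "j = int 0 \<or> j = int 1 \<or> j = int 2 \<or> j = int 3" unfolding j_def by presburger
  hence "unit_char 4 j - unit_char 4 j ^ 3 = chi4 j * 2 * \<i>"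
    using unit_char_of_nat_mult[of 4 1 0] unit_char_of_nat_mult[of 4 1 1]
      unit_char_of_nat_mult[of 4 1 2] unit_char_of_nat_mult[of 4 1 3]
    by (elim disjE) (simp_all add: u1 chi4_def power2_eq_square power3_eq_cube)
  moreover have "chi4 (-1) = -1" by (simp add: chi4_def)
  ultimately show "(\<Sum>r\<in>{0..<int 4}. chi4 r * unit_char 4 (k * r))
     = chi4 k * of_real (sqrt (real 4)) * (if chi4 (-1) = 1 then 1 else \<i>)"
    unfolding s c by simp
qed

text \<open>Both sides depend on \<open>k\<close> modulo 8 only, which leaves a finite check with
  the powers of the eighth root of unity \<open>w\<close>.\<close>

lemma gauss_property_chi8:
  "gauss_property 8 chi8" "gauss_property 8 (\<lambda>n. chi4 n * chi8 n)"
proof -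
  define w :: complex where "w = of_real (sqrt 2 / 2) * (1 + \<i>)"
  have u1: "unit_char 8 1 = w" and w2: "w * w = \<i>"
    using unit_char_8_values by (simp_all add: w_def)
  have s2: "(of_real (sqrt 2) :: complex) * of_real (sqrt 2) = 2" by (simp flip: of_real_mult)
  have w1: "w * (1 - \<i>) = of_real (sqrt 2)" by (simp add: w_def algebra_simps)
  have w1': "w * (1 + \<i>) = of_real (sqrt 2) * \<i>" by (simp add: w_def algebra_simps)
  have r8: "sqrt 8 = 2 * sqrt 2" using real_sqrt_mult[of 4 2] by simp
  have u: "unit_char 8 (int n) = w ^ n" for n
    using unit_char_of_nat_mult[of 8 1 n] by (simp add: u1)
  have wi: "w * \<i> = of_real (sqrt 2) * \<i> - w" using w1' by (simp add: algebra_simps)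
  {
    fix k :: int
    define j where "j = k mod 8"
    have uj: "unit_char 8 (k * int n) = (unit_char 8 j) ^ n" for n
      using unit_char_cong[of 8 k j] by (simp add: unit_char_of_nat_mult j_def cong_def)
    have s: "(\<Sum>r\<in>{0..<int 8}. chi8 r * unit_char 8 (k * r))
        = unit_char 8 j - unit_char 8 j ^ 3 - unit_char 8 j ^ 5 + unit_char 8 j ^ 7"
      using uj[of 1] uj[of 3] uj[of 5] uj[of 7] by (simp add: atLeastLessThan_int_8 chi8_def)
    have s': "(\<Sum>r\<in>{0..<int 8}. chi4 r * chi8 r * unit_char 8 (k * r))
        = unit_char 8 j + unit_char 8 j ^ 3 - unit_char 8 j ^ 5 - unit_char 8 j ^ 7"
      using uj[of 1] uj[of 3] uj[of 5] uj[of 7] by (simp add: atLeastLessThan_int_8 chi8_def chi4_def)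
    have c: "chi8 k = chi8 j" "chi4 k = chi4 j" by (simp_all add: chi8_def chi4_def j_def mod_mod_cancel)
    have pw: "w ^ 2 = \<i>" "w ^ 3 = \<i> * w" "w ^ 4 = -1" "w ^ 5 = - w" "w ^ 6 = -\<i>" "w ^ 7 = - \<i> * w"
    proof -
      have p2: "w ^ 2 = \<i>" using w2 by (simp add: power2_eq_square)
      have p4: "w ^ 4 = -1" using p2 power_mult[of w 2 2] by simp
      show "w ^ 2 = \<i>" "w ^ 3 = \<i> * w" "w ^ 4 = -1" "w ^ 5 = - w" "w ^ 6 = -\<i>" "w ^ 7 = - \<i> * w"
        using p2 p4 power_add[of w 2 1] power_add[of w 4 1] power_add[of w 4 2]
          power_add[of w 4 3] power_add[of w 2 1]
        by simp_all
    qed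
    have j: "j = int 0 \<or> j = int 1 \<or> j = int 2 \<or> j = int 3 \<or> j = int 4 \<or> j = int 5 \<or> j = int 6 \<or> j = int 7"
      unfolding j_def by presburger
    have val: "unit_char 8 j \<in> {1, \<i>, -1, -\<i>} \<and> even j \<or>
       j = 1 \<and> unit_char 8 j = w \<or> j = 3 \<and> unit_char 8 j = \<i> * w \<or>
       j = 5 \<and> unit_char 8 j = - w \<or> j = 7 \<and> unit_char 8 j = - \<i> * w"
      using j u[of 0] u[of 1] u[of 2] u[of 3] u[of 4] u[of 5] u[of 6] u[of 7] pw
      by (elim disjE) simp_all
    have e8: "even j \<Longrightarrow> chi8 j = 0" using j by (auto simp: chi8_def)
    have p3: "(\<i> * w) ^ n = \<i> ^ n * w ^ n" "(- \<i> * w) ^ n = (- \<i>) ^ n * w ^ n" "(-w) ^ n = (-1)^n * w^n" for n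
      by (simp_all add: power_mult_distrib power_minus')
    have ip: "\<i> ^ 3 = -\<i>" "\<i> ^ 5 = \<i>" "\<i> ^ 7 = -\<i>" "(-\<i>) ^ 3 = \<i>" "(-\<i>) ^ 5 = -\<i>" "(-\<i>) ^ 7 = \<i>"
      by (simp_all add: eval_nat_numeral)
    have "unit_char 8 j - unit_char 8 j ^ 3 - unit_char 8 j ^ 5 + unit_char 8 j ^ 7
        = chi8 j * (2 * (w * (1 - \<i>)))"
      using val
      by (elim disjE conjE insertE emptyE)
         (simp_all only: p3 pw ip e8, simp_all add: chi8_def algebra_simps)
    hence v8: "(\<Sum>r\<in>{0..<int 8}. chi8 r * unit_char 8 (k * r))
       = chi8 k * of_real (sqrt (real 8)) * (if chi8 (-1) = 1 then 1 else \<i>)"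
      unfolding s c by (simp add: w1 r8 chi8_def)
    have "unit_char 8 j + unit_char 8 j ^ 3 - unit_char 8 j ^ 5 - unit_char 8 j ^ 7
        = chi4 j * chi8 j * (2 * (w * (1 + \<i>)))"
      using val
      by (elim disjE conjE insertE emptyE)
         (simp_all only: p3 pw ip e8, simp_all add: chi8_def chi4_def algebra_simps)
    hence v8': "(\<Sum>r\<in>{0..<int 8}. chi4 r * chi8 r * unit_char 8 (k * r))
       = chi4 k * chi8 k * of_real (sqrt (real 8)) * (if chi4 (-1) * chi8 (-1) = 1 then 1 else \<i>)"
      unfolding s' c by (simp add: w1' r8 chi8_def chi4_def)
    note v8 v8'
  } note * = this
  show "gauss_property 8 chi8" "gauss_property 8 (\<lambda>n. chi4 n * chi8 n)"
    unfolding gauss_property_def using * by blast+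
qed

lemma sum_unit_char:
  assumes "q > 0"
  shows "(\<Sum>k\<in>{0..<int q}. unit_char q (k * m)) = (if int q dvd m then of_nat q else 0)"
proof -
  have "(\<Sum>k\<in>{0..<int q}. unit_char q (k * m)) = (\<Sum>n<q. unit_char q (int n * m))"
    by (intro sum.reindex_bij_witness[of _ int nat]) auto
  also have "\<dots> = (\<Sum>n<q. unit_char q m ^ n)"
    by (intro sum.cong refl) (metis mult.commute unit_char_of_nat_mult)
  also have "\<dots> = (if int q dvd m then of_nat q else 0)"
  proof (cases "int q dvd m")
    case True
    hence "unit_char q m = 1" using unit_char_cong[OF assms, of m 0] by (simp add: cong_0_iff)
    thus ?thesis using True by simp
  next
    case False
    have "unit_char q m \<noteq> 1"
    proof
      assume "unit_char q m = 1"
      hence "cos (2 * pi * real_of_int m / real q) = 1" by (simp add: unit_char_def complex_eq_iff)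
      then obtain n :: int where "2 * pi * real_of_int m / real q = of_int n * 2 * pi"
        unfolding cos_one_2pi_int by blast
      hence "real_of_int m = real_of_int (n * int q)" using assms by (simp add: field_simps)
      hence "m = n * int q" by (simp only: of_int_eq_iff)
      thus False using False by simp
    qed
    moreover have "unit_char q m ^ q = 1"
      using unit_char_cong[OF assms, of "m * int q" 0] by (simp add: cong_0_iff flip: unit_char_of_nat_mult)
    ultimately show ?thesis using False by (simp add: sum_gp_strict)
  qed
  finally show ?thesis .
qed

text \<open>The coefficient counts the square roots of \<open>t\<close> modulo \<open>p\<close>: one
  for 0, two for a nonzero residue, none for a nonresidue.\<close>

lemma sum_squares_mod_prime:
  fixes f :: "int \<Rightarrow> complex"
  assumes p: "prime p" "odd p" and f: "\<And>a b. [a = b] (mod int p) \<Longrightarrow> f a = f b"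
  shows "(\<Sum>r\<in>{0..<int p}. f (r\<^sup>2)) = (\<Sum>t\<in>{0..<int p}. (1 + of_int (Legendre t (int p))) * f t)"
proof -
  have p0: "int p > 0" using p prime_gt_0_nat by simp
  have pp: "prime (int p)" using p by simp
  have count: "of_nat (card {r \<in> {0..<int p}. r\<^sup>2 mod int p = t}) = 1 + (of_int (Legendre t (int p)) :: complex)"
    if t: "t \<in> {0..<int p}" for t
  proof (cases "t = 0")
    case True
    have "{r \<in> {0..<int p}. r\<^sup>2 mod int p = t} = {0}"
    proof (intro equalityI subsetI)
      fix r assume "r \<in> {r \<in> {0..<int p}. r\<^sup>2 mod int p = t}"
      hence "int p dvd r" "r \<in> {0..<int p}" using True pp by (auto simp: prime_dvd_power_iff)
      thus "r \<in> {0}" by (auto dest: zdvd_imp_le)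
    qed (use True p0 in auto)
    thus ?thesis using True by (simp add: Legendre_def)
  next
    case False
    hence nz: "\<not> [t = 0] (mod int p)" using t by (auto simp: cong_def)
    show ?thesis
    proof (cases "QuadRes (int p) t")
      case True
      then obtain y0 where y0: "[y0\<^sup>2 = t] (mod int p)" by (auto simp: QuadRes_def)
      define y where "y = y0 mod int p"
      have y: "y \<in> {0..<int p}" "y\<^sup>2 mod int p = t"
        using p0 y0 t by (auto simp: y_def cong_def power_mod)
      have y1: "y \<noteq> 0" using y False by auto
      have "{r \<in> {0..<int p}. r\<^sup>2 mod int p = t} = {y, int p - y}"
      proof (intro equalityI subsetI)
        fix r assume r: "r \<in> {r \<in> {0..<int p}. r\<^sup>2 mod int p = t}"
        hence "r\<^sup>2 mod int p = y\<^sup>2 mod int p" using y by simp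
        hence "int p dvd r\<^sup>2 - y\<^sup>2" by (simp only: mod_eq_dvd_iff)
        hence "int p dvd (r - y) * (r + y)" by (simp add: power2_eq_square algebra_simps)
        hence "int p dvd r - y \<or> int p dvd r + y" using pp by (simp add: prime_dvd_mult_iff)
        thus "r \<in> {y, int p - y}"
        proof
          assume "int p dvd r - y"
          hence "r mod int p = y mod int p" by (simp add: mod_eq_dvd_iff)
          thus ?thesis using r y by auto
        next
          assume "int p dvd r + y"
          then obtain c where c: "r + y = int p * c" by (elim dvdE)
          have "0 < int p * c" "int p * c < int p * 2" using r y y1 unfolding c[symmetric] by auto
          hence "c = 1" using p0 by (auto simp: zero_less_mult_iff)
          thus ?thesis using c by simp
        qed
      next
        fix r assume "r \<in> {y, int p - y}"
        moreover have "(int p - y)\<^sup>2 mod int p = y\<^sup>2 mod int p"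
          by (simp add: mod_eq_dvd_iff power2_eq_square algebra_simps)
        ultimately show "r \<in> {r \<in> {0..<int p}. r\<^sup>2 mod int p = t}" using y y1 by auto
      qed
      moreover have "y \<noteq> int p - y"
      proof
        assume "y = int p - y"
        hence "int p = 2 * y" by simp
        thus False using p(2) by presburger
      qed
      ultimately show ?thesis using True nz by (simp add: Legendre_def)
    next
      case nq: False
      hence empty: "{r \<in> {0..<int p}. r\<^sup>2 mod int p = t} = {}"
        using t by (auto simp: QuadRes_def cong_def)
      have "Legendre t (int p) = -1" using nq nz by (simp add: Legendre_def)
      thus ?thesis by (simp only: empty) simp
    qed
  qed
  have "(\<Sum>r\<in>{0..<int p}. f (r\<^sup>2)) = (\<Sum>r\<in>{0..<int p}. f (r\<^sup>2 mod int p))"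
    by (intro sum.cong refl f) (simp add: cong_def)
  also have "\<dots> = (\<Sum>t\<in>{0..<int p}. \<Sum>r\<in>{r \<in> {0..<int p}. r\<^sup>2 mod int p = t}. f (r\<^sup>2 mod int p))"
    using p0 by (intro sum.group[symmetric]) auto
  also have "\<dots> = (\<Sum>t\<in>{0..<int p}. of_nat (card {r \<in> {0..<int p}. r\<^sup>2 mod int p = t}) * f t)"
    by (intro sum.cong refl) simp
  also have "\<dots> = (\<Sum>t\<in>{0..<int p}. (1 + of_int (Legendre t (int p))) * f t)"
    by (intro sum.cong refl) (simp only: count)
  finally show ?thesis .
qed

text \<open>Orthogonality gives \<open>g * g = chi (-1) * p\<close>, so \<open>g\<close> is known up
  to sign. To fix the sign, \<open>chi 2 * g\<close> is rewritten as a phase times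
  \<open>half_gauss_sum p\<close>, for which the wrong sign contradicts the lower bound.\<close>

lemma gauss_property_odd_prime:
  assumes p: "prime p" "odd p" and rp: "real_primitive p (\<lambda>n. of_int (Legendre n (int p)))"
  shows "gauss_property p (\<lambda>n. of_int (Legendre n (int p)))"
proof -
  define chi :: "int \<Rightarrow> complex" where "chi = (\<lambda>n. of_int (Legendre n (int p)))"
  have d: "dirichlet_character p chi" and P: "primitive_dirichlet_character p chi"
    using rp by (auto simp: chi_def dest: real_primitiveD)
  have p2: "p > 2" using p prime_ge_2_nat[of p] by (cases "p = 2") auto
  have p0: "p > 0" using p2 by simp
  note cong = dirichlet_character_cong[OF d] and mult = dirichlet_character_mult[OF d]
  have pp: "prime (int p)" using p by simp
  have copp: "coprime n (int p) \<longleftrightarrow> \<not> int p dvd n" for n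
    using prime_imp_coprime[OF pp, of n] coprime_common_divisor[of n "int p" "int p"] p(1)
    by (auto simp: coprime_commute prime_int_iff)
  have cases: "chi n = 0 \<or> chi n = 1 \<or> chi n = -1" for n by (auto simp: chi_def Legendre_def)
  have sq: "chi n * chi n = 1" if "coprime n (int p)" for n
    using cases[of n] dirichlet_character_eq_0_iff[OF d, of n] that by auto
  have sq0: "chi n * chi n = (if int p dvd n then 0 else 1)" for n
    using sq[of n] copp[of n] dirichlet_character_eq_0_iff[OF d, of n] by auto
  have nontriv: "\<exists>a. chi a = -1"
  proof (rule ccontr)
    assume *: "\<nexists>a. chi a = -1"
    have "1 = p"
    proof (rule primitive_not_induced[OF P])
      show "dirichlet_character 1 (\<lambda>_. 1)" using real_primitive_one_iff by (blast dest: real_primitiveD)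
      show "chi n = 1" if "coprime n (int p)" for n
        using * cases[of n] dirichlet_character_eq_0_iff[OF d, of n] that by auto
    qed auto
    thus False using p2 by simp
  qed
  have sum0: "(\<Sum>r\<in>{0..<int p}. chi r) = 0"
  proof -
    obtain a where a: "chi a = -1" using nontriv by blast
    hence "coprime a (int p)" using dirichlet_character_eq_0_iff[OF d, of a] by auto
    hence "(\<Sum>r\<in>{0..<int p}. chi (a * r)) = (\<Sum>r\<in>{0..<int p}. chi r)"
      by (intro sum_unit_residues_reindex p0 cong)
    thus ?thesis by (simp add: mult a sum_negf)
  qed
  define S where "S = (\<lambda>k. \<Sum>r\<in>{0..<int p}. chi r * unit_char p (k * r))"
  define g where "g = S 1"
  have S: "S k = chi k * g" for k
  proof (cases "int p dvd k")
    case True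
    hence "unit_char p (k * r) = 1" for r
      using unit_char_cong[OF p0, of "k * r" 0] by (simp add: cong_0_iff)
    moreover have "chi k = 0" using True copp dirichlet_character_eq_0_iff[OF d] by blast
    ultimately show ?thesis by (simp add: S_def sum0)
  next
    case False
    hence cop: "coprime k (int p)" using copp by blast
    have "S k = (\<Sum>r\<in>{0..<int p}. chi k * (chi (k * r) * unit_char p (1 * (k * r))))"
      unfolding S_def using sq[OF cop] by (intro sum.cong refl) (simp add: mult flip: mult.assoc)
    also have "\<dots> = chi k * (\<Sum>r\<in>{0..<int p}. chi (k * r) * unit_char p (1 * (k * r)))"
      by (simp add: sum_distrib_left)
    also have "(\<Sum>r\<in>{0..<int p}. chi (k * r) * unit_char p (1 * (k * r))) = g"
      unfolding g_def S_def
      by (rule sum_unit_residues_reindex[OF p0 cop, where f = "\<lambda>x. chi x * unit_char p (1 * x)"])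
         (auto intro!: arg_cong2[where f = "(*)"] intro: cong unit_char_cong[OF p0])
    finally show ?thesis .
  qed
  have cnj_g: "cnj g = chi (-1) * g"
  proof -
    have "cnj (chi r) = chi r" for r by (simp add: chi_def)
    hence "cnj g = S (-1)" by (simp add: g_def S_def cnj_unit_char)
    thus ?thesis using S by simp
  qed
  have sum_sq: "(\<Sum>k\<in>{0..<int p}. chi k * chi k) = of_nat p - 1"
  proof -
    have "(\<Sum>k\<in>{0..<int p}. chi k * chi k) = (\<Sum>k\<in>{0..<int p} - {0}. 1)"
      by (rule sum.mono_neutral_cong_right) (auto simp: sq0 dest: zdvd_imp_le)
    thus ?thesis using p0 by (simp add: card_Diff_subset of_nat_diff)
  qed
  \<comment> \<open>The sum of \<open>S k * cnj (S k)\<close> over all \<open>k\<close> is evaluated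
    in two ways: by \<open>S k = chi k * g\<close>, and by orthogonality of the additive
    characters.\<close>
  have norm_g: "g * cnj g = of_nat p"
  proof -
    have "(of_nat p - 1) * (g * cnj g) = (\<Sum>k\<in>{0..<int p}. S k * cnj (S k))"
      unfolding sum_sq[symmetric] sum_distrib_right
      by (intro sum.cong refl) (simp add: S chi_def)
    also have "\<dots> = (\<Sum>k\<in>{0..<int p}. \<Sum>r\<in>{0..<int p}. \<Sum>s\<in>{0..<int p}.
        chi r * chi s * unit_char p (k * (r - s)))"
      unfolding S_def cnj_sum sum_product
      by (intro sum.cong refl) (simp add: cnj_unit_char chi_def right_diff_distrib unit_char_add[of _ "_ * _" "- (_ * _)", simplified])
    also have "\<dots> = (\<Sum>r\<in>{0..<int p}. \<Sum>s\<in>{0..<int p}. chi r * chi s * 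
        (\<Sum>k\<in>{0..<int p}. unit_char p (k * (r - s))))"
      unfolding sum_distrib_left by (subst sum.swap, rule sum.cong[OF refl], rule sum.swap)
    also have "\<dots> = (\<Sum>r\<in>{0..<int p}. \<Sum>s\<in>{0..<int p}. if s = r then chi r * chi s * of_nat p else 0)"
    proof (intro sum.cong refl)
      fix r s assume rs: "r \<in> {0..<int p}" "s \<in> {0..<int p}"
      have "int p dvd r - s \<longleftrightarrow> s = r" using rs by (auto simp flip: mod_eq_dvd_iff)
      thus "chi r * chi s * (\<Sum>k\<in>{0..<int p}. unit_char p (k * (r - s)))
          = (if s = r then chi r * chi s * of_nat p else 0)"
        by (simp add: sum_unit_char[OF p0])
    qed
    also have "\<dots> = (\<Sum>r\<in>{0..<int p}. chi r * chi r * of_nat p)"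
      by (intro sum.cong refl) (simp add: sum.delta')
    also have "\<dots> = (of_nat p - 1) * of_nat p" by (simp add: sum_sq flip: sum_distrib_right)
    finally have "(of_nat p - 1) * (g * cnj g) = (of_nat p - 1) * (of_nat p :: complex)" .
    moreover have "(of_nat p - 1 :: complex) \<noteq> 0" using p2 by simp
    ultimately show ?thesis by simp
  qed
  have m1: "chi (-1) = 1 \<or> chi (-1) = -1" by (rule dirichlet_character_minus_one[OF d])
  have g2: "g * g = chi (-1) * of_nat p"
    using norm_g m1 by (auto simp: cnj_g minus_equation_iff)
  obtain m where m: "p = 2 * m + 1" using p(2) by (elim oddE)
  \<comment> \<open>The inverse of 2 modulo \<open>p\<close>. At this frequency the phases are
    \<open>pi * (p + 1) * r^2 / p\<close>, which complete to the odd squares of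
    \<open>half_gauss_sum\<close>.\<close>
  define N where "N = int (m + 1)"
  have N: "chi N = chi 2"
  proof -
    have "[N * 2 = 1] (mod int p)" by (simp add: N_def m cong_iff_dvd_diff algebra_simps)
    hence "chi N * chi 2 = 1" using cong[of "N * 2" 1] mult[of N 2] dirichlet_character_one[OF d] by simp
    thus ?thesis using cases[of N] cases[of 2] by auto
  qed
  define T where "T = half_gauss_sum p"
  have T: "chi 2 * g = cis (- (pi * real p / 4)) * T"
  proof -
    have "chi 2 * g = (\<Sum>t\<in>{0..<int p}. chi t * unit_char p (N * t))" using S[of N] N by (simp add: S_def)
    \<comment> \<open>The added 1 contributes a full sum of a nontrivial additive character, which
      is 0; it turns the sum into one over squares.\<close>
    also have "\<dots> = (\<Sum>t\<in>{0..<int p}. (1 + of_int (Legendre t (int p))) * unit_char p (N * t))"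
    proof -
      have "(\<Sum>t\<in>{0..<int p}. unit_char p (N * t)) = 0"
      proof -
        have "\<not> int p dvd N" using m p2 by (auto simp: N_def dest!: zdvd_imp_le)
        thus ?thesis using sum_unit_char[OF p0, of N] by (simp add: mult.commute)
      qed
      thus ?thesis by (simp add: chi_def ring_distribs sum.distrib)
    qed
    also have "\<dots> = (\<Sum>r\<in>{0..<int p}. unit_char p (N * r\<^sup>2))"
      by (rule sum_squares_mod_prime[OF p, symmetric]) (auto intro!: unit_char_cong[OF p0] cong_scalar_left)
    also have "\<dots> = (\<Sum>r<p. unit_char p (N * (int r)\<^sup>2))"
      by (intro sum.reindex_bij_witness[of _ int nat]) auto
    also have "\<dots> = (\<Sum>r<p. cis (- (pi * real p / 4)) * cis (pi * (2 * real r - real p)\<^sup>2 / (4 * real p)))"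
    proof (intro sum.cong refl)
      fix r :: nat
      \<comment> \<open>Completing the square leaves the phase \<open>pi * (r^2 + r)\<close>, a
        multiple of \<open>2 pi\<close>.\<close>
      have e: "even (r\<^sup>2 + r)" by simp
      then obtain c where c: "r\<^sup>2 + r = 2 * c" by (elim evenE)
      have cr: "real r ^ 2 + real r = 2 * real c" using c by (simp flip: of_nat_power of_nat_add)
      have "2 * pi * real_of_int (N * (int r)\<^sup>2) / real p
         = (- (pi * real p / 4) + pi * (2 * real r - real p)\<^sup>2 / (4 * real p)) + 2 * pi * real c"
      proof -
        have "2 * pi * real_of_int (N * (int r)\<^sup>2) / real p = pi * (real p + 1) * real r ^ 2 / real p"
          by (simp add: N_def m)
        also have "\<dots> = (- (pi * real p / 4) + pi * (2 * real r - real p)\<^sup>2 / (4 * real p))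
            + pi * (real r ^ 2 + real r)"
          using p0 by (simp add: power2_eq_square field_simps)
        finally show ?thesis by (simp add: cr)
      qed
      moreover have "cis (2 * pi * real c) = 1" using cis_multiple_2pi[of "real c"] by simp
      ultimately show "unit_char p (N * (int r)\<^sup>2)
          = cis (- (pi * real p / 4)) * cis (pi * (2 * real r - real p)\<^sup>2 / (4 * real p))"
        unfolding unit_char_def by (simp only: cis_mult[symmetric] mult_1_right)
    qed
    also have "\<dots> = cis (- (pi * real p / 4)) * T" by (simp add: T_def half_gauss_sum_def sum_distrib_left)
    finally show ?thesis .
  qed
  have c2: "chi 2 * chi 2 = 1" using p2 sq0[of 2] by (auto dest: zdvd_imp_le)
  have Tg: "T = cis (pi * real p / 4) * chi 2 * g"
    using T by (simp add: mult.assoc cis_mult flip: mult.assoc[of "cis _" "cis _"])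
  have p8: "int p mod 8 = 1 \<or> int p mod 8 = 3 \<or> int p mod 8 = 5 \<or> int p mod 8 = 7"
    using p(2) by presburger
  define k where "k = p div 8"
  have chi2: "chi 2 = chi8 (int p)" unfolding chi_def by (rule Legendre_two[OF p(1) p2])
  have chim: "chi (-1) = (-1) ^ m" using Legendre_minus_one[OF p(1) p2] by (simp add: chi_def m)
  define \<epsilon> where "\<epsilon> = (if chi (-1) = 1 then 1 else \<i>)"
  \<comment> \<open>The phase of the completed square, the symbol of 2 and \<open>\<epsilon>\<close>
    depend on \<open>p\<close> modulo 8 and always combine to \<open>cis (pi / 4)\<close>. The wrong
    sign of \<open>g\<close> would therefore give \<open>T\<close> the projection
    \<open>- sqrt p\<close> on this direction, which the strict lower bound excludes.\<close>
  have key: "cis (pi * real p / 4) * chi 2 * \<epsilon> = cis (pi/4)"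
  proof -
    have eq: "cis (pi * real p / 4) = cis (pi * real j / 4)" if "p = 8 * k + j" for j
    proof -
      have "pi * real p / 4 = pi * real j / 4 + 2 * pi * real k" by (simp add: that field_simps)
      moreover have "cis (2 * pi * real k) = 1" using cis_multiple_2pi[of "real k"] by simp
      ultimately show ?thesis by (simp only: cis_mult[symmetric] mult_1_right)
    qed
    have pe: "int p = 8 * int k + int p mod 8" by (simp add: k_def zdiv_int)
    have ii: "- (\<i> * c * \<i>) = c" "\<i> * c * \<i> = - c" for c by (simp_all add: complex_eq_iff)
    from p8 show ?thesis
    proof (elim disjE)
      assume j: "int p mod 8 = 1"
      have "p = 8 * k + 1" "m = 4 * k" using pe j m by linarith+
      thus ?thesis using eq[of 1] j by (simp add: chi2 chi8_def \<epsilon>_def chim)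
    next
      assume j: "int p mod 8 = 3"
      have "p = 8 * k + 3" "m = 4 * k + 1" using pe j m by linarith+
      moreover have "cis (pi * real 3 / 4) = \<i> * cis (pi/4)"
        by (simp add: cis_mult mult.commute flip: cis_pi_half)
      ultimately show ?thesis using eq[of 3] j by (simp add: ii chi2 chi8_def \<epsilon>_def chim)
    next
      assume j: "int p mod 8 = 5"
      have "p = 8 * k + 5" "m = 4 * k + 2" using pe j m by linarith+
      moreover have "cis (pi * real 5 / 4) = - cis (pi/4)"
        using cis_mult[of pi "pi/4"] by (simp add: field_simps)
      ultimately show ?thesis using eq[of 5] j by (simp add: chi2 chi8_def \<epsilon>_def chim)
    next
      assume j: "int p mod 8 = 7"
      have "p = 8 * k + 7" "m = 4 * k + 3" using pe j m by linarith+
      moreover have "cis (pi * real 7 / 4) = - \<i> * cis (pi/4)"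
      proof -
        have "cis (pi * real 7 / 4) = cis pi * (cis (pi/2) * cis (pi/4))"
          unfolding cis_mult by (intro arg_cong[of _ _ cis]) (simp add: field_simps)
        thus ?thesis by simp
      qed
      ultimately show ?thesis using eq[of 7] j by (simp add: ii chi2 chi8_def \<epsilon>_def chim)
    qed
  qed
  have "\<epsilon> * \<epsilon> = chi (-1)" using m1 by (auto simp: \<epsilon>_def)
  moreover have "(of_real (sqrt (real p)) :: complex) * of_real (sqrt (real p)) = of_nat p"
    by (simp flip: of_real_mult)
  ultimately have "(g - \<epsilon> * of_real (sqrt (real p))) * (g + \<epsilon> * of_real (sqrt (real p))) = 0"
    using g2 by (simp add: algebra_simps)
  moreover have "g + \<epsilon> * of_real (sqrt (real p)) \<noteq> 0"
  proof
    assume "g + \<epsilon> * of_real (sqrt (real p)) = 0"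
    hence "g = - (\<epsilon> * of_real (sqrt (real p)))" by (simp add: eq_neg_iff_add_eq_0)
    hence "T = - (cis (pi/4) * of_real (sqrt (real p)))" unfolding Tg using key by (simp add: mult.assoc)
    hence "cis (-(pi/4)) * T = - of_real (sqrt (real p))" by (simp add: cis_mult flip: mult.assoc)
    moreover have "Re (cis (-(pi/4)) * T) > - sqrt (real p)" unfolding T_def
      by (rule half_gauss_sum_lower_bound[OF m]) (use m p2 in auto)
    ultimately show False by simp
  qed
  ultimately have "g = \<epsilon> * of_real (sqrt (real p))" by simp
  hence "S k = chi k * of_real (sqrt (real p)) * \<epsilon>" for k using S by simp
  thus ?thesis unfolding gauss_property_def S_def \<epsilon>_def chi_def by blast
qed

theorem real_primitive_gauss_sum:
  assumes "real_primitive q chi"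
  shows "(\<Sum>r\<in>{0..<int q}. chi r * unit_char q (k * r))
     = chi k * of_real (sqrt (real q)) * (if chi (-1) = 1 then 1 else \<i>)"
proof -
  have "gauss_property q chi"
    using assms
  proof (induction rule: real_primitive_induct)
    case one
    have "{0..<1::int} = {0}" by auto
    thus ?case by (simp add: gauss_property_def)
  next
    case (times q1 q2 chi1 chi2)
    thus ?case by (intro gauss_property_times real_primitive_reciprocity) (auto dest: real_primitiveD)
  qed (auto intro: gauss_property_odd_prime gauss_property_chi4 gauss_property_chi8)
  thus ?thesis by (simp add: gauss_property_def)
qed

section \<open>Mellin transforms of Gaussians\<close>

lemma set_Fubini:
  fixes f :: "real \<Rightarrow> real \<Rightarrow> complex"
  assumes f [measurable]: "(\<lambda>(x, y). f x y) \<in> borel_measurable (borel \<Otimes>\<^sub>M borel)"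
    and [measurable]: "A \<in> sets borel" "B \<in> sets borel"
    and int: "\<And>x. x \<in> A \<Longrightarrow> set_integrable lborel B (f x)"
    and int_norm: "set_integrable lborel A (\<lambda>x. LINT y:B|lborel. norm (f x y))"
  shows "set_integrable lborel B (\<lambda>y. LINT x:A|lborel. f x y)"
    and "(LINT x:A|lborel. LINT y:B|lborel. f x y) = (LINT y:B|lborel. LINT x:A|lborel. f x y)"
proof -
  define F where "F = (\<lambda>(x, y). indicator A x *\<^sub>R indicator B y *\<^sub>R f x y)"
  have F [measurable]: "F \<in> borel_measurable (lborel \<Otimes>\<^sub>M lborel)"
    unfolding F_def by measurable
  have I: "integrable (lborel \<Otimes>\<^sub>M lborel) F"
  proof (rule lborel_pair.Fubini_integrable[OF F])
    have "(\<lambda>x. LINT y|lborel. norm (F (x, y))) = (\<lambda>x. indicator A x *\<^sub>R (LINT y:B|lborel. norm (f x y)))"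
      by (auto simp: F_def set_lebesgue_integral_def fun_eq_iff indicator_def)
    thus "integrable lborel (\<lambda>x. LINT y|lborel. norm (F (x, y)))"
      using int_norm by (simp add: set_integrable_def)
    have "integrable lborel (\<lambda>y. F (x, y))" for x
      using int[of x] by (cases "x \<in> A") (auto simp: F_def set_integrable_def)
    thus "AE x in lborel. integrable lborel (\<lambda>y. F (x, y))" by simp
  qed
  have 1: "(LINT x|lborel. F (x, y)) = indicator B y *\<^sub>R (LINT x:A|lborel. f x y)" for y
    by (cases "y \<in> B") (auto simp: F_def set_lebesgue_integral_def)
  have 2: "(LINT y|lborel. F (x, y)) = indicator A x *\<^sub>R (LINT y:B|lborel. f x y)" for x
    by (cases "x \<in> A") (auto simp: F_def set_lebesgue_integral_def)
  have I': "integrable (lborel \<Otimes>\<^sub>M lborel) (\<lambda>(x, y). F (x, y))" using I by simp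
  show "set_integrable lborel B (\<lambda>y. LINT x:A|lborel. f x y)"
    using lborel_pair.integrable_snd[OF I'] by (simp add: set_integrable_def 1)
  show "(LINT x:A|lborel. LINT y:B|lborel. f x y) = (LINT y:B|lborel. LINT x:A|lborel. f x y)"
    using lborel_pair.Fubini_integral[OF I'] by (simp add: set_lebesgue_integral_def 1[unfolded set_lebesgue_integral_def] 2[unfolded set_lebesgue_integral_def])
qed

lemma set_Fubini_product_bound:
  fixes f :: "real \<Rightarrow> real \<Rightarrow> complex" and g h :: "real \<Rightarrow> real"
  assumes f [measurable]: "(\<lambda>(x, y). f x y) \<in> borel_measurable (borel \<Otimes>\<^sub>M borel)"
    and [measurable]: "A \<in> sets borel" "B \<in> sets borel"
    and g: "set_integrable lborel A g" and h: "set_integrable lborel B h"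
    and bound: "\<And>x y. x \<in> A \<Longrightarrow> y \<in> B \<Longrightarrow> norm (f x y) \<le> g x * h y"
  shows "set_integrable lborel B (\<lambda>y. LINT x:A|lborel. f x y)"
    and "(LINT x:A|lborel. LINT y:B|lborel. f x y) = (LINT y:B|lborel. LINT x:A|lborel. f x y)"
proof -
  have I: "set_integrable lborel B (f x)" if "x \<in> A" for x
  proof (rule set_integrable_bound)
    show "set_integrable lborel B (\<lambda>y. g x * h y)" using h by simp
    show "set_borel_measurable lborel B (f x)" unfolding set_borel_measurable_def by measurable
    show "AE y in lborel. y \<in> B \<longrightarrow> norm (f x y) \<le> norm (g x * h y)"
      using bound[OF that] by (intro AE_I2) force
  qed
  have "set_integrable lborel A (\<lambda>x. LINT y:B|lborel. norm (f x y))"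
  proof (rule set_integrable_bound)
    show "set_integrable lborel A (\<lambda>x. g x * (LINT y:B|lborel. h y))" using g by simp
    show "set_borel_measurable lborel A (\<lambda>x. LINT y:B|lborel. norm (f x y))"
      unfolding set_borel_measurable_def set_lebesgue_integral_def by measurable
    show "AE x in lborel. x \<in> A \<longrightarrow>
        norm (LINT y:B|lborel. norm (f x y)) \<le> norm (g x * (LINT y:B|lborel. h y))"
    proof (intro AE_I2 impI)
      fix x assume x: "x \<in> A"
      have "(LINT y:B|lborel. norm (f x y)) \<le> (LINT y:B|lborel. g x * h y)"
        using I[OF x] h bound[OF x] by (intro set_integral_mono set_integrable_norm) auto
      moreover have "(LINT y:B|lborel. norm (f x y)) \<ge> 0"
        unfolding set_lebesgue_integral_def by (intro Bochner_Integration.integral_nonneg) simp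
      ultimately show "norm (LINT y:B|lborel. norm (f x y)) \<le> norm (g x * (LINT y:B|lborel. h y))"
        by simp
    qed
  qed
  from set_Fubini[OF f assms(2,3) I this]
  show "set_integrable lborel B (\<lambda>y. LINT x:A|lborel. f x y)"
    and "(LINT x:A|lborel. LINT y:B|lborel. f x y) = (LINT y:B|lborel. LINT x:A|lborel. f x y)"
    by blast+
qed

text \<open>Integrability travels with the value, because the integral of a function that is not
  integrable has the default value 0.\<close>

definition has_integral_pos :: "(real \<Rightarrow> complex) \<Rightarrow> complex \<Rightarrow> bool" where
  "has_integral_pos f I \<longleftrightarrow> set_integrable lborel {0<..} f \<and> (LINT x:{0<..}|lborel. f x) = I"

lemma has_integral_pos_cong:
  assumes "\<And>x. x > 0 \<Longrightarrow> f x = g x"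
  shows "has_integral_pos f I \<longleftrightarrow> has_integral_pos g I"
proof -
  have "set_integrable lborel {0<..} f \<longleftrightarrow> set_integrable lborel {0<..} g"
    using assms by (intro set_integrable_cong) auto
  moreover have "(LINT x:{0<..}|lborel. f x) = (LINT x:{0<..}|lborel. g x)"
    using assms by (intro set_lebesgue_integral_cong) auto
  ultimately show ?thesis by (simp add: has_integral_pos_def)
qed

lemma has_integral_pos_cmult: "has_integral_pos f I \<Longrightarrow> has_integral_pos (\<lambda>x. c * f x) (c * I)"
  by (auto simp: has_integral_pos_def)

text \<open>Bridge to gauge integrals, for which the Gamma integral and the change of variables are
  stated.\<close>

lemma has_integral_pos_iff_absolutely_integrable:
  assumes "f \<in> borel_measurable borel"
  shows "has_integral_pos f I \<longleftrightarrow> f absolutely_integrable_on {0<..} \<and> integral {0<..} f = I"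
proof -
  have m: "(\<lambda>x. indicat_real {0<..} x *\<^sub>R f x) \<in> borel_measurable lborel" using assms by measurable
  have "set_integrable lborel {0<..} f \<longleftrightarrow> f absolutely_integrable_on {0<..}"
    unfolding set_integrable_def using integrable_completion[OF m] by simp
  moreover have "(LINT x:{0<..}|lborel. f x) = (LINT x:{0<..}|lebesgue. f x)"
    unfolding set_lebesgue_integral_def using integral_completion[OF m] by simp
  moreover have "f absolutely_integrable_on {0<..} \<Longrightarrow> (LINT x:{0<..}|lebesgue. f x) = integral {0<..} f"
    by (rule set_lebesgue_integral_eq_integral)
  ultimately show ?thesis by (auto simp: has_integral_pos_def)
qed

lemma has_integral_pos_substitution:
  fixes g g' :: "real \<Rightarrow> real"
  assumes "f \<in> borel_measurable borel" "(\<lambda>x. of_real \<bar>g' x\<bar> * f (g x)) \<in> borel_measurable borel"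
    and "\<And>x. x > 0 \<Longrightarrow> (g has_real_derivative g' x) (at x)"
    and "inj_on g {0<..}" "g ` {0<..} = {0<..}"
  shows "has_integral_pos (\<lambda>x. of_real \<bar>g' x\<bar> * f (g x)) I \<longleftrightarrow> has_integral_pos f I"
  using has_absolute_integral_change_of_variables_real[of "{0<..}" g g' f I] assms
  by (simp add: has_integral_pos_iff_absolutely_integrable scaleR_conv_of_real has_field_derivative_at_within)

text \<open>\<open>x powr s\<close> for real \<open>x > 0\<close>, in a form which is visibly measurable in \<open>x\<close>.\<close>

definition rpow :: "real \<Rightarrow> complex \<Rightarrow> complex" where
  "rpow x s = exp (s * of_real (ln x))"

lemma rpow_measurable [measurable]: "(\<lambda>x. rpow x s) \<in> borel_measurable borel"
  unfolding rpow_def by measurable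

lemma powr_conv_rpow: "x > 0 \<Longrightarrow> of_real x powr s = rpow x s"
  by (simp add: rpow_def powr_def Ln_of_real)

lemma rpow_add: "rpow x (s + t) = rpow x s * rpow x t"
  by (simp add: rpow_def exp_add distrib_right)

lemma rpow_minus: "rpow x (-s) = inverse (rpow x s)"
  by (simp add: rpow_def exp_minus)

lemma rpow_diff: "rpow x (s - t) = rpow x s / rpow x t"
  by (simp add: rpow_def exp_diff left_diff_distrib)

lemma rpow_nonzero [simp]: "rpow x s \<noteq> 0"
  by (simp add: rpow_def)

lemma rpow_0 [simp]: "rpow x 0 = 1"
  by (simp add: rpow_def)

lemma rpow_1_left [simp]: "rpow 1 s = 1"
  by (simp add: rpow_def)

lemma rpow_of_nat: "x > 0 \<Longrightarrow> rpow x (of_nat n) = of_real (x ^ n)"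
  by (simp add: rpow_def exp_of_nat_mult exp_of_real)

lemma rpow_of_real: "x > 0 \<Longrightarrow> rpow x (of_real s) = of_real (x powr s)"
  by (simp add: rpow_def powr_def exp_of_real flip: of_real_mult)

lemma rpow_mult: "x > 0 \<Longrightarrow> y > 0 \<Longrightarrow> rpow (x * y) s = rpow x s * rpow y s"
  by (simp add: rpow_def ln_mult exp_add distrib_left)

lemma rpow_power: "x > 0 \<Longrightarrow> rpow (x ^ n) s = rpow x (of_nat n * s)"
  by (simp add: rpow_def ln_realpow mult_ac)

lemma rpow_inverse: "x > 0 \<Longrightarrow> rpow (inverse x) s = rpow x (-s)"
  by (simp add: rpow_def ln_inverse)

lemma norm_rpow_powr: "x > 0 \<Longrightarrow> norm (rpow x s) = x powr Re s"
  by (simp add: rpow_def powr_def)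

lemma has_integral_pos_Gamma:
  assumes "Re s > 0"
  shows "has_integral_pos (\<lambda>x. rpow x (s - 1) * of_real (exp (-x))) (Gamma s)"
proof -
  define f where "f = (\<lambda>t. complex_of_real t powr (s - 1) / of_real (exp t))"
  have eq: "rpow x (s - 1) * of_real (exp (-x)) = f x" if "x > 0" for x
    using that by (simp add: f_def powr_conv_rpow exp_minus divide_inverse flip: exp_of_real)
  have "f absolutely_integrable_on {0<..}"
    using absolutely_integrable_Gamma_integral'[OF assms] by (simp add: f_def)
  hence 1: "(\<lambda>x. rpow x (s - 1) * of_real (exp (-x))) absolutely_integrable_on {0<..}"
    using eq by (subst set_integrable_cong[OF refl refl, of _ _ f]) auto
  have "(f has_integral Gamma s) {0..}" using Gamma_integral_complex[OF assms] by (simp add: f_def)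
  hence "(f has_integral Gamma s) {0<..}"
    by (subst has_integral_spike_set_eq[of "{0<..}" "{0..}"]) (auto intro: negligible_subset[of "{0}"])
  hence "integral {0<..} f = Gamma s" by (rule integral_unique)
  moreover have "integral {0<..} (\<lambda>x. rpow x (s - 1) * of_real (exp (-x))) = integral {0<..} f"
    by (rule integral_cong) (use eq in auto)
  ultimately show ?thesis using 1
    by (subst has_integral_pos_iff_absolutely_integrable) auto
qed

text \<open>Substitution of \<open>c * x ^ k\<close> in the Gamma integral. The exponent
  \<open>k = 1\<close> serves exponentials, \<open>k = 2\<close> Gaussians.\<close>

lemma has_integral_pos_Gamma_scaled:
  assumes s: "Re s > 0" and c: "c > 0" and k: "k > 0"
  shows "has_integral_pos (\<lambda>x. rpow x (s - 1) * of_real (exp (- c * x ^ k)))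
           (rpow c (- s / of_nat k) * Gamma (s / of_nat k) / of_nat k)"
proof -
  define f where "f = (\<lambda>x. rpow x (s / of_nat k - 1) * complex_of_real (exp (-x)))"
  define g where "g = (\<lambda>x::real. c * x ^ k)"
  define g' where "g' = (\<lambda>x::real. c * (of_nat k * x ^ (k - 1)))"
  have [measurable]: "f \<in> borel_measurable borel" unfolding f_def by measurable
  have "has_integral_pos f (Gamma (s / of_nat k))"
    unfolding f_def by (rule has_integral_pos_Gamma) (use s k in simp)
  hence "has_integral_pos (\<lambda>x. of_real \<bar>g' x\<bar> * f (g x)) (Gamma (s / of_nat k))"
  proof (subst has_integral_pos_substitution)
    show "(\<lambda>x. of_real \<bar>g' x\<bar> * f (g x)) \<in> borel_measurable borel" unfolding g_def g'_def by measurable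
    show "(g has_real_derivative g' x) (at x)" for x
      unfolding g_def g'_def by (auto intro!: derivative_eq_intros)
    show "inj_on g {0<..}"
      using c k by (auto simp: inj_on_def g_def power_eq_iff_eq_base)
    show "g ` {0<..} = {0<..}"
    proof (intro equalityI subsetI)
      fix y :: real assume y: "y \<in> {0<..}"
      have "g (root k (y / c)) = y" using y c k by (simp add: g_def)
      moreover have "root k (y / c) \<in> {0<..}" using y c k by simp
      ultimately show "y \<in> g ` {0<..}" by (metis imageI)
    qed (use c in \<open>auto simp: g_def\<close>)
  qed auto
  hence "has_integral_pos (\<lambda>x. (rpow c (- s / of_nat k) / of_nat k) * (of_real \<bar>g' x\<bar> * f (g x)))
     ((rpow c (- s / of_nat k) / of_nat k) * Gamma (s / of_nat k))"
    by (rule has_integral_pos_cmult)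
  also have "?this \<longleftrightarrow> ?thesis"
    unfolding times_divide_eq_left
  proof (rule has_integral_pos_cong)
    fix x :: real assume x: "x > 0"
    have gx: "g x > 0" using x c by (simp add: g_def)
    have e1: "rpow (g x) (s / of_nat k - 1) = rpow c (s / of_nat k - 1) * rpow x (s - of_nat k)"
      using x c k by (simp add: g_def rpow_mult rpow_power right_diff_distrib)
    have e2: "of_real \<bar>g' x\<bar> = rpow c 1 * of_nat k * rpow x (of_nat (k - 1))"
      using x c k rpow_of_nat[of c 1] rpow_of_nat[of x "k - 1"] by (simp add: g'_def)
    have e3: "rpow c (- s / of_nat k) * (rpow c 1 * rpow c (s / of_nat k - 1)) = 1"
      by (simp flip: rpow_add)
    have e4: "rpow x (of_nat (k - 1)) * rpow x (s - of_nat k) = rpow x (s - 1)"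
      using k by (simp add: of_nat_diff flip: rpow_add)
    have "rpow c (- s / of_nat k) * (of_real \<bar>g' x\<bar> * f (g x)) / of_nat k
      = (rpow c (- s / of_nat k) * (rpow c 1 * rpow c (s / of_nat k - 1)))
        * (rpow x (of_nat (k - 1)) * rpow x (s - of_nat k)) * of_real (exp (- g x))"
      unfolding f_def e1 e2 using k by simp
    thus "rpow c (- s / of_nat k) * (of_real \<bar>g' x\<bar> * f (g x)) / of_nat k
      = rpow x (s - 1) * of_real (exp (- c * x ^ k))"
      unfolding e3 e4 by (simp add: g_def)
  qed
  finally show ?thesis .
qed

section \<open>Kummer series and the Mellin transform of a Gaussian times cosh or sinh\<close>

lemma kummer_summable:
  assumes c: "Re c > 0"
  shows "summable (\<lambda>n. norm (pochhammer a n / pochhammer c n * w ^ n / fact n :: complex))"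
proof -
  define f where "f = (\<lambda>n. pochhammer a n / pochhammer c n * w ^ n / fact n)"
  \<comment> \<open>Chosen so that beyond \<open>N\<close> the quotient of consecutive terms is at
    most 1/2; the positive real part of \<open>c\<close> gives
    \<open>norm (c + n) \<ge> n\<close>.\<close>
  obtain N :: nat where N: "real N \<ge> 2 * (norm a + 1) * norm w" using real_arch_simple by blast
  have "summable (\<lambda>n. norm (f n))"
  proof (rule summable_ratio_test[of "1/2" "max N 1"])
    fix n assume n: "max N 1 \<le> n"
    have cn: "norm (c + of_nat n) \<ge> real n" using c complex_Re_le_cmod[of "c + of_nat n"] by simp
    define \<rho> where "\<rho> = (a + of_nat n) * w / ((c + of_nat n) * of_nat (Suc n))"
    have "f (Suc n) = f n * \<rho>" unfolding \<rho>_def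
      by (simp add: f_def pochhammer_Suc mult_ac)
    moreover have "norm \<rho> \<le> 1/2"
    proof -
      have "norm (a + of_nat n) \<le> norm a + real n" using norm_triangle_ineq[of a "of_nat n"] by simp
      also have "\<dots> \<le> (norm a + 1) * real n" using n mult_left_mono[of 1 "real n" "norm a"] by (simp add: algebra_simps)
      finally have "norm (a + of_nat n) * norm w \<le> (norm a + 1) * real n * norm w"
        by (rule mult_right_mono) simp
      also have "\<dots> \<le> real n * (real N / 2)" using N mult_left_mono[OF N, of "real n"] by (simp add: mult_ac)
      also have "\<dots> \<le> norm (c + of_nat n) * (real (Suc n) / 2)"
        using cn n by (intro mult_mono) auto
      finally have *: "norm (a + of_nat n) * norm w \<le> norm (c + of_nat n) * (real (Suc n) / 2)" .
      have "norm (c + of_nat n) > 0" using cn n by (intro less_le_trans[OF _ cn]) simp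
      hence "norm (c + of_nat n) * real (Suc n) > 0" by (intro mult_pos_pos) auto
      thus ?thesis using * by (simp add: \<rho>_def norm_mult norm_divide pos_divide_le_eq del: of_nat_Suc)
    qed
    ultimately show "norm (norm (f (Suc n))) \<le> 1 / 2 * norm (norm (f n))"
      using mult_left_mono[of "norm \<rho>" "1/2" "norm (f n)"] by (simp add: norm_mult)
  qed simp
  thus ?thesis by (simp add: f_def)
qed

lemma kummer_sums:
  "Re c > 0 \<Longrightarrow> (\<lambda>n. pochhammer a n / pochhammer c n * w ^ n / fact n) sums kummer_1F1 a c w"
  unfolding kummer_1F1_def by (rule summable_sums[OF summable_norm_cancel[OF kummer_summable]])

text \<open>The index lets both parts of the theorem share one computation: at imaginary arguments
  \<open>hyp 0\<close> is the cosine and \<open>hyp 1\<close> is \<open>\<i>\<close> times the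
  sine.\<close>

definition hyp :: "nat \<Rightarrow> complex \<Rightarrow> complex" where
  "hyp h w = (if h = 0 then cosh w else sinh w)"

lemma hyp_measurable [measurable]: "hyp h \<in> borel_measurable borel"
  unfolding hyp_def by (cases "h = 0") (auto simp: cosh_def sinh_def intro!: borel_measurable_continuous_onI continuous_intros)

lemma hyp_sums:
  assumes "h \<le> 1"
  shows "(\<lambda>n. w ^ (2 * n + h) / fact (2 * n + h)) sums hyp h w"
proof (cases "h = 0")
  case True
  have "(\<lambda>n. if even n then w ^ n /\<^sub>R fact n else 0) sums cosh w" by (rule cosh_converges)
  hence "(\<lambda>n. if even (2 * n) then w ^ (2 * n) /\<^sub>R fact (2 * n) else 0) sums cosh w"
    by (subst sums_mono_reindex[of "\<lambda>n. 2 * n"]) (auto simp: strict_mono_def elim!: evenE)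
  thus ?thesis using True by (simp add: hyp_def scaleR_conv_of_real field_simps)
next
  case False
  hence h: "h = 1" using assms by simp
  have "(\<lambda>n. if even n then 0 else w ^ n /\<^sub>R fact n) sums sinh w" by (rule sinh_converges)
  hence "(\<lambda>n. if even (2 * n + 1) then 0 else w ^ (2 * n + 1) /\<^sub>R fact (2 * n + 1)) sums sinh w"
    by (subst sums_mono_reindex[of "\<lambda>n. 2 * n + 1"]) (auto simp: strict_mono_def image_iff elim!: oddE)
  thus ?thesis using h by (simp add: hyp_def scaleR_conv_of_real field_simps)
qed

text \<open>Duplication formula for factorials. It converts the coefficients of the cosh and sinh
  series into those of a Kummer series with lower parameter \<open>h + 1/2\<close>.\<close>

lemma fact_double_conv_pochhammer:
  assumes "h \<le> 1"
  shows "(fact (2 * n + h) :: complex) = 4 ^ n * fact n * pochhammer (of_nat h + 1/2) n"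
proof (induction n)
  case 0
  show ?case using assms by (cases h) auto
next
  case (Suc n)
  have "(fact (2 * Suc n + h) :: complex) = (2 * of_nat n + of_nat h + 2) * (2 * of_nat n + of_nat h + 1) * fact (2 * n + h)"
    by (simp add: algebra_simps)
  also have "(2 * of_nat n + of_nat h + 2) * (2 * of_nat n + of_nat h + 1)
     = 4 * (of_nat n + 1) * (of_nat h + 1/2 + of_nat n :: complex)"
    using assms by (cases h) (auto simp: algebra_simps)
  finally show ?case unfolding Suc
    by (simp only: pochhammer_Suc fact_Suc power_Suc of_nat_mult of_nat_Suc mult_ac add_ac)
qed

text \<open>The Mellin transform at \<open>s\<close> of the \<open>n\<close>-th Taylor term of
  \<open>exp (- c x^2) * hyp h (w x)\<close>; \<open>gauss_mellin\<close> is the sum of these in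
  closed form.\<close>

definition gauss_mellin_term :: "real \<Rightarrow> nat \<Rightarrow> complex \<Rightarrow> complex \<Rightarrow> nat \<Rightarrow> complex" where
  "gauss_mellin_term c h w s n = w ^ (2 * n + h) / fact (2 * n + h)
     * (rpow c (- (s + of_nat h) / 2 - of_nat n) * Gamma ((s + of_nat h) / 2 + of_nat n) / 2)"

definition gauss_mellin :: "real \<Rightarrow> nat \<Rightarrow> complex \<Rightarrow> complex \<Rightarrow> complex" where
  "gauss_mellin c h w s = w ^ h * rpow c (- (s + of_nat h) / 2) * Gamma ((s + of_nat h) / 2) / 2
     * kummer_1F1 ((s + of_nat h) / 2) (of_nat h + 1/2) (w\<^sup>2 / (4 * of_real c))"

lemma gauss_mellin_term_eq:
  assumes h: "h \<le> 1" and s: "Re s > 0" and c: "c > 0"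
  shows "gauss_mellin_term c h w s n = w ^ h * rpow c (- (s + of_nat h) / 2) * Gamma ((s + of_nat h) / 2) / 2
     * (pochhammer ((s + of_nat h) / 2) n / pochhammer (of_nat h + 1/2) n * (w\<^sup>2 / (4 * of_real c)) ^ n / fact n)"
proof -
  define u where "u = (s + of_nat h) / 2"
  have u: "u \<notin> \<int>\<^sub>\<le>\<^sub>0"
  proof
    assume "u \<in> \<int>\<^sub>\<le>\<^sub>0"
    hence "Re u \<le> 0" by (auto elim!: nonpos_Ints_cases)
    moreover have "Re u > 0" using s by (simp add: u_def add_pos_nonneg)
    ultimately show False by simp
  qed
  have e1: "Gamma (u + of_nat n) = pochhammer u n * Gamma u"
    using u by (simp add: pochhammer_Gamma Gamma_eq_zero_iff)
  have e2: "rpow c (- u - of_nat n) = rpow c (- u) / of_real c ^ n"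
    using c by (simp add: rpow_diff rpow_of_nat)
  have e3: "w ^ (2 * n + h) = (w\<^sup>2) ^ n * w ^ h" by (simp add: power_add power_mult)
  show ?thesis unfolding gauss_mellin_term_def minus_divide_left[symmetric] u_def[symmetric]
      fact_double_conv_pochhammer[OF h] e1 e2 e3
    by (simp add: power_divide power_mult_distrib mult_ac)
qed

lemma gauss_mellin_sums:
  assumes "h \<le> 1" "Re s > 0" "c > 0"
  shows "gauss_mellin_term c h w s sums gauss_mellin c h w s"
    and "summable (\<lambda>n. norm (gauss_mellin_term c h w s n))"
proof -
  have c: "Re (of_nat h + 1/2) > 0" by (simp add: add_nonneg_pos)
  show "gauss_mellin_term c h w s sums gauss_mellin c h w s"
    unfolding gauss_mellin_term_eq[OF assms, abs_def] gauss_mellin_def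
    by (rule sums_mult[OF kummer_sums[OF c]])
  show "summable (\<lambda>n. norm (gauss_mellin_term c h w s n))"
    unfolding gauss_mellin_term_eq[OF assms] norm_mult[of "_ / 2"]
    by (rule summable_mult[OF kummer_summable[OF c]])
qed

text \<open>Integration term by term of the Taylor series of \<open>hyp h\<close>. The interchange
  is legitimate because the integrals of the norms are summable.\<close>

lemma has_integral_pos_gauss_hyp:
  assumes h: "h \<le> 1" and s: "Re s > 0" and c: "c > 0"
  shows "has_integral_pos (\<lambda>x. rpow x (s - 1) * of_real (exp (- c * x\<^sup>2)) * hyp h (w * of_real x))
           (gauss_mellin c h w s)"
proof -
  define T where "T = (\<lambda>n x. w ^ (2 * n + h) / fact (2 * n + h)
    * (rpow x (s + of_nat (2 * n + h) - 1) * of_real (exp (- c * x\<^sup>2))))"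
  have T: "has_integral_pos (T n) (gauss_mellin_term c h w s n)" for n
  proof -
    have "has_integral_pos (T n) (w ^ (2 * n + h) / fact (2 * n + h) *
       (rpow c (- (s + of_nat (2 * n + h)) / of_nat 2) * Gamma ((s + of_nat (2 * n + h)) / of_nat 2) / of_nat 2))"
      unfolding T_def
      by (intro has_integral_pos_cmult has_integral_pos_Gamma_scaled c) (use s in \<open>auto intro: add_pos_nonneg\<close>)
    also have "(s + of_nat (2 * n + h)) / of_nat 2 = (s + of_nat h) / 2 + of_nat n"
      by (simp add: field_simps)
    also have "- (s + of_nat (2 * n + h)) / of_nat 2 = - (s + of_nat h) / 2 - of_nat n"
      by (simp add: field_simps)
    finally show ?thesis by (simp add: gauss_mellin_term_def)
  qed
  \<comment> \<open>Taking norms replaces \<open>w\<close> by \<open>norm w\<close> and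
    \<open>s\<close> by \<open>Re s\<close>, so the norms again have Mellin terms as integrals and
    the summability already shown applies to them.\<close>
  have nT: "(LINT x:{0<..}|lborel. norm (T n x)) = Re (gauss_mellin_term c h (of_real (norm w)) (of_real (Re s)) n)" for n
  proof -
    define T' where "T' = (\<lambda>x. of_real (norm w) ^ (2 * n + h) / fact (2 * n + h)
       * (rpow x (of_real (Re s) + of_nat (2 * n + h) - 1) * complex_of_real (exp (- c * x\<^sup>2))))"
    have "has_integral_pos T' (of_real (norm w) ^ (2 * n + h) / fact (2 * n + h) *
       (rpow c (- (of_real (Re s) + of_nat (2 * n + h)) / of_nat 2) * Gamma ((of_real (Re s) + of_nat (2 * n + h)) / of_nat 2) / of_nat 2))"
      unfolding T'_def
      by (intro has_integral_pos_cmult has_integral_pos_Gamma_scaled c) (use s in \<open>auto intro: add_pos_nonneg\<close>)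
    also have "(complex_of_real (Re s) + of_nat (2 * n + h)) / of_nat 2 = (of_real (Re s) + of_nat h) / 2 + of_nat n"
      by (simp add: field_simps)
    also have "- (complex_of_real (Re s) + of_nat (2 * n + h)) / of_nat 2 = - (of_real (Re s) + of_nat h) / 2 - of_nat n"
      by (simp add: field_simps)
    finally have "has_integral_pos T' (gauss_mellin_term c h (of_real (norm w)) (of_real (Re s)) n)"
      by (simp add: gauss_mellin_term_def)
    moreover have "has_integral_pos T' (gauss_mellin_term c h (of_real (norm w)) (of_real (Re s)) n)
      \<longleftrightarrow> has_integral_pos (\<lambda>x. of_real (norm (T n x))) (gauss_mellin_term c h (of_real (norm w)) (of_real (Re s)) n)"
    proof (rule has_integral_pos_cong)
      fix x :: real assume x: "x > 0"
      have "rpow x (of_real (Re s) + of_nat (2 * n + h) - 1) = of_real (norm (rpow x (s + of_nat (2 * n + h) - 1)))"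
        using rpow_of_real[OF x, of "Re s + real (2 * n + h) - 1"] x by (simp add: norm_rpow_powr)
      thus "T' x = of_real (norm (T n x))"
        by (simp add: T_def T'_def norm_mult norm_divide norm_power del: of_nat_add)
    qed
    ultimately have "(LINT x:{0<..}|lborel. complex_of_real (norm (T n x))) = gauss_mellin_term c h (of_real (norm w)) (of_real (Re s)) n"
      by (simp add: has_integral_pos_def)
    thus ?thesis by (metis set_integral_complex_of_real Re_complex_of_real)
  qed
  define f where "f = (\<lambda>n x. indicator {0<..} x *\<^sub>R T n x)"
  have fi: "integrable lborel (f n)" "(LINT x|lborel. f n x) = gauss_mellin_term c h w s n" for n
    using T[of n] by (simp_all add: has_integral_pos_def f_def set_integrable_def set_lebesgue_integral_def)
  have sums: "(\<lambda>n. f n x) sums (indicator {0<..} x *\<^sub>R (rpow x (s - 1) * of_real (exp (- c * x\<^sup>2)) * hyp h (w * of_real x)))" 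
    and summ: "summable (\<lambda>n. norm (f n x))" for x
  proof -
    have eq: "f n x = (indicator {0<..} x *\<^sub>R (rpow x (s - 1) * of_real (exp (- c * x\<^sup>2)))) * ((w * of_real x) ^ (2 * n + h) / fact (2 * n + h))" for n
    proof (cases "x > 0")
      case True
      have "rpow x (s + of_nat (2 * n + h) - 1) = rpow x (s - 1) * of_real x ^ (2 * n + h)"
        using rpow_add[of x "s - 1" "of_nat (2 * n + h)"] rpow_of_nat[OF True, of "2 * n + h"]
        by (simp add: algebra_simps)
      thus ?thesis using True by (simp add: f_def T_def power_mult_distrib)
    qed (simp add: f_def)
    show "(\<lambda>n. f n x) sums (indicator {0<..} x *\<^sub>R (rpow x (s - 1) * of_real (exp (- c * x\<^sup>2)) * hyp h (w * of_real x)))"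
      unfolding eq mult_scaleR_left[symmetric] by (rule sums_mult[OF hyp_sums[OF h]])
    have "summable (\<lambda>n. norm ((w * of_real x) ^ n) / fact n)"
      using summable_norm_exp[of "w * of_real x"] by (simp add: norm_power norm_divide field_simps scaleR_conv_of_real norm_mult)
    hence "summable (\<lambda>n. norm ((w * of_real x) ^ (2 * n + h)) / fact (2 * n + h))"
      by (rule summable_reindex[where g = "\<lambda>n. 2 * n + h", unfolded o_def]) (auto simp: inj_on_def)
    thus "summable (\<lambda>n. norm (f n x))"
      unfolding eq norm_mult norm_divide norm_fact by (rule summable_mult)
  qed
  have sumn: "summable (\<lambda>n. LINT x|lborel. norm (f n x))"
  proof -
    have "(LINT x|lborel. norm (f n x)) = Re (gauss_mellin_term c h (of_real (norm w)) (of_real (Re s)) n)" for n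
      unfolding nT[symmetric] by (simp add: f_def set_lebesgue_integral_def)
    moreover have "summable (gauss_mellin_term c h (of_real (norm w)) (of_real (Re s)))"
      by (rule sums_summable[OF gauss_mellin_sums(1)[OF h _ c]]) (use s in simp)
    ultimately show ?thesis by (simp add: summable_Re)
  qed
  have F: "(\<lambda>x. \<Sum>n. f n x) = (\<lambda>x. indicator {0<..} x *\<^sub>R (rpow x (s - 1) * of_real (exp (- c * x\<^sup>2)) * hyp h (w * of_real x)))"
    using sums by (auto simp: sums_iff)
  have "integrable lborel (\<lambda>x. \<Sum>n. f n x)"
    by (rule integrable_suminf[OF fi(1) AE_I2[OF summ] sumn])
  moreover have "(\<lambda>n. LINT x|lborel. f n x) sums (LINT x|lborel. (\<Sum>n. f n x))"
    by (rule sums_integral[OF fi(1) AE_I2[OF summ] sumn])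
  hence "(LINT x|lborel. (\<Sum>n. f n x)) = gauss_mellin c h w s"
    unfolding fi(2) using gauss_mellin_sums(1)[OF h s c] by (rule sums_unique2)
  ultimately show ?thesis
    unfolding F by (simp add: has_integral_pos_def set_integrable_def set_lebesgue_integral_def)
qed

section \<open>Fourier transform of the Gaussian and Fourier inversion\<close>

lemma integrable_lborel_halves:
  fixes f :: "real \<Rightarrow> complex"
  assumes "set_integrable lborel {0<..} f" "set_integrable lborel {0<..} (\<lambda>x. f (-x))"
    and [measurable]: "f \<in> borel_measurable borel"
  shows "integrable lborel f"
proof -
  have "integrable lborel (\<lambda>x. indicator {0<..} (0 + (-1) * x) *\<^sub>R f (- (0 + (-1) * x)))"
    using lborel_integrable_real_affine[OF assms(2)[unfolded set_integrable_def], of "-1" 0] by simp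
  hence 1: "integrable lborel (\<lambda>x. indicator {0<..} (-x) *\<^sub>R f x)" by simp
  have "integrable lborel (\<lambda>x. indicator {0<..} x *\<^sub>R f x + indicator {0<..} (-x) *\<^sub>R f x)"
    by (rule Bochner_Integration.integrable_add[OF assms(1)[unfolded set_integrable_def] 1])
  moreover have "AE x in lborel. indicator {0<..} x *\<^sub>R f x + indicator {0<..} (-x) *\<^sub>R f x = f x"
    using AE_lborel_singleton[of "0::real"] by eventually_elim (auto simp: indicator_def)
  ultimately show ?thesis
    by (subst integrable_cong_AE[of f _ "\<lambda>x. indicator {0<..} x *\<^sub>R f x + indicator {0<..} (-x) *\<^sub>R f x"]) auto
qed

lemma lborel_integral_fold:
  fixes f :: "real \<Rightarrow> complex"
  assumes f: "integrable lborel f"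
  shows "set_integrable lborel {0<..} (\<lambda>x. f x + f (-x))"
    and "(LINT x|lborel. f x) = (LINT x:{0<..}|lborel. f x + f (-x))"
proof -
  have [measurable]: "f \<in> borel_measurable borel" using borel_measurable_integrable[OF f] by simp
  have r: "integrable lborel (\<lambda>x. f (-x))" using lborel_integrable_real_affine[OF f, of "-1" 0] by simp
  have s1: "set_integrable lborel {0<..} f" and s2: "set_integrable lborel {0<..} (\<lambda>x. f (-x))"
    unfolding set_integrable_def by (intro integrable_mult_indicator; simp add: f r)+
  show "set_integrable lborel {0<..} (\<lambda>x. f x + f (-x))" by (rule set_integral_add(1)[OF s1 s2])
  define g where "g = (\<lambda>x. indicator {0<..} x *\<^sub>R f (-x))"
  have g: "integrable lborel g" using s2 by (simp add: set_integrable_def g_def)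
  have "(LINT x|lborel. g x) = (LINT x|lborel. g (-x))"
    using lborel_integral_real_affine[of "-1" g 0] by simp
  moreover have "integrable lborel (\<lambda>x. g (-x))" using lborel_integrable_real_affine[OF g, of "-1" 0] by simp
  moreover have "(LINT x|lborel. f x) = (LINT x|lborel. indicator {0<..} x *\<^sub>R f x + g (-x))"
  proof (rule integral_cong_AE)
    show "AE x in lborel. f x = indicator {0<..} x *\<^sub>R f x + g (-x)"
      using AE_lborel_singleton[of "0::real"] by eventually_elim (auto simp: indicator_def g_def)
  qed (auto simp: g_def)
  ultimately have "(LINT x|lborel. f x) = (LINT x:{0<..}|lborel. f x) + (LINT x|lborel. g x)"
    using s1 by (simp add: set_lebesgue_integral_def set_integrable_def)
  also have "(LINT x|lborel. g x) = (LINT x:{0<..}|lborel. f (-x))"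
    by (simp add: g_def set_lebesgue_integral_def)
  finally show "(LINT x|lborel. f x) = (LINT x:{0<..}|lborel. f x + f (-x))"
    by (simp only: set_integral_add(2)[OF s1 s2])
qed

text \<open>Turns a Mellin transform on the half line into a Fourier transform on the whole
  line.\<close>

lemma set_integral_exp_substitution:
  fixes f :: "real \<Rightarrow> complex"
  assumes [measurable]: "f \<in> borel_measurable borel" and f: "has_integral_pos f I"
  shows "integrable lborel (\<lambda>u. of_real (exp u) * f (exp u))"
    and "(LINT u|lborel. of_real (exp u) * f (exp u)) = I"
proof -
  have "range (exp :: real \<Rightarrow> real) = {0<..}"
  proof (intro equalityI subsetI)
    fix x :: real assume "x \<in> {0<..}"
    hence "x = exp (ln x)" by simp
    thus "x \<in> range exp" by (rule range_eqI)
  qed auto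
  hence *: "(\<lambda>x. \<bar>exp x\<bar> *\<^sub>R f (exp x)) absolutely_integrable_on UNIV \<and> integral UNIV (\<lambda>x. \<bar>exp x\<bar> *\<^sub>R f (exp x)) = I"
    using has_absolute_integral_change_of_variables_real[of UNIV exp exp f I]
      f has_integral_pos_iff_absolutely_integrable[of f I]
    by (auto simp: has_field_derivative_at_within inj_on_def)
  have m: "(\<lambda>x. of_real (exp x) * f (exp x)) \<in> borel_measurable lborel" by measurable
  have 1: "integrable lebesgue (\<lambda>u. of_real (exp u) * f (exp u))"
    using * by (simp add: set_integrable_def scaleR_conv_of_real)
  thus "integrable lborel (\<lambda>u. of_real (exp u) * f (exp u))"
    using integrable_completion[OF m] by simp
  have "(LINT u|lborel. of_real (exp u) * f (exp u)) = (LINT u|lebesgue. of_real (exp u) * f (exp u))"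
    using integral_completion[OF m] by simp
  also have "\<dots> = (LINT u:UNIV|lebesgue. of_real (exp u) * f (exp u))"
    by (simp add: set_lebesgue_integral_def)
  also have "\<dots> = I"
    using * set_lebesgue_integral_eq_integral(2)[of UNIV "\<lambda>u. of_real (exp u) * f (exp u)"]
    by (simp add: scaleR_conv_of_real)
  finally show "(LINT u|lborel. of_real (exp u) * f (exp u)) = I" .
qed

lemma rpow_half_pi: "c > 0 \<Longrightarrow> rpow c (-(1/2)) * of_real (sqrt pi) = of_real (sqrt (pi / c))"
  using rpow_of_real[of c "-(1/2)"] by (simp add: powr_minus powr_half_sqrt real_sqrt_divide field_simps)

lemma kummer_1F1_same:
  assumes "Re a > 0"
  shows "kummer_1F1 a a w = exp w"
proof -
  have "pochhammer a n \<noteq> 0" for n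
    using assms by (auto simp: pochhammer_eq_0_iff)
  hence "(\<lambda>n. pochhammer a n / pochhammer a n * w ^ n / fact n) = (\<lambda>n. w ^ n /\<^sub>R fact n)"
    by (simp add: fun_eq_iff scaleR_conv_of_real field_simps)
  thus ?thesis unfolding kummer_1F1_def exp_def by simp
qed

lemma has_integral_pos_gauss_cosh:
  assumes c: "c > 0"
  shows "has_integral_pos (\<lambda>x. of_real (exp (- c * x\<^sup>2)) * cosh (w * of_real x))
           (of_real (sqrt (pi / c)) / 2 * exp (w\<^sup>2 / (4 * of_real c)))"
proof -
  have "gauss_mellin c 0 w 1 = of_real (sqrt (pi / c)) / 2 * exp (w\<^sup>2 / (4 * of_real c))"
    using rpow_half_pi[OF c] by (simp add: gauss_mellin_def kummer_1F1_same Gamma_one_half_complex)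
  moreover have "has_integral_pos (\<lambda>x. of_real (exp (- c * x\<^sup>2)) * cosh (w * of_real x)) (gauss_mellin c 0 w 1)"
    using has_integral_pos_gauss_hyp[of 0 1 c w] c by (simp add: hyp_def)
  ultimately show ?thesis by (simp only:)
qed

lemma integrable_gauss: "c > 0 \<Longrightarrow> integrable lborel (\<lambda>x. complex_of_real (exp (- c * x\<^sup>2)))"
proof -
  assume c: "c > 0"
  have "set_integrable lborel {0<..} (\<lambda>x. complex_of_real (exp (- c * x\<^sup>2)))"
    using has_integral_pos_gauss_cosh[OF c, of 0] by (simp add: has_integral_pos_def)
  thus ?thesis by (intro integrable_lborel_halves) auto
qed

lemma gauss_fourier:
  assumes c: "c > 0"
  shows "integrable lborel (\<lambda>x. complex_of_real (exp (- c * x\<^sup>2)) * cis (v * x))"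
    and "(LINT x|lborel. complex_of_real (exp (- c * x\<^sup>2)) * cis (v * x)) = of_real (sqrt (pi / c) * exp (- v\<^sup>2 / (4 * c)))"
proof -
  show I: "integrable lborel (\<lambda>x. complex_of_real (exp (- c * x\<^sup>2)) * cis (v * x))"
    by (rule Bochner_Integration.integrable_bound[OF integrable_gauss[OF c]])
       (auto simp: norm_mult cis_conv_exp)
  have "(LINT x|lborel. complex_of_real (exp (- c * x\<^sup>2)) * cis (v * x))
     = (LINT x:{0<..}|lborel. 2 * (of_real (exp (- c * x\<^sup>2)) * cosh ((\<i> * of_real v) * of_real x)))"
    unfolding lborel_integral_fold(2)[OF I]
    by (intro set_lebesgue_integral_cong) (auto simp: cosh_def cis_conv_exp field_simps)
  also have "\<dots> = of_real (sqrt (pi / c)) * exp ((\<i> * of_real v)\<^sup>2 / (4 * of_real c))"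
    using has_integral_pos_gauss_cosh[OF c, of "\<i> * of_real v"] by (simp add: has_integral_pos_def mult_ac)
  also have "(\<i> * of_real v)\<^sup>2 / (4 * of_real c) = complex_of_real (- v\<^sup>2 / (4 * c))"
    by (simp add: power_mult_distrib)
  finally show "(LINT x|lborel. complex_of_real (exp (- c * x\<^sup>2)) * cis (v * x)) = of_real (sqrt (pi / c) * exp (- v\<^sup>2 / (4 * c)))"
    by (simp only: exp_of_real of_real_mult)
qed

text \<open>Gaussian regularisation: the damped inversion integral tends to the undamped one by
  domination, and by Fubini it equals a Gaussian average of \<open>\<phi>\<close> around
  \<open>u\<close> at scale \<open>1 / N\<close>. Continuity at \<open>u\<close> gives the limit of
  the averages, boundedness of \<open>\<phi>\<close> the domination.\<close>

theorem fourier_inversion: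
  fixes \<phi> :: "real \<Rightarrow> complex"
  assumes cont: "continuous_on UNIV \<phi>" and int: "integrable lborel \<phi>"
    and bd: "\<And>u. norm (\<phi> u) \<le> B"
    and int': "integrable lborel (\<lambda>\<tau>. LINT v|lborel. \<phi> v * cis (\<tau> * v))"
  shows "(LINT \<tau>|lborel. (LINT v|lborel. \<phi> v * cis (\<tau> * v)) * cis (- \<tau> * u)) = 2 * pi * \<phi> u"
proof -
  have [measurable]: "\<phi> \<in> borel_measurable borel" by (rule borel_measurable_continuous_onI[OF cont])
  have cism [measurable]: "cis \<in> borel_measurable borel"
    by (intro borel_measurable_continuous_onI continuous_intros)
  define F where "F = (\<lambda>\<tau>. LINT v|lborel. \<phi> v * cis (\<tau> * v))"
  have [measurable]: "F \<in> borel_measurable borel" using borel_measurable_integrable[OF int'] by (simp add: F_def)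
  define N where "N = (\<lambda>n. real (Suc n))"
  have N0: "N n > 0" for n by (simp add: N_def)
  \<comment> \<open>The Fourier transform of a Gaussian damping with this constant is a Gaussian of
    width \<open>1 / N n\<close>.\<close>
  define c where "c = (\<lambda>n. 1 / (2 * (N n)\<^sup>2))"
  have c0: "c n > 0" for n using N0[of n] by (simp add: c_def)
  have Nlim: "(\<lambda>n. inverse (N n)) \<longlonglongrightarrow> 0" unfolding N_def by (rule LIMSEQ_inverse_real_of_nat)
  have clim: "c \<longlonglongrightarrow> 0"
  proof -
    have "(\<lambda>n. inverse (N n) * inverse (N n) / 2) \<longlonglongrightarrow> 0 * 0 / 2" by (intro tendsto_intros Nlim) auto
    thus ?thesis by (simp add: c_def[abs_def] power2_eq_square field_simps)
  qed
  define A where "A = (\<lambda>n. LINT \<tau>|lborel. F \<tau> * cis (- \<tau> * u) * of_real (exp (- c n * \<tau>\<^sup>2)))"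
  have lim1: "A \<longlonglongrightarrow> (LINT \<tau>|lborel. F \<tau> * cis (- \<tau> * u))"
    unfolding A_def
  proof (rule integral_dominated_convergence)
    show "integrable lborel (\<lambda>\<tau>. norm (F \<tau>))" using int' by (simp add: F_def)
    show "AE \<tau> in lborel. (\<lambda>n. F \<tau> * cis (- \<tau> * u) * of_real (exp (- c n * \<tau>\<^sup>2))) \<longlonglongrightarrow> F \<tau> * cis (- \<tau> * u)"
    proof (rule AE_I2)
      fix \<tau> :: real
      have "(\<lambda>n. F \<tau> * cis (- \<tau> * u) * of_real (exp (- c n * \<tau>\<^sup>2))) \<longlonglongrightarrow> F \<tau> * cis (- \<tau> * u) * of_real (exp (- 0 * \<tau>\<^sup>2))"
        by (intro tendsto_intros clim)
      thus "(\<lambda>n. F \<tau> * cis (- \<tau> * u) * of_real (exp (- c n * \<tau>\<^sup>2))) \<longlonglongrightarrow> F \<tau> * cis (- \<tau> * u)" by simp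
    qed
    show "AE \<tau> in lborel. norm (F \<tau> * cis (- \<tau> * u) * of_real (exp (- c n * \<tau>\<^sup>2))) \<le> norm (F \<tau>)" for n
      using c0[of n] by (intro AE_I2) (auto simp: norm_mult intro!: mult_left_le)
  qed measurable
  define g where "g = (\<lambda>n t. \<phi> (u + t / N n) * of_real (exp (- (1/2) * t\<^sup>2)))"
  have A_eq: "A n = sqrt (2 * pi) * (LINT t|lborel. g n t)" for n
  proof -
    have "A n = (LINT \<tau>:UNIV|lborel. LINT v:UNIV|lborel. \<phi> v * (cis (\<tau> * (v - u)) * of_real (exp (- c n * \<tau>\<^sup>2))))"
    proof -
      have cm: "cis (\<tau> * (v - u)) = cis (\<tau> * v) * cis (- \<tau> * u)" for \<tau> v
        by (simp add: cis_mult right_diff_distrib)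
      have "F \<tau> * cis (- \<tau> * u) * of_real (exp (- c n * \<tau>\<^sup>2))
          = (LINT v|lborel. \<phi> v * (cis (\<tau> * (v - u)) * of_real (exp (- c n * \<tau>\<^sup>2))))" for \<tau>
        unfolding F_def cm integral_mult_left_zero[symmetric] by (simp only: mult.assoc)
      thus ?thesis unfolding A_def set_lebesgue_integral_def by simp
    qed
    also have "\<dots> = (LINT v:UNIV|lborel. LINT \<tau>:UNIV|lborel. \<phi> v * (cis (\<tau> * (v - u)) * of_real (exp (- c n * \<tau>\<^sup>2))))"
    proof (rule set_Fubini_product_bound(2))
      show "(\<lambda>(\<tau>, v). \<phi> v * (cis (\<tau> * (v - u)) * of_real (exp (- c n * \<tau>\<^sup>2)))) \<in> borel_measurable (borel \<Otimes>\<^sub>M borel)"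
        by measurable
      show "set_integrable lborel UNIV (\<lambda>\<tau>. norm (complex_of_real (exp (- c n * \<tau>\<^sup>2))))"
        using integrable_norm[OF integrable_gauss[OF c0[of n]]] by (simp add: set_integrable_def)
      show "set_integrable lborel UNIV (\<lambda>v. norm (\<phi> v))"
        using int by (simp add: set_integrable_def)
    qed (auto simp: norm_mult)
    also have "\<dots> = (LINT v|lborel. \<phi> v * (LINT \<tau>|lborel. of_real (exp (- c n * \<tau>\<^sup>2)) * cis ((v - u) * \<tau>)))"
      by (simp add: set_lebesgue_integral_def mult_ac)
    also have "\<dots> = (LINT v|lborel. \<phi> v * of_real (sqrt (2 * pi) * N n * exp (- (1/2) * ((v - u) * N n)\<^sup>2)))"
    proof -
      have "sqrt (pi / c n) * exp (- (v - u)\<^sup>2 / (4 * c n)) = sqrt (2 * pi) * N n * exp (- (1/2) * ((v - u) * N n)\<^sup>2)" for v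
        using N0[of n] by (simp add: c_def real_sqrt_mult real_sqrt_divide power_mult_distrib field_simps)
          (simp add: power2_eq_square algebra_simps)
      thus ?thesis unfolding gauss_fourier(2)[OF c0] by simp
    qed
    also have "\<dots> = \<bar>1 / N n\<bar> *\<^sub>R (LINT t|lborel. \<phi> (u + 1 / N n * t) * of_real (sqrt (2 * pi) * N n * exp (- (1/2) * ((u + 1 / N n * t - u) * N n)\<^sup>2)))"
      by (rule lborel_integral_real_affine) (use N0[of n] in simp)
    also have "(\<lambda>t. \<phi> (u + 1 / N n * t) * of_real (sqrt (2 * pi) * N n * exp (- (1/2) * ((u + 1 / N n * t - u) * N n)\<^sup>2)))
       = (\<lambda>t. (of_real (sqrt (2 * pi)) * of_real (N n)) * g n t)"
      using N0[of n] by (auto simp: g_def fun_eq_iff)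
    finally show ?thesis using N0[of n] by (simp add: scaleR_conv_of_real)
  qed
  have "(\<lambda>n. LINT t|lborel. g n t) \<longlonglongrightarrow> (LINT t|lborel. \<phi> u * of_real (exp (- (1/2) * t\<^sup>2)))"
  proof (rule integral_dominated_convergence)
    show "integrable lborel (\<lambda>t. B * norm (complex_of_real (exp (- (1/2) * t\<^sup>2))))"
      using integrable_norm[OF integrable_gauss[of "1/2"]] by (intro integrable_mult_right) auto
    show "AE t in lborel. (\<lambda>n. g n t) \<longlonglongrightarrow> \<phi> u * of_real (exp (- (1/2) * t\<^sup>2))"
    proof (rule AE_I2)
      fix t :: real
      have "(\<lambda>n. u + t * inverse (N n)) \<longlonglongrightarrow> u + t * 0" by (intro tendsto_intros Nlim)
      hence "(\<lambda>n. u + t / N n) \<longlonglongrightarrow> u" by (simp add: divide_inverse)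
      moreover have "isCont \<phi> u" using cont by (simp add: continuous_on_eq_continuous_at)
      ultimately have "(\<lambda>n. \<phi> (u + t / N n)) \<longlonglongrightarrow> \<phi> u" by (rule isCont_tendsto_compose[rotated])
      thus "(\<lambda>n. g n t) \<longlonglongrightarrow> \<phi> u * of_real (exp (- (1/2) * t\<^sup>2))"
        unfolding g_def by (intro tendsto_intros)
    qed
    show "AE t in lborel. norm (g n t) \<le> B * norm (complex_of_real (exp (- (1/2) * t\<^sup>2)))" for n
      by (intro AE_I2) (auto simp: g_def norm_mult intro!: mult_right_mono bd)
  qed (auto simp: g_def)
  hence "(\<lambda>n. of_real (sqrt (2 * pi)) * (LINT t|lborel. g n t)) \<longlonglongrightarrow> of_real (sqrt (2 * pi)) * (LINT t|lborel. \<phi> u * of_real (exp (- (1/2) * t\<^sup>2)))"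
    by (intro tendsto_intros)
  hence "A \<longlonglongrightarrow> of_real (sqrt (2 * pi)) * (LINT t|lborel. \<phi> u * of_real (exp (- (1/2) * t\<^sup>2)))"
    by (simp only: A_eq[abs_def])
  also have "(LINT t|lborel. \<phi> u * of_real (exp (- (1/2) * t\<^sup>2))) = \<phi> u * of_real (sqrt (2 * pi))"
    using gauss_fourier(2)[of "1/2" 0] by simp
  also have "of_real (sqrt (2 * pi)) * (\<phi> u * of_real (sqrt (2 * pi))) = 2 * pi * \<phi> u"
    by (simp add: mult.left_commute[of _ "\<phi> u"] flip: of_real_mult)
  finally show ?thesis using LIMSEQ_unique[OF lim1] by (simp add: F_def)
qed

text \<open>Differentiation under the integral sign with a bound on the integrand alone: Cauchy's
  inequality on discs of radius \<open>r / 2\<close> turns the bound \<open>g\<close> on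
  \<open>f\<close> into \<open>2 / r * g\<close> for the derivative, hence for the difference
  quotients, and dominated convergence applies.\<close>

lemma holomorphic_on_set_integral:
  fixes f :: "complex \<Rightarrow> real \<Rightarrow> complex"
  assumes S: "open S" and A [measurable]: "A \<in> sets borel"
    and meas [measurable]: "\<And>s. f s \<in> borel_measurable borel"
    and hol: "\<And>x. x \<in> A \<Longrightarrow> (\<lambda>s. f s x) holomorphic_on S"
    and dom: "\<And>s. s \<in> S \<Longrightarrow> \<exists>r>0. cball s r \<subseteq> S \<and>
       (\<exists>g. set_integrable lborel A g \<and> (\<forall>z\<in>cball s r. \<forall>x\<in>A. norm (f z x) \<le> g x))"
  shows "(\<lambda>s. LINT x:A|lborel. f s x) holomorphic_on S"
  unfolding holomorphic_on_open[OF S]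
proof
  fix s assume s: "s \<in> S"
  obtain r g where r: "r > 0" "cball s r \<subseteq> S" and g: "set_integrable lborel A g"
    and gb: "\<And>z x. z \<in> cball s r \<Longrightarrow> x \<in> A \<Longrightarrow> norm (f z x) \<le> g x"
    using dom[OF s] by blast
  have int: "set_integrable lborel A (f z)" if "z \<in> cball s r" for z
  proof (rule set_integrable_bound[OF g])
    show "set_borel_measurable lborel A (f z)" unfolding set_borel_measurable_def by measurable
    show "AE x in lborel. x \<in> A \<longrightarrow> norm (f z x) \<le> norm (g x)"
      using gb[OF that] by (intro AE_I2) force
  qed
  define D where "D = (\<lambda>x. deriv (\<lambda>s. f s x) s)"
  have quot: "norm ((f (s + k) x - f s x) / k) \<le> 2 / r * g x" if "x \<in> A" "norm k \<le> r / 2" "k \<noteq> 0" for x k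
  proof -
    have "norm (f (s + k) x - f s x) \<le> 2 / r * g x * norm (s + k - s)"
    proof (rule field_differentiable_bound[where S = "cball s (r/2)" and f' = "deriv (\<lambda>s. f s x)"])
      fix z assume z: "z \<in> cball s (r/2)"
      have sub: "cball z (r/2) \<subseteq> cball s r"
      proof
        fix y assume "y \<in> cball z (r/2)"
        thus "y \<in> cball s r" using z dist_triangle[of s y z] by (simp add: dist_commute)
      qed
      have hz: "(\<lambda>s. f s x) holomorphic_on cball z (r/2)"
        using hol[OF that(1)] by (rule holomorphic_on_subset) (use sub r in auto)
      have "z \<in> S" using z r by auto
      thus "((\<lambda>s. f s x) has_field_derivative deriv (\<lambda>s. f s x) z) (at z within cball s (r/2))"
        using holomorphic_derivI[OF hol[OF that(1)] S] has_field_derivative_at_within by blast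
      have "norm ((deriv ^^ 1) (\<lambda>s. f s x) z) \<le> fact 1 * g x / (r/2) ^ 1"
      proof (rule Cauchy_inequality)
        show "(\<lambda>s. f s x) holomorphic_on ball z (r/2)"
          using hz by (rule holomorphic_on_subset) auto
        show "continuous_on (cball z (r/2)) (\<lambda>s. f s x)" by (rule holomorphic_on_imp_continuous_on[OF hz])
        show "norm (f y x) \<le> g x" if "norm (z - y) = r / 2" for y
          using gb[of y x] \<open>x \<in> A\<close> sub that by (auto simp: dist_norm)
      qed (use r in auto)
      thus "norm (deriv (\<lambda>s. f s x) z) \<le> 2 / r * g x" by (simp add: field_simps)
    qed (use that r in \<open>auto simp: dist_norm\<close>)
    thus ?thesis using that by (simp add: norm_divide pos_divide_le_eq)
  qed
  have "((\<lambda>k. ((LINT x:A|lborel. f (s + k) x) - (LINT x:A|lborel. f s x)) / k) \<longlongrightarrow> (LINT x:A|lborel. D x)) (at 0)"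
    unfolding tendsto_at_iff_sequentially o_def
  proof (intro allI impI)
    fix X :: "nat \<Rightarrow> complex" assume X0: "\<forall>i. X i \<in> UNIV - {0}" and X: "X \<longlonglongrightarrow> 0"
    obtain N where N: "\<And>n. n \<ge> N \<Longrightarrow> norm (X n) < r / 2"
      using LIMSEQ_D[OF X, of "r/2"] r by auto
    \<comment> \<open>Dropping the first \<open>N\<close> terms keeps every increment within
      \<open>r / 2\<close>, where the difference quotients are dominated.\<close>
    define Y where "Y = (\<lambda>n. X (n + N))"
    have Y: "Y \<longlonglongrightarrow> 0" "\<And>n. Y n \<noteq> 0"
      using X0 by (auto simp: Y_def LIMSEQ_ignore_initial_segment[OF X])
    have Y3: "norm (Y n) \<le> r / 2" for n using N[of "n + N"] by (simp add: Y_def)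
    note Y = Y Y3
    have "(\<lambda>n. LINT x|lborel. indicator A x *\<^sub>R ((f (s + Y n) x - f s x) / Y n)) \<longlonglongrightarrow> (LINT x|lborel. indicator A x *\<^sub>R D x)"
    proof (rule integral_dominated_convergence)
      show "integrable lborel (\<lambda>x. 2 / r * (indicator A x *\<^sub>R g x))"
        using g by (simp add: set_integrable_def)
      have lim: "(\<lambda>n. indicator A x *\<^sub>R ((f (s + Y n) x - f s x) / Y n)) \<longlonglongrightarrow> indicator A x *\<^sub>R D x" for x
      proof (cases "x \<in> A")
        case True
        have "((\<lambda>s. f s x) has_field_derivative D x) (at s)"
          unfolding D_def by (rule holomorphic_derivI[OF hol[OF True] S s])
        hence "((\<lambda>k. (f (s + k) x - f s x) / k) \<longlongrightarrow> D x) (at 0)" by (simp add: DERIV_def)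
        hence "(\<lambda>n. (f (s + Y n) x - f s x) / Y n) \<longlonglongrightarrow> D x"
          by (rule filterlim_compose) (use Y in \<open>auto simp: filterlim_at\<close>)
        thus ?thesis using True by simp
      qed simp
      show "AE x in lborel. (\<lambda>n. indicator A x *\<^sub>R ((f (s + Y n) x - f s x) / Y n)) \<longlonglongrightarrow> indicator A x *\<^sub>R D x"
        using lim by simp
      show "(\<lambda>x. indicator A x *\<^sub>R D x) \<in> borel_measurable lborel"
        by (rule borel_measurable_LIMSEQ_metric[OF _ lim]) measurable
      show "AE x in lborel. norm (indicator A x *\<^sub>R ((f (s + Y n) x - f s x) / Y n)) \<le> 2 / r * (indicator A x *\<^sub>R g x)" for n
        using quot[of _ "Y n"] Y by (intro AE_I2) (auto simp: indicator_def)
    qed measurable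
    also have "(\<lambda>n. LINT x|lborel. indicator A x *\<^sub>R ((f (s + Y n) x - f s x) / Y n))
      = (\<lambda>n. ((LINT x:A|lborel. f (s + Y n) x) - (LINT x:A|lborel. f s x)) / Y n)"
    proof
      fix n
      have mem: "s + Y n \<in> cball s r" "s \<in> cball s r" using Y(3)[of n] r by (auto simp: dist_norm)
      have "(LINT x|lborel. indicator A x *\<^sub>R ((f (s + Y n) x - f s x) / Y n))
          = (LINT x:A|lborel. (f (s + Y n) x - f s x) / Y n)" by (simp only: set_lebesgue_integral_def)
      also have "\<dots> = (LINT x:A|lborel. f (s + Y n) x - f s x) / Y n" by (rule set_integral_divide_zero)
      also have "(LINT x:A|lborel. f (s + Y n) x - f s x) = (LINT x:A|lborel. f (s + Y n) x) - (LINT x:A|lborel. f s x)"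
        by (rule set_integral_diff(2)[OF int int]) (use mem in auto)
      finally show "(LINT x|lborel. indicator A x *\<^sub>R ((f (s + Y n) x - f s x) / Y n))
         = ((LINT x:A|lborel. f (s + Y n) x) - (LINT x:A|lborel. f s x)) / Y n" .
    qed
    finally show "(\<lambda>n. ((LINT x:A|lborel. f (s + X n) x) - (LINT x:A|lborel. f s x)) / X n) \<longlonglongrightarrow> (LINT x:A|lborel. D x)"
      unfolding Y_def set_lebesgue_integral_def[of _ _ D, symmetric]
      by (rule LIMSEQ_offset)
  qed
  hence "((\<lambda>s. LINT x:A|lborel. f s x) has_field_derivative (LINT x:A|lborel. D x)) (at s)"
    by (simp add: DERIV_def)
  thus "\<exists>f'. ((\<lambda>s. LINT x:A|lborel. f s x) has_field_derivative f') (at s)" by blast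
qed

lemma norm_Gamma_le:
  assumes "Re z > 0"
  shows "norm (Gamma z) \<le> Gamma (Re z)"
proof -
  have I: "has_integral_pos (\<lambda>x. rpow x (z - 1) * of_real (exp (-x))) (Gamma z)"
    by (rule has_integral_pos_Gamma[OF assms])
  have J: "has_integral_pos (\<lambda>x. rpow x (of_real (Re z) - 1) * of_real (exp (-x))) (Gamma (of_real (Re z)))"
    by (rule has_integral_pos_Gamma) (use assms in simp)
  have "norm (Gamma z) = norm (LINT x:{0<..}|lborel. rpow x (z - 1) * of_real (exp (-x)))"
    using I by (simp add: has_integral_pos_def)
  also have "\<dots> \<le> (LINT x:{0<..}|lborel. norm (rpow x (z - 1) * of_real (exp (-x))))"
    using I by (intro set_integral_norm_bound) (simp add: has_integral_pos_def)
  also have "complex_of_real \<dots> = (LINT x:{0<..}|lborel. rpow x (of_real (Re z) - 1) * of_real (exp (-x)))"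
    unfolding set_integral_complex_of_real[symmetric]
  proof (intro set_lebesgue_integral_cong)
    show "\<forall>x. x \<in> {0<..} \<longrightarrow> complex_of_real (norm (rpow x (z - 1) * of_real (exp (-x)))) = rpow x (of_real (Re z) - 1) * of_real (exp (-x))"
      using rpow_of_real[of _ "Re z - 1"] by (auto simp: norm_mult norm_rpow_powr)
  qed auto
  hence "(LINT x:{0<..}|lborel. norm (rpow x (z - 1) * of_real (exp (-x)))) = Gamma (Re z)"
    using J unfolding has_integral_pos_def Gamma_complex_of_real by (simp only: of_real_eq_iff)
  finally show ?thesis .
qed

text \<open>Two applications of the functional equation of Gamma produce the factors
  \<open>z\<close> and \<open>z + 1\<close>, each at least as large as the imaginary part. The
  resulting quadratic decay makes the vertical integrals converge.\<close>

lemma norm_Gamma_decay: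
  assumes "Re z > 0"
  shows "(Im z)\<^sup>2 * norm (Gamma z) \<le> Gamma (Re z + 2)"
proof -
  have z: "z \<notin> \<int>\<^sub>\<le>\<^sub>0" "z + 1 \<notin> \<int>\<^sub>\<le>\<^sub>0"
    using assms by (auto elim!: nonpos_Ints_cases simp: complex_eq_iff)
  have "Gamma (z + 1 + 1) = (z + 1) * (z * Gamma z)"
    using Gamma_plus1[OF z(1)] Gamma_plus1[OF z(2)] by simp
  hence "norm (z + 1) * (norm z * norm (Gamma z)) \<le> Gamma (Re z + 2)"
    using norm_Gamma_le[of "z + 1 + 1"] assms by (simp add: norm_mult add.assoc)
  moreover have "(Im z)\<^sup>2 * norm (Gamma z) \<le> norm (z + 1) * norm z * norm (Gamma z)"
  proof (rule mult_right_mono)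
    have "\<bar>Im z\<bar> * \<bar>Im z\<bar> \<le> norm (z + 1) * norm z"
      using abs_Im_le_cmod[of "z + 1"] abs_Im_le_cmod[of z] by (intro mult_mono) auto
    thus "(Im z)\<^sup>2 \<le> norm (z + 1) * norm z" by (simp add: power2_eq_square abs_mult_self_eq)
  qed simp
  ultimately show ?thesis by (simp add: mult.assoc)
qed

text \<open>Every term of the series is bounded both by its value on the real axis and, with the
  factor of \<open>\<tau>^2\<close>, by Gamma at an argument raised by 2. Adding the two estimates
  gives one summable majorant, uniform in \<open>\<tau>\<close>.\<close>

lemma gauss_mellin_bound:
  assumes h: "h \<le> 1" and \<sigma>: "\<sigma> > 0" and c: "c > 0"
  obtains B where "\<And>\<tau>. norm (gauss_mellin c h w (Complex \<sigma> \<tau>)) \<le> B / (1 + \<tau>\<^sup>2)"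
proof -
  define a where "a = (\<lambda>n. norm w ^ (2 * n + h) / fact (2 * n + h) * (c powr (- (\<sigma> + real h) / 2 - real n) / 2))"
  define u where "u = (\<lambda>n. (\<sigma> + real h) / 2 + real n)"
  have u0: "u n > 0" for n using \<sigma> by (simp add: u_def add_pos_nonneg)
  have a0: "a n \<ge> 0" for n by (simp add: a_def)
  have term_eq: "norm (gauss_mellin_term c h w (Complex \<sigma> \<tau>) n) = a n * norm (Gamma (Complex (u n) (\<tau> / 2)))" for \<tau> n
  proof -
    have "(Complex \<sigma> \<tau> + of_nat h) / 2 + of_nat n = Complex (u n) (\<tau> / 2)"
      by (simp add: complex_eq_iff u_def)
    thus ?thesis
      by (simp add: gauss_mellin_term_def a_def norm_mult norm_divide norm_power norm_rpow_powr[OF c])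
  qed
  have s1: "summable (\<lambda>n. a n * Gamma (u n))"
  proof -
    have "norm (gauss_mellin_term c h w (Complex \<sigma> 0) n) = a n * Gamma (u n)" for n
    proof -
      have "Complex (u n) (0 / 2) = of_real (u n)" by (simp add: complex_eq_iff)
      thus ?thesis unfolding term_eq using Gamma_real_pos[OF u0[of n]]
        by (simp only: Gamma_complex_of_real norm_of_real abs_of_pos)
    qed
    thus ?thesis using gauss_mellin_sums(2)[OF h _ c, of "Complex \<sigma> 0" w] \<sigma> by simp
  qed
  \<comment> \<open>Raising the Gamma argument by 2 corresponds to raising the real part of
    \<open>s\<close> by 4, so up to the factor \<open>c^2\<close> this is the Mellin series at
    \<open>\<sigma> + 4\<close>.\<close>
  have s2: "summable (\<lambda>n. a n * Gamma (u n + 2))"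
  proof -
    have "norm (gauss_mellin_term c h w (Complex (\<sigma> + 4) 0) n) = (a n * Gamma (u n + 2)) / c\<^sup>2" for n
    proof -
      have "(Complex (\<sigma> + 4) 0 + of_nat h) / 2 + of_nat n = of_real (u n + 2)"
        by (simp add: complex_eq_iff u_def field_simps)
      moreover have "c powr (- (\<sigma> + 4 + real h) / 2 - real n) = c powr (- (\<sigma> + real h) / 2 - real n) / c\<^sup>2"
      proof -
        have "- (\<sigma> + 4 + real h) / 2 - real n = (- (\<sigma> + real h) / 2 - real n) - 2" by (simp add: field_simps)
        thus ?thesis using c by (simp only: powr_diff powr_numeral)
      qed
      ultimately show ?thesis
        using Gamma_real_pos[of "u n + 2"] u0[of n]
        by (simp add: gauss_mellin_term_def a_def norm_mult norm_divide norm_power norm_rpow_powr[OF c] Gamma_complex_of_real mult_ac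
              del: of_real_add)
    qed
    hence "summable (\<lambda>n. (a n * Gamma (u n + 2)) / c\<^sup>2)"
      using gauss_mellin_sums(2)[OF h _ c, of "Complex (\<sigma> + 4) 0" w] \<sigma> by simp
    thus ?thesis using c by (simp add: summable_divide_iff)
  qed
  define b where "b = (\<lambda>n. a n * Gamma (u n) + 4 * (a n * Gamma (u n + 2)))"
  have sb: "summable b" unfolding b_def by (intro summable_add summable_mult s1 s2)
  have tb: "norm (gauss_mellin_term c h w (Complex \<sigma> \<tau>) n) \<le> b n / (1 + \<tau>\<^sup>2)" for \<tau> n
  proof -
    have "norm (Gamma (Complex (u n) (\<tau> / 2))) \<le> Gamma (u n)"
      using norm_Gamma_le[of "Complex (u n) (\<tau>/2)"] u0[of n] by simp
    moreover have "\<tau>\<^sup>2 * norm (Gamma (Complex (u n) (\<tau> / 2))) \<le> 4 * Gamma (u n + 2)"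
      using norm_Gamma_decay[of "Complex (u n) (\<tau>/2)"] u0[of n] by (simp add: power_divide)
    ultimately have "(1 + \<tau>\<^sup>2) * norm (Gamma (Complex (u n) (\<tau> / 2))) \<le> Gamma (u n) + 4 * Gamma (u n + 2)"
      by (simp add: distrib_right)
    hence "a n * ((1 + \<tau>\<^sup>2) * norm (Gamma (Complex (u n) (\<tau> / 2)))) \<le> a n * (Gamma (u n) + 4 * Gamma (u n + 2))"
      by (rule mult_left_mono[OF _ a0])
    moreover have "1 + \<tau>\<^sup>2 > 0" by (simp add: add_pos_nonneg)
    ultimately show ?thesis unfolding term_eq b_def by (simp add: pos_le_divide_eq algebra_simps)
  qed
  have "norm (gauss_mellin c h w (Complex \<sigma> \<tau>)) \<le> suminf b / (1 + \<tau>\<^sup>2)" for \<tau>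
  proof -
    have S: "gauss_mellin_term c h w (Complex \<sigma> \<tau>) sums gauss_mellin c h w (Complex \<sigma> \<tau>)"
      by (rule gauss_mellin_sums(1)[OF h _ c]) (use \<sigma> in simp)
    have "norm (\<Sum>n. gauss_mellin_term c h w (Complex \<sigma> \<tau>) n) \<le> (\<Sum>n. b n / (1 + \<tau>\<^sup>2))"
      using tb sb by (intro norm_suminf_le summable_divide)
    thus ?thesis using S sb by (simp add: sums_iff suminf_divide)
  qed
  thus ?thesis using that by blast
qed

section \<open>Self-reciprocal kernels\<close>

lemma hyp_eq_exp: "h \<le> 1 \<Longrightarrow> hyp h w = (exp w + (-1) ^ h * exp (-w)) / 2"
  by (cases h) (auto simp: hyp_def cosh_def sinh_def scaleR_conv_of_real field_simps)

lemma hyp_mult: "h \<le> 1 \<Longrightarrow> hyp h a * hyp h b = (cosh (a + b) + (-1) ^ h * cosh (a - b)) / 2"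
  by (cases h) (auto simp: hyp_def cosh_add cosh_diff)

lemma hyp_uminus: "h \<le> 1 \<Longrightarrow> hyp h (-w) = (-1) ^ h * hyp h w"
  by (cases h) (auto simp: hyp_def)

lemma norm_hyp_le: "norm (hyp h w) \<le> exp (norm w)"
proof -
  have e: "norm (exp w) \<le> exp (norm w)" "norm (exp (-w)) \<le> exp (norm w)"
    using norm_exp[of w] norm_exp[of "-w"] by simp_all
  have "2 * norm (hyp h w) \<le> norm (exp w) + norm (exp (-w))"
    using norm_triangle_ineq[of "exp w" "exp (-w)"] norm_triangle_ineq4[of "exp w" "exp (-w)"]
    by (auto simp: hyp_def cosh_def sinh_def)
  thus ?thesis using e by linarith
qed

lemma norm_hyp_imaginary: "norm (hyp h (\<i> * of_real t)) \<le> 1"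
proof -
  have "norm (exp (\<i> * of_real t)) = 1" "norm (exp (- (\<i> * of_real t))) = 1" by simp_all
  thus ?thesis
    using norm_triangle_ineq[of "exp (\<i> * of_real t)" "exp (- (\<i> * of_real t))"]
      norm_triangle_ineq4[of "exp (\<i> * of_real t)" "exp (- (\<i> * of_real t))"]
    by (auto simp: hyp_def cosh_def sinh_def)
qed

lemma has_integral_pos_add:
  "has_integral_pos f I \<Longrightarrow> has_integral_pos g J \<Longrightarrow> has_integral_pos (\<lambda>x. f x + g x) (I + J)"
  by (simp add: has_integral_pos_def)

text \<open>The product-to-sum formula leaves two Gaussian integrals with frequencies
  \<open>w + v\<close> and \<open>w - v\<close>; the common part of their exponents factors out and
  the rest recombines to \<open>hyp h\<close>.\<close>

lemma has_integral_pos_gauss_hyp_hyp: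
  assumes c: "c > 0" and h: "h \<le> 1"
  shows "has_integral_pos (\<lambda>x. of_real (exp (- c * x\<^sup>2)) * hyp h (w * of_real x) * hyp h (v * of_real x))
     (of_real (sqrt (pi / c)) / 2 * exp ((w\<^sup>2 + v\<^sup>2) / (4 * of_real c)) * hyp h (w * v / (2 * of_real c)))"
proof -
  define E where "E = (\<lambda>u. of_real (sqrt (pi / c)) / 2 * exp (u\<^sup>2 / (4 * complex_of_real c)))"
  have "has_integral_pos (\<lambda>x. (1/2) * (of_real (exp (- c * x\<^sup>2)) * cosh ((w + v) * of_real x))
     + ((-1) ^ h / 2) * (of_real (exp (- c * x\<^sup>2)) * cosh ((w - v) * of_real x)))
     ((1/2) * E (w + v) + ((-1) ^ h / 2) * E (w - v))"
    unfolding E_def by (intro has_integral_pos_add has_integral_pos_cmult has_integral_pos_gauss_cosh c)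
  also have "?this \<longleftrightarrow> has_integral_pos (\<lambda>x. of_real (exp (- c * x\<^sup>2)) * hyp h (w * of_real x) * hyp h (v * of_real x))
     ((1/2) * E (w + v) + ((-1) ^ h / 2) * E (w - v))"
  proof (rule has_integral_pos_cong)
    fix x :: real
    show "(1/2) * (of_real (exp (- c * x\<^sup>2)) * cosh ((w + v) * of_real x))
     + ((-1) ^ h / 2) * (of_real (exp (- c * x\<^sup>2)) * cosh ((w - v) * of_real x))
     = of_real (exp (- c * x\<^sup>2)) * hyp h (w * of_real x) * hyp h (v * of_real x)"
      unfolding mult.assoc[of _ "hyp h _"] hyp_mult[OF h] by (simp add: algebra_simps)
  qed
  also have "(1/2) * E (w + v) + ((-1) ^ h / 2) * E (w - v)
     = of_real (sqrt (pi / c)) / 2 * exp ((w\<^sup>2 + v\<^sup>2) / (4 * of_real c)) * hyp h (w * v / (2 * of_real c))"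
  proof -
    have "(w + v)\<^sup>2 / (4 * complex_of_real c) = (w\<^sup>2 + v\<^sup>2) / (4 * of_real c) + w * v / (2 * of_real c)"
         "(w - v)\<^sup>2 / (4 * complex_of_real c) = (w\<^sup>2 + v\<^sup>2) / (4 * of_real c) + - (w * v / (2 * of_real c))"
      using c by (simp_all add: power2_eq_square field_simps)
    thus ?thesis unfolding E_def hyp_eq_exp[OF h] by (simp only: exp_add) (simp add: field_simps)
  qed
  finally show ?thesis .
qed

text \<open>On the critical line the Mellin transform is the Fourier transform of
  \<open>exp (u / 2) * g (exp u)\<close>, to which Fourier inversion applies;
  \<open>gauss_mellin_bound\<close> supplies the integrability of the transform.\<close>

lemma gauss_mellin_inversion:
  assumes h: "h \<le> 1" and c: "c > 0"
  shows "integrable lborel (\<lambda>\<tau>. gauss_mellin c h w (Complex (1/2) \<tau>))"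
    and "x > 0 \<Longrightarrow> (LINT \<tau>|lborel. gauss_mellin c h w (Complex (1/2) \<tau>) * rpow x (- Complex (1/2) \<tau>))
      = 2 * pi * (of_real (exp (- c * x\<^sup>2)) * hyp h (w * of_real x))"
proof -
  define g where "g = (\<lambda>x::real. complex_of_real (exp (- c * x\<^sup>2)) * hyp h (w * of_real x))"
  define \<phi> where "\<phi> = (\<lambda>u. complex_of_real (exp (u / 2)) * g (exp u))"
  have conth: "continuous_on UNIV (hyp h)"
    unfolding hyp_def by (cases "h = 0") (auto simp: cosh_def sinh_def intro!: continuous_intros)
  have cont: "continuous_on UNIV \<phi>"
    unfolding \<phi>_def g_def
    by (intro continuous_intros continuous_on_compose2[OF conth]) auto
  have [measurable]: "\<phi> \<in> borel_measurable borel" by (rule borel_measurable_continuous_onI[OF cont])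
  have cism [measurable]: "cis \<in> borel_measurable borel"
    by (intro borel_measurable_continuous_onI continuous_intros)
  have eq: "of_real (exp u) * (rpow (exp u) (Complex (1/2) \<tau> - 1) * of_real (exp (- c * (exp u)\<^sup>2)) * hyp h (w * of_real (exp u)))
      = \<phi> u * cis (\<tau> * u)" for u \<tau>
  proof -
    have "of_real (exp u) * rpow (exp u) (Complex (1/2) \<tau> - 1) = rpow (exp u) (Complex (1/2) \<tau>)"
      by (simp add: rpow_def left_diff_distrib exp_diff exp_of_real)
    also have "\<dots> = of_real (exp (u / 2)) * cis (\<tau> * u)"
    proof -
      have "Complex (1/2) \<tau> * complex_of_real u = of_real (u / 2) + \<i> * of_real (\<tau> * u)"
        by (simp add: complex_eq_iff)
      thus ?thesis unfolding rpow_def cis_conv_exp by (simp only: ln_exp exp_add exp_of_real)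
    qed
    finally show ?thesis unfolding \<phi>_def g_def mult.assoc[symmetric] by (simp add: mult_ac)
  qed
  have H: "has_integral_pos (\<lambda>x. rpow x (Complex (1/2) \<tau> - 1) * of_real (exp (- c * x\<^sup>2)) * hyp h (w * of_real x))
        (gauss_mellin c h w (Complex (1/2) \<tau>))" for \<tau>
    by (rule has_integral_pos_gauss_hyp[OF h _ c]) simp
  have m: "(\<lambda>x. rpow x (Complex (1/2) \<tau> - 1) * of_real (exp (- c * x\<^sup>2)) * hyp h (w * of_real x)) \<in> borel_measurable borel" for \<tau>
    by measurable
  have I: "integrable lborel (\<lambda>u. \<phi> u * cis (\<tau> * u))"
    and F: "(LINT u|lborel. \<phi> u * cis (\<tau> * u)) = gauss_mellin c h w (Complex (1/2) \<tau>)" for \<tau>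
    using set_integral_exp_substitution[OF m H, of \<tau>] unfolding eq by blast+
  have \<phi>: "integrable lborel \<phi>" using I[of 0] by simp
  have int': "integrable lborel (\<lambda>\<tau>. LINT v|lborel. \<phi> v * cis (\<tau> * v))"
  proof -
    obtain B where B: "\<And>\<tau>. norm (gauss_mellin c h w (Complex (1/2) \<tau>)) \<le> B / (1 + \<tau>\<^sup>2)"
      using gauss_mellin_bound[OF h _ c, of "1/2" w] by auto
    have "integrable lborel (\<lambda>\<tau>::real. B * inverse (1 + \<tau>\<^sup>2))"
      using integrable_inverse_1_plus_square by (simp add: set_integrable_def)
    thus ?thesis
    proof (rule Bochner_Integration.integrable_bound)
      show "AE \<tau> in lborel. norm (LINT v|lborel. \<phi> v * cis (\<tau> * v)) \<le> norm (B * inverse (1 + \<tau>\<^sup>2))"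
      proof (rule AE_I2)
        fix \<tau> :: real
        have "norm (LINT v|lborel. \<phi> v * cis (\<tau> * v)) \<le> B / (1 + \<tau>\<^sup>2)" unfolding F by (rule B)
        also have "\<dots> \<le> \<bar>B / (1 + \<tau>\<^sup>2)\<bar>" by (rule abs_ge_self)
        finally show "norm (LINT v|lborel. \<phi> v * cis (\<tau> * v)) \<le> norm (B * inverse (1 + \<tau>\<^sup>2))"
          by (simp only: real_norm_def divide_inverse)
      qed
    qed measurable
  qed
  thus "integrable lborel (\<lambda>\<tau>. gauss_mellin c h w (Complex (1/2) \<tau>))" by (simp add: F)
  \<comment> \<open>With \<open>x = exp u\<close> the factor \<open>exp (u / 2)\<close> is at most
    \<open>exp x\<close>. The maximum of \<open>(norm w + 1) * x - c * x^2\<close> then gives the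
    constant.\<close>
  have bd: "norm (\<phi> u) \<le> exp ((norm w + 1)\<^sup>2 / (4 * c))" for u
  proof -
    define x where "x = exp u"
    have x: "x > 0" by (simp add: x_def)
    have "u \<le> 2 * x" using exp_ge_add_one_self[of u] x unfolding x_def by linarith
    hence e: "exp (u / 2) \<le> exp x" by simp
    have "norm (hyp h (w * of_real x)) \<le> exp (norm w * x)"
      using norm_hyp_le[of h "w * of_real x"] x by (simp add: norm_mult)
    hence "norm (\<phi> u) \<le> exp x * (exp (- c * x\<^sup>2) * exp (norm w * x))"
      unfolding \<phi>_def g_def norm_mult x_def[symmetric] using e by (intro mult_mono) auto
    also have "\<dots> = exp ((norm w + 1) * x - c * x\<^sup>2)" by (simp add: algebra_simps flip: exp_add)
    also have "(norm w + 1) * x - c * x\<^sup>2 \<le> (norm w + 1)\<^sup>2 / (4 * c)"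
    proof -
      have "0 \<le> (norm w + 1 - 2 * c * x)\<^sup>2" by simp
      hence "4 * c * ((norm w + 1) * x - c * x\<^sup>2) \<le> (norm w + 1)\<^sup>2" by (simp add: power2_eq_square algebra_simps)
      thus ?thesis using c by (simp add: pos_le_divide_eq mult.commute)
    qed
    finally show ?thesis by simp
  qed
  assume x: "x > 0"
  have "2 * pi * \<phi> (ln x) = (LINT \<tau>|lborel. gauss_mellin c h w (Complex (1/2) \<tau>) * cis (- \<tau> * ln x))"
    using fourier_inversion[OF cont \<phi> bd int', of "ln x"] by (simp add: F)
  also have "\<dots> = (LINT \<tau>|lborel. of_real (exp (ln x / 2)) * (gauss_mellin c h w (Complex (1/2) \<tau>) * rpow x (- Complex (1/2) \<tau>)))"
  proof (intro Bochner_Integration.integral_cong refl)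
    fix \<tau>
    have "rpow x (- Complex (1/2) \<tau>) = inverse (of_real (exp (ln x / 2))) * cis (- \<tau> * ln x)"
    proof -
      have "- Complex (1/2) \<tau> * complex_of_real (ln x) = - of_real (ln x / 2) + \<i> * of_real (- \<tau> * ln x)"
        by (simp add: complex_eq_iff)
      thus ?thesis unfolding rpow_def cis_conv_exp by (simp only: exp_add exp_minus exp_of_real)
    qed
    thus "gauss_mellin c h w (Complex (1/2) \<tau>) * cis (- \<tau> * ln x)
      = of_real (exp (ln x / 2)) * (gauss_mellin c h w (Complex (1/2) \<tau>) * rpow x (- Complex (1/2) \<tau>))"
      by (simp add: field_simps)
  qed
  finally have "of_real (exp (ln x / 2)) * (LINT \<tau>|lborel. gauss_mellin c h w (Complex (1/2) \<tau>) * rpow x (- Complex (1/2) \<tau>))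
     = of_real (exp (ln x / 2)) * (2 * pi * g x)"
    using x by (simp add: \<phi>_def mult_ac)
  thus "(LINT \<tau>|lborel. gauss_mellin c h w (Complex (1/2) \<tau>) * rpow x (- Complex (1/2) \<tau>))
      = 2 * pi * (of_real (exp (- c * x\<^sup>2)) * hyp h (w * of_real x))"
    by (simp add: g_def)
qed

text \<open>As \<open>hyp h\<close> of an imaginary argument is \<open>cos\<close> or
  \<open>\<i> * sin\<close>, the factor \<open>\<i> ^ h\<close> only compensates notation, and the
  last assumption says that \<open>K\<close> reproduces itself under the cosine or sine transform.
  The Gaussian transform, the functional equation of \<open>mellin_K\<close> and Parseval's formula
  rest on these assumptions alone.\<close>

locale self_reciprocal_kernel =
  fixes K :: "real \<Rightarrow> complex" and q :: real and h :: nat and C :: real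
  assumes q: "q > 0" and h: "h \<le> 1" and K [measurable]: "K \<in> borel_measurable borel"
    and K_bound: "\<And>x. x > 0 \<Longrightarrow> norm (K x) \<le> C * exp (- (2 * pi / q) * x)"
    and self_reciprocal: "\<And>y. y > 0 \<Longrightarrow>
      (LINT x:{0<..}|lborel. K x * hyp h (\<i> * of_real (2 * pi * x * y / q))) = of_real (sqrt q) / 2 * \<i> ^ h * K y"
begin

definition mellin_K :: "complex \<Rightarrow> complex" where
  "mellin_K s = (LINT x:{0<..}|lborel. rpow x (s - 1) * K x)"

lemma C_nonneg: "C \<ge> 0"
proof -
  have "0 \<le> C * exp (- (2 * pi / q) * 1)" using K_bound[of 1] norm_ge_zero[of "K 1"] by linarith
  thus ?thesis by (simp add: zero_le_mult_iff)
qed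

lemma K_le: "x > 0 \<Longrightarrow> norm (K x) \<le> C"
proof -
  assume x: "x > 0"
  have "C * exp (- (2 * pi / q) * x) \<le> C * 1"
    using x q C_nonneg by (intro mult_left_mono) auto
  thus ?thesis using K_bound[OF x] by simp
qed

lemma set_integrable_power_K:
  assumes "Re s > 0"
  shows "set_integrable lborel {0<..} (\<lambda>x. rpow x (s - 1) * K x)"
proof (rule set_integrable_bound)
  have "has_integral_pos (\<lambda>x. rpow x (s - 1) * of_real (exp (- (2 * pi / q) * x ^ 1)))
     (rpow (2 * pi / q) (- s / of_nat 1) * Gamma (s / of_nat 1) / of_nat 1)"
    by (rule has_integral_pos_Gamma_scaled) (use assms q in auto)
  thus "set_integrable lborel {0<..} (\<lambda>x. of_real C * (rpow x (s - 1) * of_real (exp (- (2 * pi / q) * x))))"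
    by (simp add: has_integral_pos_def)
  show "set_borel_measurable lborel {0<..} (\<lambda>x. rpow x (s - 1) * K x)"
    unfolding set_borel_measurable_def by measurable
  show "AE x in lborel. x \<in> {0<..} \<longrightarrow> norm (rpow x (s - 1) * K x) \<le>
      norm (of_real C * (rpow x (s - 1) * of_real (exp (- (2 * pi / q) * x))))"
    using K_bound C_nonneg
    by (intro AE_I2) (auto simp: norm_mult mult.left_commute[of C] intro!: mult_left_mono)
qed

lemma set_integrable_K: "set_integrable lborel {0<..} K"
  using set_integrable_power_K[of 1] by simp

lemma set_integrable_mult_K:
  assumes [measurable]: "g \<in> borel_measurable borel" and g: "set_integrable lborel {0<..} g"
  shows "set_integrable lborel {0<..} (\<lambda>x. g x * K x)"
proof (rule set_integrable_bound)
  show "set_integrable lborel {0<..} (\<lambda>x. of_real C * g x)" using g by simp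
  show "set_borel_measurable lborel {0<..} (\<lambda>x. g x * K x)"
    unfolding set_borel_measurable_def by measurable
  show "AE x in lborel. x \<in> {0<..} \<longrightarrow> norm (g x * K x) \<le> norm (of_real C * g x)"
    using K_le C_nonneg by (intro AE_I2) (auto simp: norm_mult mult.commute[of C] intro!: mult_left_mono)
qed

text \<open>Replacing \<open>K\<close> by its own transform and exchanging the integrals moves the
  transform onto \<open>g\<close>. This is the way in which self-reciprocity is used.\<close>

lemma integral_mult_K_transform:
  assumes g [measurable]: "g \<in> borel_measurable borel" and gi: "set_integrable lborel {0<..} g"
  shows "(LINT x:{0<..}|lborel. g x * K x) = 2 / (of_real (sqrt q) * \<i> ^ h) *
    (LINT y:{0<..}|lborel. K y * (LINT x:{0<..}|lborel. g x * hyp h (\<i> * of_real (2 * pi * y / q) * of_real x)))"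
proof -
  have q0: "complex_of_real (sqrt q) \<noteq> 0" using q by simp
  have "(LINT x:{0<..}|lborel. g x * K x) = (LINT x:{0<..}|lborel. 
      2 / (of_real (sqrt q) * \<i> ^ h) * (LINT y:{0<..}|lborel. g x * K y * hyp h (\<i> * of_real (2 * pi * y / q) * of_real x)))"
  proof (intro set_lebesgue_integral_cong allI impI)
    fix x :: real assume x: "x \<in> {0<..}"
    have "(LINT y:{0<..}|lborel. g x * K y * hyp h (\<i> * of_real (2 * pi * y / q) * of_real x))
        = g x * (LINT y:{0<..}|lborel. K y * hyp h (\<i> * of_real (2 * pi * y * x / q)))"
      by (simp add: mult.assoc flip: set_integral_mult_right)
    also have "\<dots> = g x * (of_real (sqrt q) / 2 * \<i> ^ h * K x)" using self_reciprocal[of x] x by simp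
    finally have *: "(LINT y:{0<..}|lborel. g x * K y * hyp h (\<i> * of_real (2 * pi * y / q) * of_real x))
       = g x * (of_real (sqrt q) / 2 * \<i> ^ h * K x)" .
    show "g x * K x = 2 / (of_real (sqrt q) * \<i> ^ h) * (LINT y:{0<..}|lborel. g x * K y * hyp h (\<i> * of_real (2 * pi * y / q) * of_real x))"
      unfolding * using q0 by simp
  qed auto
  also have "\<dots> = 2 / (of_real (sqrt q) * \<i> ^ h) * (LINT x:{0<..}|lborel. LINT y:{0<..}|lborel. g x * K y * hyp h (\<i> * of_real (2 * pi * y / q) * of_real x))"
    by simp
  also have "(LINT x:{0<..}|lborel. LINT y:{0<..}|lborel. g x * K y * hyp h (\<i> * of_real (2 * pi * y / q) * of_real x))
     = (LINT y:{0<..}|lborel. LINT x:{0<..}|lborel. g x * K y * hyp h (\<i> * of_real (2 * pi * y / q) * of_real x))"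
  proof (rule set_Fubini_product_bound(2))
    show "set_integrable lborel {0<..} (\<lambda>x. norm (g x))" by (rule set_integrable_norm[OF gi])
    show "set_integrable lborel {0<..} (\<lambda>x. norm (K x))" by (rule set_integrable_norm[OF set_integrable_K])
    show "norm (g x * K y * hyp h (\<i> * of_real (2 * pi * y / q) * of_real x)) \<le> norm (g x) * norm (K y)" for x y
      using norm_hyp_imaginary[of h "2 * pi * y / q * x"]
      by (auto simp: norm_mult mult.assoc intro!: mult_left_le mult_left_mono)
  qed measurable
  also have "\<dots> = (LINT y:{0<..}|lborel. K y * (LINT x:{0<..}|lborel. g x * hyp h (\<i> * of_real (2 * pi * y / q) * of_real x)))"
    by (simp add: mult_ac flip: set_integral_mult_right)
  finally show ?thesis .
qed

lemma set_integrable_gauss_hyp_K: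
  assumes c: "c > 0"
  shows "set_integrable lborel {0<..} (\<lambda>x. of_real (exp (- c * x\<^sup>2)) * hyp h (w * of_real x) * K x)"
proof (rule set_integrable_mult_K)
  show "set_integrable lborel {0<..} (\<lambda>x. of_real (exp (- c * x\<^sup>2)) * hyp h (w * of_real x))"
    using has_integral_pos_gauss_hyp[OF h _ c, of 1 w] by (simp add: has_integral_pos_def)
qed measurable

text \<open>The transform of a Gaussian times \<open>hyp h\<close> is of the same shape, with
  \<open>\<alpha>\<close> replaced by its inverse. Two imaginary frequencies multiply to a real one,
  which turns sine into sinh, and since \<open>b^2 = c * z^2\<close> the exponent
  \<open>- b^2 / (4 c)\<close> is \<open>- z^2 / 4\<close>.\<close>

theorem gauss_transform:
  assumes \<alpha>: "\<alpha> > 0" "\<beta> > 0" "\<alpha> * \<beta> = 1"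
  shows "(LINT x:{0<..}|lborel. of_real (exp (- (pi * \<alpha>\<^sup>2 / q) * x\<^sup>2)) * hyp h (\<i> * (of_real (sqrt pi * \<alpha> / sqrt q) * z) * of_real x) * K x)
    = \<i> ^ h * of_real \<beta> * exp (- z\<^sup>2 / 4) *
      (LINT x:{0<..}|lborel. of_real (exp (- (pi * \<beta>\<^sup>2 / q) * x\<^sup>2)) * hyp h (of_real (sqrt pi * \<beta> / sqrt q) * z * of_real x) * K x)"
proof -
  define c where "c = pi * \<alpha>\<^sup>2 / q"
  define c' where "c' = pi * \<beta>\<^sup>2 / q"
  define b where "b = of_real (sqrt pi * \<alpha> / sqrt q) * z"
  define b' where "b' = of_real (sqrt pi * \<beta> / sqrt q) * z"
  have c: "c > 0" using \<alpha> q by (simp add: c_def)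
  have \<beta>: "\<beta> = 1 / \<alpha>" using \<alpha> by (simp add: field_simps)
  define g where "g = (\<lambda>x::real. complex_of_real (exp (- c * x\<^sup>2)) * hyp h (\<i> * b * of_real x))"
  have [measurable]: "g \<in> borel_measurable borel" unfolding g_def by measurable
  have gi: "set_integrable lborel {0<..} g"
    unfolding g_def using has_integral_pos_gauss_hyp[OF h _ c, of 1 "\<i> * b"] by (simp add: has_integral_pos_def)
  have sq: "complex_of_real (sqrt q) * complex_of_real (sqrt q) = of_real q"
    "complex_of_real (sqrt pi) * complex_of_real (sqrt pi) = of_real pi"
    using q by (simp_all flip: of_real_mult)
  have inner: "(LINT x:{0<..}|lborel. g x * hyp h (\<i> * of_real (2 * pi * y / q) * of_real x))
     = of_real (sqrt q * \<beta>) / 2 * (-1) ^ h * exp (- z\<^sup>2 / 4) * (of_real (exp (- c' * y\<^sup>2)) * hyp h (b' * of_real y))" for y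
  proof -
    define v where "v = \<i> * complex_of_real (2 * pi * y / q)"
    have "(LINT x:{0<..}|lborel. g x * hyp h (v * of_real x))
       = of_real (sqrt (pi / c)) / 2 * exp (((\<i> * b)\<^sup>2 + v\<^sup>2) / (4 * of_real c)) * hyp h (\<i> * b * v / (2 * of_real c))"
      unfolding g_def using has_integral_pos_gauss_hyp_hyp[OF c h, of "\<i> * b" v] by (simp add: has_integral_pos_def)
    also have "sqrt (pi / c) = sqrt q * \<beta>" using \<alpha> q by (simp add: c_def \<beta> real_sqrt_divide)
    also have "((\<i> * b)\<^sup>2 + v\<^sup>2) / (4 * of_real c) = - z\<^sup>2 / 4 + of_real (- c' * y\<^sup>2)"
    proof -
      have "b\<^sup>2 = of_real c * z\<^sup>2"
        using q by (simp add: b_def c_def power_mult_distrib power_divide power2_eq_square sq)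
      moreover have "v\<^sup>2 / (4 * of_real c) = of_real (- c' * y\<^sup>2)"
        using \<alpha> q by (simp add: v_def c_def c'_def \<beta> power2_eq_square field_simps)
      ultimately show ?thesis using c by (simp add: power_mult_distrib add_divide_distrib field_simps)
    qed
    also have "\<i> * b * v / (2 * of_real c) = - (b' * of_real y)"
      using \<alpha> q by (simp add: b_def v_def c_def b'_def \<beta> power2_eq_square field_simps sq)
        (simp add: mult.assoc[symmetric] sq)?
    finally have "(LINT x:{0<..}|lborel. g x * hyp h (v * of_real x)) =
       of_real (sqrt q * \<beta>) / 2 * (exp (- z\<^sup>2 / 4) * of_real (exp (- c' * y\<^sup>2))) * ((-1) ^ h * hyp h (b' * of_real y))"
      by (simp only: exp_add exp_of_real hyp_uminus[OF h])
    thus ?thesis unfolding v_def by (simp only: mult_ac)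
  qed
  have "(LINT x:{0<..}|lborel. g x * K x) = 2 / (of_real (sqrt q) * \<i> ^ h) *
    (LINT y:{0<..}|lborel. (of_real (sqrt q * \<beta>) / 2 * (-1) ^ h * exp (- z\<^sup>2 / 4)) * (of_real (exp (- c' * y\<^sup>2)) * hyp h (b' * of_real y) * K y))"
  proof -
    have "(LINT x:{0<..}|lborel. g x * K x) = 2 / (of_real (sqrt q) * \<i> ^ h) *
        (LINT y:{0<..}|lborel. K y * (LINT x:{0<..}|lborel. g x * hyp h (\<i> * of_real (2 * pi * y / q) * of_real x)))"
      by (rule integral_mult_K_transform[OF _ gi]) measurable
    thus ?thesis unfolding inner by (simp only: mult_ac)
  qed
  also have "\<dots> = 2 / (of_real (sqrt q) * \<i> ^ h) * (of_real (sqrt q * \<beta>) / 2 * (-1) ^ h * exp (- z\<^sup>2 / 4)) *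
     (LINT y:{0<..}|lborel. of_real (exp (- c' * y\<^sup>2)) * hyp h (b' * of_real y) * K y)"
    by simp
  also have "2 / (of_real (sqrt q) * \<i> ^ h) * (of_real (sqrt q * \<beta>) / 2 * (-1) ^ h * exp (- z\<^sup>2 / 4)) = \<i> ^ h * of_real \<beta> * exp (- z\<^sup>2 / 4)"
    using q h by (cases h) (auto simp: field_simps)
  finally show ?thesis unfolding g_def b_def b'_def c_def c'_def by simp
qed

end

section \<open>Theta moments, functional equation and Parseval's formula\<close>

context self_reciprocal_kernel
begin

text \<open>Plays the part of the theta function: its transformation under inversion of
  \<open>\<alpha>\<close> becomes, after a Mellin transform in \<open>\<alpha>\<close>, the
  functional equation of \<open>mellin_K\<close>.\<close>

definition theta_moment :: "real \<Rightarrow> complex" where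
  "theta_moment \<alpha> = (LINT x:{0<..}|lborel. of_real x ^ h * of_real (exp (- (pi * \<alpha>\<^sup>2 / q) * x\<^sup>2)) * K x)"

lemma theta_moment_measurable [measurable]: "theta_moment \<in> borel_measurable borel"
  unfolding theta_moment_def[abs_def] set_lebesgue_integral_def by measurable

text \<open>The function \<open>x ^ h * exp (- c x^2)\<close> reproduces its shape under the cosine
  or sine transform, with \<open>\<alpha>\<close> replaced by its inverse;
  \<open>integral_mult_K_transform\<close> carries this over to the moment.\<close>

lemma theta_moment_inverse:
  assumes \<alpha>: "\<alpha> > 0"
  shows "theta_moment \<alpha> = rpow \<alpha> (- (2 * of_nat h + 1)) * theta_moment (inverse \<alpha>)"
proof -
  define c where "c = pi * \<alpha>\<^sup>2 / q"
  define c' where "c' = pi * (inverse \<alpha>)\<^sup>2 / q"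
  have c: "c > 0" using \<alpha> q by (simp add: c_def)
  define g where "g = (\<lambda>x::real. complex_of_real x ^ h * of_real (exp (- c * x\<^sup>2)))"
  have [measurable]: "g \<in> borel_measurable borel" unfolding g_def by measurable
  have geq: "g x = rpow x ((of_nat h + 1) - 1) * of_real (exp (- c * x\<^sup>2))" if "x > 0" for x
    using rpow_of_nat[OF that, of h] by (simp add: g_def)
  have "has_integral_pos (\<lambda>x. rpow x ((of_nat h + 1) - 1) * of_real (exp (- c * x\<^sup>2)))
     (rpow c (- (of_nat h + 1) / of_nat 2) * Gamma ((of_nat h + 1) / of_nat 2) / of_nat 2)"
    by (rule has_integral_pos_Gamma_scaled[OF _ c]) (auto simp: add_nonneg_pos)
  hence "has_integral_pos g (rpow c (- (of_nat h + 1) / of_nat 2) * Gamma ((of_nat h + 1) / of_nat 2) / of_nat 2)"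
    by (subst has_integral_pos_cong[OF geq]) auto
  hence gi: "set_integrable lborel {0<..} g" by (simp add: has_integral_pos_def)
  define \<kappa> where "\<kappa> = rpow c (- (of_nat h + 1/2)) * Gamma (of_nat h + 1/2) / 2"
  have inner: "(LINT x:{0<..}|lborel. g x * hyp h (\<i> * of_real (2 * pi * y / q) * of_real x))
     = \<kappa> * (\<i> * of_real (2 * pi / q)) ^ h * (of_real y ^ h * of_real (exp (- c' * y\<^sup>2)))" for y
  proof -
    define v where "v = \<i> * complex_of_real (2 * pi * y / q)"
    have "has_integral_pos (\<lambda>x. rpow x ((of_nat h + 1) - 1) * of_real (exp (- c * x\<^sup>2)) * hyp h (v * of_real x))
        (gauss_mellin c h v (of_nat h + 1))"
      by (rule has_integral_pos_gauss_hyp[OF h _ c]) (simp add: add_nonneg_pos)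
    hence "has_integral_pos (\<lambda>x. g x * hyp h (v * of_real x)) (gauss_mellin c h v (of_nat h + 1))"
      by (subst has_integral_pos_cong[where g = "\<lambda>x. rpow x ((of_nat h + 1) - 1) * of_real (exp (- c * x\<^sup>2)) * hyp h (v * of_real x)"])
         (auto simp: geq)
    \<comment> \<open>At \<open>s = h + 1\<close> the two parameters of the Kummer series coincide
      and it collapses to the exponential.\<close>
    moreover have "gauss_mellin c h v (of_nat h + 1) = v ^ h * \<kappa> * exp (v\<^sup>2 / (4 * of_real c))"
    proof -
      have e: "(of_nat h + 1 + of_nat h) / 2 = of_nat h + (1/2 :: complex)" by (simp add: field_simps)
      have "Re (of_nat h + 1/2) > 0" by (simp add: add_nonneg_pos)
      thus ?thesis unfolding gauss_mellin_def minus_divide_left[symmetric] e \<kappa>_def by (simp add: kummer_1F1_same mult.assoc)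
    qed
    moreover have "v\<^sup>2 / (4 * of_real c) = of_real (- c' * y\<^sup>2)"
      using \<alpha> q by (simp add: v_def c_def c'_def power2_eq_square field_simps)
    moreover have "v ^ h = (\<i> * of_real (2 * pi / q)) ^ h * of_real y ^ h"
      by (simp add: v_def power_mult_distrib power_divide)
    ultimately show ?thesis unfolding v_def[symmetric] has_integral_pos_def
      by (simp only: exp_of_real) (simp only: mult_ac)
  qed
  have "theta_moment \<alpha> = (LINT x:{0<..}|lborel. g x * K x)"
    by (simp add: theta_moment_def g_def c_def)
  also have "\<dots> = 2 / (of_real (sqrt q) * \<i> ^ h) *
        (LINT y:{0<..}|lborel. K y * (LINT x:{0<..}|lborel. g x * hyp h (\<i> * of_real (2 * pi * y / q) * of_real x)))"
    by (rule integral_mult_K_transform[OF _ gi]) measurable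
  also have "\<dots> = 2 / (of_real (sqrt q) * \<i> ^ h) * (LINT y:{0<..}|lborel. 
       (\<kappa> * (\<i> * of_real (2 * pi / q)) ^ h) * (of_real y ^ h * of_real (exp (- c' * y\<^sup>2)) * K y))"
    unfolding inner by (simp only: mult_ac)
  also have "\<dots> = 2 / (of_real (sqrt q) * \<i> ^ h) * (\<kappa> * (\<i> * of_real (2 * pi / q)) ^ h) * theta_moment (inverse \<alpha>)"
    unfolding set_integral_mult_right theta_moment_def c'_def by (simp only: mult.assoc)
  also have "2 / (of_real (sqrt q) * \<i> ^ h) * (\<kappa> * (\<i> * of_real (2 * pi / q)) ^ h) = rpow \<alpha> (- (2 * of_nat h + 1))"
  proof -
    have sc: "rpow c (-(1/2)) * of_real (sqrt pi) = of_real (sqrt q / \<alpha>)"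
      using rpow_half_pi[OF c] \<alpha> q by (simp add: c_def real_sqrt_divide)
    have r1: "rpow \<alpha> (- of_nat n) = of_real (1 / \<alpha> ^ n)" for n
      using \<alpha> by (simp add: rpow_minus rpow_of_nat divide_inverse)
    have rc: "rpow c (-(3/2)) = rpow c (-(1/2)) / of_real c"
      using rpow_diff[of c "-(1/2)" 1] rpow_of_nat[OF c, of 1] by simp
    have G: "Gamma (3/2 :: complex) = of_real (sqrt pi) / 2"
    proof -
      have "(1/2 :: complex) \<notin> \<int>\<^sub>\<le>\<^sub>0" by (auto elim!: nonpos_Ints_cases simp: complex_eq_iff)
      thus ?thesis using Gamma_plus1[of "1/2 :: complex"] Gamma_one_half_complex by simp
    qed
    show ?thesis
    proof (cases h)
      case 0
      have "\<kappa> = of_real (sqrt q / \<alpha>) / 2"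
        using sc 0 by (simp add: \<kappa>_def Gamma_one_half_complex)
      thus ?thesis using 0 q \<alpha> r1[of 1] by simp
    next
      case (Suc n)
      hence h1: "h = 1" using h by simp
      have "\<kappa> = rpow c (-(1/2)) * of_real (sqrt pi) / of_real c / 4"
      proof -
        have "\<kappa> = rpow c (-(3/2)) * Gamma (3/2) / 2" unfolding \<kappa>_def h1 by simp
        thus ?thesis unfolding rc G by simp
      qed
      also have "\<dots> = of_real (sqrt q / \<alpha>) / of_real c / 4" by (simp only: sc)
      finally have k: "\<kappa> = of_real (sqrt q / \<alpha>) / of_real c / 4" .
      have r3: "rpow \<alpha> (- (2 * of_nat h + 1)) = of_real (1 / \<alpha> ^ 3)" using r1[of 3] by (simp add: h1)
      show ?thesis unfolding r3 k using q \<alpha> by (simp add: h1 c_def field_simps power2_eq_square power3_eq_cube)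
    qed
  qed
  finally show ?thesis .
qed

text \<open>With the integrals exchanged, the integral over \<open>\<alpha>\<close> is a Gamma
  integral and contributes the power \<open>- w\<close> of \<open>x\<close>, so \<open>K\<close> is
  left with its Mellin transform at \<open>h + 1 - w\<close>.\<close>

lemma theta_moment_mellin:
  assumes w: "Re w > 0" "Re w < real h + 1"
  shows "has_integral_pos (\<lambda>\<alpha>. rpow \<alpha> (w - 1) * theta_moment \<alpha>)
    (Gamma (w / 2) / 2 * rpow (pi / q) (- w / 2) * mellin_K (of_nat h + 1 - w))"
proof -
  define f where "f = (\<lambda>x \<alpha>. rpow \<alpha> (w - 1) * (of_real x ^ h * of_real (exp (- (pi * \<alpha>\<^sup>2 / q) * x\<^sup>2)) * K x))"
  have pq: "pi / q > 0" using q by simp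
  have inner: "has_integral_pos (\<lambda>\<alpha>. rpow \<alpha> (u - 1) * of_real (exp (- (pi * \<alpha>\<^sup>2 / q) * x\<^sup>2)))
     (rpow (pi / q) (- u / 2) * rpow x (- u) * Gamma (u / 2) / 2)" if x: "x > 0" and u: "Re u > 0" for x u
  proof -
    have "has_integral_pos (\<lambda>\<alpha>. rpow \<alpha> (u - 1) * of_real (exp (- (pi / q * x\<^sup>2) * \<alpha> ^ 2)))
       (rpow (pi / q * x\<^sup>2) (- u / of_nat 2) * Gamma (u / of_nat 2) / of_nat 2)"
      by (rule has_integral_pos_Gamma_scaled) (use x u q in auto)
    moreover have "rpow (pi / q * x\<^sup>2) (- u / of_nat 2) = rpow (pi / q) (- u / 2) * rpow x (- u)"
      using rpow_mult[OF pq, of "x\<^sup>2"] rpow_power[OF x, of 2] x by simp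
    moreover have "- (pi / q * x\<^sup>2) * \<alpha> ^ 2 = - (pi * \<alpha>\<^sup>2 / q) * x\<^sup>2" for \<alpha> by simp
    ultimately show ?thesis by (simp add: mult_ac)
  qed
  have fx: "has_integral_pos (f x) (Gamma (w / 2) / 2 * rpow (pi / q) (- w / 2) * (rpow x (of_nat h + 1 - w - 1) * K x))"
    if x: "x > 0" for x
  proof -
    have "has_integral_pos (\<lambda>\<alpha>. (of_real x ^ h * K x) * (rpow \<alpha> (w - 1) * of_real (exp (- (pi * \<alpha>\<^sup>2 / q) * x\<^sup>2))))
       ((of_real x ^ h * K x) * (rpow (pi / q) (- w / 2) * rpow x (- w) * Gamma (w / 2) / 2))"
      by (intro has_integral_pos_cmult inner x w)
    moreover have "rpow x (of_nat h + 1 - w - 1) = of_real x ^ h * rpow x (- w)"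
      using rpow_add[of x "of_nat h" "-w"] rpow_of_nat[OF x, of h] by simp
    ultimately show ?thesis unfolding f_def by (simp only: mult_ac times_divide_eq_right times_divide_eq_left)
  qed
  define u where "u = Re w"
  define \<kappa> where "\<kappa> = Re (rpow (pi / q) (- of_real u / 2) * Gamma (of_real u / 2) / 2)"
  \<comment> \<open>Taking norms replaces \<open>w\<close> by its real part, so the same Gamma
    integral evaluates the inner integral. The outer one then converges because
    \<open>Re w < h + 1\<close>.\<close>
  have nf: "(LINT \<alpha>:{0<..}|lborel. norm (f x \<alpha>)) = \<kappa> * norm (rpow x ((of_nat h + 1 - w) - 1) * K x)" if x: "x > 0" for x
  proof -
    define N where "N = x ^ h * norm (K x)"
    have "has_integral_pos (\<lambda>\<alpha>. of_real N * (rpow \<alpha> (of_real u - 1) * of_real (exp (- (pi * \<alpha>\<^sup>2 / q) * x\<^sup>2))))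
       (of_real N * (rpow (pi / q) (- of_real u / 2) * rpow x (- of_real u) * Gamma (of_real u / 2) / 2))"
      by (intro has_integral_pos_cmult inner x) (use w u_def in auto)
    also have "?this \<longleftrightarrow> has_integral_pos (\<lambda>\<alpha>. of_real (norm (f x \<alpha>)))
       (of_real N * (rpow (pi / q) (- of_real u / 2) * rpow x (- of_real u) * Gamma (of_real u / 2) / 2))"
    proof (rule has_integral_pos_cong)
      fix \<alpha> :: real assume a: "\<alpha> > 0"
      have "rpow \<alpha> (of_real u - 1) = of_real (norm (rpow \<alpha> (w - 1)))"
        using rpow_of_real[OF a, of "u - 1"] a by (simp add: norm_rpow_powr u_def)
      thus "of_real N * (rpow \<alpha> (of_real u - 1) * of_real (exp (- (pi * \<alpha>\<^sup>2 / q) * x\<^sup>2))) = complex_of_real (norm (f x \<alpha>))"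
        using x by (simp add: f_def N_def norm_mult norm_power)
    qed
    finally have "(LINT \<alpha>:{0<..}|lborel. complex_of_real (norm (f x \<alpha>))) = 
        of_real N * (rpow (pi / q) (- of_real u / 2) * rpow x (- of_real u) * Gamma (of_real u / 2) / 2)"
      by (simp add: has_integral_pos_def)
    moreover have "rpow x (- of_real u) = of_real (x powr (- u))" using rpow_of_real[OF x, of "-u"] by simp
    ultimately have "complex_of_real (LINT \<alpha>:{0<..}|lborel. norm (f x \<alpha>)) = 
        of_real (N * x powr (-u)) * (rpow (pi / q) (- of_real u / 2) * Gamma (of_real u / 2) / 2)"
      unfolding set_integral_complex_of_real by (simp add: mult_ac)
    hence "Re (complex_of_real (LINT \<alpha>:{0<..}|lborel. norm (f x \<alpha>))) = Re (of_real (N * x powr (-u)) * (rpow (pi / q) (- of_real u / 2) * Gamma (of_real u / 2) / 2))"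
      by (rule arg_cong)
    hence "(LINT \<alpha>:{0<..}|lborel. norm (f x \<alpha>)) = N * x powr (-u) * \<kappa>" by (simp add: \<kappa>_def)
    also have "N * x powr (-u) = norm (rpow x ((of_nat h + 1 - w) - 1) * K x)"
      using x by (simp add: N_def norm_mult norm_rpow_powr u_def powr_diff powr_minus divide_inverse powr_realpow)
    finally show ?thesis by simp
  qed
  have s: "Re (of_nat h + 1 - w) > 0" using w by simp
  have meas: "(\<lambda>(x, \<alpha>). f x \<alpha>) \<in> borel_measurable (borel \<Otimes>\<^sub>M borel)" unfolding f_def by measurable
  have "set_integrable lborel {0<..} (\<lambda>x. \<kappa> * norm (rpow x ((of_nat h + 1 - w) - 1) * K x))"
    by (intro set_integrable_mult_right set_integrable_norm set_integrable_power_K s)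
  hence intn: "set_integrable lborel {0<..} (\<lambda>x. LINT \<alpha>:{0<..}|lborel. norm (f x \<alpha>))"
    by (subst set_integrable_cong[OF refl refl nf]) auto
  have int: "set_integrable lborel {0<..} (f x)" if "x \<in> {0<..}" for x
    using fx[of x] that by (simp add: has_integral_pos_def)
  have eq: "(LINT x:{0<..}|lborel. f x \<alpha>) = rpow \<alpha> (w - 1) * theta_moment \<alpha>" for \<alpha>
    unfolding f_def theta_moment_def by (rule set_integral_mult_right)
  note F = set_Fubini[OF meas _ _ int intn, unfolded eq]
  have "(LINT x:{0<..}|lborel. LINT \<alpha>:{0<..}|lborel. f x \<alpha>) = 
     (LINT x:{0<..}|lborel. Gamma (w / 2) / 2 * rpow (pi / q) (- w / 2) * (rpow x (of_nat h + 1 - w - 1) * K x))"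
    by (intro set_lebesgue_integral_cong) (use fx in \<open>auto simp: has_integral_pos_def\<close>)
  also have "\<dots> = Gamma (w / 2) / 2 * rpow (pi / q) (- w / 2) * mellin_K (of_nat h + 1 - w)"
    unfolding mellin_K_def by (rule set_integral_mult_right)
  finally show ?thesis using F by (simp add: has_integral_pos_def)
qed

text \<open>The Mellin transform of \<open>theta_moment\<close> is computed at \<open>h + s\<close>
  and at \<open>h + 1 - s\<close>. Inverting the variable relates the two, and the power from
  \<open>theta_moment_inverse\<close> accounts for the shift of the exponent.\<close>

theorem mellin_K_functional_equation:
  assumes s: "0 < Re s" "Re s < 1"
  shows "Gamma ((of_nat h + 1 - s) / 2) * rpow (pi / q) (- (of_nat h + 1 - s) / 2) * mellin_K s
       = Gamma ((of_nat h + s) / 2) * rpow (pi / q) (- (of_nat h + s) / 2) * mellin_K (1 - s)"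
proof -
  define f where "f = (\<lambda>t. rpow t (of_nat h + s - 1) * theta_moment t)"
  define g' where "g' = (\<lambda>x::real. - (inverse x * inverse x))"
  have [measurable]: "f \<in> borel_measurable borel" unfolding f_def by measurable
  have h0: "Re (of_nat h + s) > 0" "Re (of_nat h + s) < real h + 1" using s by (auto simp: add_nonneg_pos)
  have "has_integral_pos f (Gamma ((of_nat h + s) / 2) / 2 * rpow (pi / q) (- (of_nat h + s) / 2) * mellin_K (1 - s))"
    unfolding f_def using theta_moment_mellin[OF h0] by (simp add: algebra_simps)
  hence "has_integral_pos (\<lambda>x. of_real \<bar>g' x\<bar> * f (inverse x)) (Gamma ((of_nat h + s) / 2) / 2 * rpow (pi / q) (- (of_nat h + s) / 2) * mellin_K (1 - s))"
  proof (subst has_integral_pos_substitution)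
    show "(\<lambda>x. of_real \<bar>g' x\<bar> * f (inverse x)) \<in> borel_measurable borel" unfolding g'_def by measurable
    show "(inverse has_real_derivative g' x) (at x)" if "x > 0" for x :: real
      using that by (auto intro!: derivative_eq_intros simp: g'_def)
    show "inverse ` {0::real<..} = {0<..}"
    proof (intro equalityI subsetI)
      fix y :: real assume "y \<in> {0<..}"
      thus "y \<in> inverse ` {0<..}" by (intro image_eqI[of _ _ "inverse y"]) auto
    qed auto
  qed (auto simp: inj_on_def)
  also have "?this \<longleftrightarrow> has_integral_pos (\<lambda>x. rpow x (of_nat h + 1 - s - 1) * theta_moment x)
     (Gamma ((of_nat h + s) / 2) / 2 * rpow (pi / q) (- (of_nat h + s) / 2) * mellin_K (1 - s))"
  proof (rule has_integral_pos_cong)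
    fix x :: real assume x: "x > 0"
    have "of_real \<bar>g' x\<bar> = rpow x (- 2)"
      using rpow_of_nat[OF x, of 2] x by (simp add: g'_def rpow_minus power2_eq_square)
    hence "of_real \<bar>g' x\<bar> * f (inverse x) = rpow x (- 2) * rpow x (- (of_nat h + s - 1)) * theta_moment (inverse x)"
      unfolding f_def rpow_inverse[OF x] by (simp only: mult.assoc)
    also have "rpow x (- 2) * rpow x (- (of_nat h + s - 1)) = rpow x (of_nat h + 1 - s - 1) * rpow x (- (2 * of_nat h + 1))"
      by (simp add: algebra_simps flip: rpow_add)
    finally show "of_real \<bar>g' x\<bar> * f (inverse x) = rpow x (of_nat h + 1 - s - 1) * theta_moment x"
      unfolding theta_moment_inverse[OF x] by (simp only: mult.assoc)
  qed
  finally have 1: "has_integral_pos (\<lambda>x. rpow x (of_nat h + 1 - s - 1) * theta_moment x)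
     (Gamma ((of_nat h + s) / 2) / 2 * rpow (pi / q) (- (of_nat h + s) / 2) * mellin_K (1 - s))" .
  have "Re (of_nat h + 1 - s) > 0" "Re (of_nat h + 1 - s) < real h + 1" using s by (auto simp: add_nonneg_pos)
  from theta_moment_mellin[OF this]
  have "has_integral_pos (\<lambda>x. rpow x (of_nat h + 1 - s - 1) * theta_moment x)
     (Gamma ((of_nat h + 1 - s) / 2) / 2 * rpow (pi / q) (- (of_nat h + 1 - s) / 2) * mellin_K s)" by simp
  with 1 show ?thesis by (simp add: has_integral_pos_def)
qed

lemma holomorphic_mellin_K: "mellin_K holomorphic_on {s. Re s > 0}"
  unfolding mellin_K_def[abs_def]
proof (rule holomorphic_on_set_integral)
  show "open {s. Re s > 0}" by (rule open_halfspace_Re_gt)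
  show "(\<lambda>s. rpow x (s - 1) * K x) holomorphic_on {s. Re s > 0}" for x
    unfolding rpow_def by (intro holomorphic_intros)
  fix s assume "s \<in> {s. Re s > 0}"
  hence s: "Re s > 0" by simp
  \<comment> \<open>On the disc the power of \<open>x\<close> lies below the sum of the powers with
    the extreme exponents \<open>a\<close> and \<open>b\<close>, the first deciding for
    \<open>x < 1\<close> and the second for \<open>x \<ge> 1\<close>.\<close>
  define a b where "a = Re s / 2" and "b = 3 * Re s / 2"
  define g where "g = (\<lambda>x. norm (rpow x (of_real a - 1) * K x) + norm (rpow x (of_real b - 1) * K x))"
  have ball: "a \<le> Re z \<and> Re z \<le> b" if "z \<in> cball s a" for z
  proof -
    have "\<bar>Re (s - z)\<bar> \<le> a" using abs_Re_le_cmod[of "s - z"] that by (simp add: dist_norm)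
    hence "2 * \<bar>Re s - Re z\<bar> \<le> Re s" by (simp add: a_def)
    thus ?thesis by (simp add: a_def b_def abs_if split: if_splits)
  qed
  have "set_integrable lborel {0<..} g"
    unfolding g_def
    by (intro set_integral_add(1) set_integrable_norm set_integrable_power_K) (use s in \<open>auto simp: a_def b_def\<close>)
  moreover have "norm (rpow x (z - 1) * K x) \<le> g x" if z: "z \<in> cball s a" and x: "x \<in> {0<..}" for z x
  proof -
    have "x powr (Re z - 1) \<le> x powr (a - 1) + x powr (b - 1)"
    proof (cases "x \<ge> 1")
      case True
      hence "x powr (Re z - 1) \<le> x powr (b - 1)" using ball[OF z] by (intro powr_mono) auto
      thus ?thesis using powr_ge_zero[of x "a - 1"] by linarith
    next
      case False
      hence "x powr (Re z - 1) \<le> x powr (a - 1)" using ball[OF z] x by (intro powr_mono') auto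
      thus ?thesis using powr_ge_zero[of x "b - 1"] by linarith
    qed
    hence "x powr (Re z - 1) * norm (K x) \<le> (x powr (a - 1) + x powr (b - 1)) * norm (K x)"
      by (intro mult_right_mono) auto
    thus ?thesis using x by (simp add: g_def norm_mult norm_rpow_powr distrib_right)
  qed
  moreover have "cball s a \<subseteq> {s. Re s > 0}" using ball s by (fastforce simp: a_def)
  moreover have "a > 0" using s by (simp add: a_def)
  ultimately show "\<exists>r>0. cball s r \<subseteq> {s. Re s > 0} \<and> (\<exists>g. set_integrable lborel {0<..} g \<and> (\<forall>z\<in>cball s r. \<forall>x\<in>{0<..}. norm (rpow x (z - 1) * K x) \<le> g x))"
    by blast
qed measurable

text \<open>The Gaussian factor is written by its inverse Mellin integral and the integrals are
  exchanged. Domination is by a product: the transform is integrable in \<open>\<tau>\<close>, and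
  \<open>K\<close> divided by \<open>sqrt x\<close> is integrable in \<open>x\<close>.\<close>

theorem gauss_hyp_parseval:
  assumes c: "c > 0"
  shows "integrable lborel (\<lambda>\<tau>. gauss_mellin c h w (Complex (1/2) \<tau>) * mellin_K (1 - Complex (1/2) \<tau>))"
    and "(LINT \<tau>|lborel. gauss_mellin c h w (Complex (1/2) \<tau>) * mellin_K (1 - Complex (1/2) \<tau>))
      = 2 * pi * (LINT x:{0<..}|lborel. of_real (exp (- c * x\<^sup>2)) * hyp h (w * of_real x) * K x)"
proof -
  define G where "G = (\<lambda>\<tau>. gauss_mellin c h w (Complex (1/2) \<tau>))"
  have Gi: "integrable lborel G" unfolding G_def by (rule gauss_mellin_inversion(1)[OF h c])
  have [measurable]: "G \<in> borel_measurable borel" using borel_measurable_integrable[OF Gi] by simp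
  define f where "f = (\<lambda>x \<tau>. G \<tau> * (rpow x (- Complex (1/2) \<tau>) * K x))"
  have Ci: "- Complex (1/2) \<tau> = - (1/2) - \<i> * of_real \<tau>" for \<tau> by (simp add: complex_eq_iff)
  have meas: "(\<lambda>(x, \<tau>). f x \<tau>) \<in> borel_measurable (borel \<Otimes>\<^sub>M borel)"
    unfolding f_def Ci rpow_def by measurable
  have s1: "set_integrable lborel {0<..} (\<lambda>x. norm (rpow x (1/2 - 1) * K x))"
    by (intro set_integrable_norm set_integrable_power_K) simp
  have s2: "set_integrable lborel UNIV (\<lambda>\<tau>. norm (G \<tau>))" using Gi by (simp add: set_integrable_def)
  have bound: "norm (f x \<tau>) \<le> norm (rpow x (1/2 - 1) * K x) * norm (G \<tau>)" if "x \<in> {0<..}" for x \<tau>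
    using that by (simp add: f_def norm_mult norm_rpow_powr)
  note F = set_Fubini_product_bound[OF meas _ _ s1 s2 bound]
  have e1: "(LINT x:{0<..}|lborel. f x \<tau>) = G \<tau> * mellin_K (1 - Complex (1/2) \<tau>)" for \<tau>
    by (simp add: f_def mellin_K_def)
  show "integrable lborel (\<lambda>\<tau>. gauss_mellin c h w (Complex (1/2) \<tau>) * mellin_K (1 - Complex (1/2) \<tau>))"
    using F(1) by (simp add: e1 set_integrable_def G_def)
  have "(LINT \<tau>|lborel. G \<tau> * mellin_K (1 - Complex (1/2) \<tau>)) = (LINT x:{0<..}|lborel. LINT \<tau>:UNIV|lborel. f x \<tau>)"
    using F(2)[unfolded e1] by (simp add: set_lebesgue_integral_def[of lborel UNIV])
  also have "\<dots> = (LINT x:{0<..}|lborel. (2 * pi) * (of_real (exp (- c * x\<^sup>2)) * hyp h (w * of_real x) * K x))"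
  proof (intro set_lebesgue_integral_cong allI impI)
    fix x :: real assume x: "x \<in> {0<..}"
    have "(LINT \<tau>:UNIV|lborel. f x \<tau>) = (LINT \<tau>|lborel. (G \<tau> * rpow x (- Complex (1/2) \<tau>)) * K x)"
      by (simp add: f_def set_lebesgue_integral_def mult.assoc)
    also have "\<dots> = (LINT \<tau>|lborel. G \<tau> * rpow x (- Complex (1/2) \<tau>)) * K x" by (rule integral_mult_left_zero)
    also have "(LINT \<tau>|lborel. G \<tau> * rpow x (- Complex (1/2) \<tau>)) = 2 * pi * (of_real (exp (- c * x\<^sup>2)) * hyp h (w * of_real x))"
      using gauss_mellin_inversion(2)[OF h c, of x w] x by (simp add: G_def)
    finally show "(LINT \<tau>:UNIV|lborel. f x \<tau>) = (2 * pi) * (of_real (exp (- c * x\<^sup>2)) * hyp h (w * of_real x) * K x)"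
      by (simp only: mult.assoc)
  qed auto
  finally show "(LINT \<tau>|lborel. gauss_mellin c h w (Complex (1/2) \<tau>) * mellin_K (1 - Complex (1/2) \<tau>))
      = 2 * pi * (LINT x:{0<..}|lborel. of_real (exp (- c * x\<^sup>2)) * hyp h (w * of_real x) * K x)"
    by (simp only: G_def set_integral_mult_right)
qed

end

section \<open>The kernel of a character\<close>

lemma Digamma_reflection:
  fixes w :: complex
  assumes "w \<notin> \<int>"
  shows "Digamma (1 - w) - Digamma w = of_real pi * cos (of_real pi * w) / sin (of_real pi * w)"
proof -
  have w: "w \<notin> \<int>\<^sub>\<le>\<^sub>0" "1 - w \<notin> \<int>\<^sub>\<le>\<^sub>0"
    using assms nonpos_Ints_Int[of w] nonpos_Ints_Int[of "1 - w"] Ints_diff[of 1 "1 - w"] by auto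
  have sw: "sin (of_real pi * w) \<noteq> 0"
  proof
    assume "sin (of_real pi * w) = 0"
    then obtain n :: int where "of_real pi * w = of_real (of_int n * pi)"
      by (auto simp: sin_eq_0)
    hence "w = of_int n" by (simp add: mult.commute)
    thus False using assms by simp
  qed
  have G: "Gamma w * Gamma (1 - w) = of_real pi / sin (of_real pi * w)"
    by (rule Gamma_reflection_complex)
  have "((\<lambda>z. Gamma z * Gamma (1 - z)) has_field_derivative
      (Gamma w * Gamma (1 - w)) * (Digamma w - Digamma (1 - w))) (at w)"
    using w by (auto intro!: derivative_eq_intros simp: algebra_simps)
  moreover have "((\<lambda>z. of_real pi / sin (of_real pi * z)) has_field_derivative
      - (of_real pi * (cos (of_real pi * w) * of_real pi)) / (sin (of_real pi * w))\<^sup>2) (at w)"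
    using sw by (auto intro!: derivative_eq_intros simp: power2_eq_square)
  ultimately have "(of_real pi / sin (of_real pi * w)) * (Digamma w - Digamma (1 - w))
      = - (of_real pi * (cos (of_real pi * w) * of_real pi)) / (sin (of_real pi * w))\<^sup>2"
    unfolding Gamma_reflection_complex using DERIV_unique by blast
  hence "of_real pi * sin (of_real pi * w) * (Digamma (1 - w) * sin (of_real pi * w)
      - (of_real pi * cos (of_real pi * w) + Digamma w * sin (of_real pi * w))) = 0"
    using sw by (simp add: field_simps power2_eq_square)
  hence "Digamma (1 - w) * sin (of_real pi * w) = of_real pi * cos (of_real pi * w) + Digamma w * sin (of_real pi * w)"
    using sw by simp
  thus ?thesis using sw by (simp add: field_simps)
qed

text \<open>The difference of the limit formulas for Digamma at \<open>1 - w\<close> and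
  \<open>w\<close>, in which the logarithms cancel. Both have \<open>M\<close> terms, hence the
  lopsided range from \<open>- M\<close> to \<open>M - 1\<close>.\<close>

lemma cot_partial_fractions:
  fixes w :: complex
  assumes "w \<notin> \<int>"
  shows "(\<lambda>M. \<Sum>k\<in>{- int M..<int M}. 1 / (w + of_int k)) \<longlonglongrightarrow> of_real pi * cos (of_real pi * w) / sin (of_real pi * w)"
proof -
  have w: "w \<noteq> 0" "1 - w \<noteq> 0" using assms by auto
  have "(\<lambda>M. (of_real (ln (real M)) - (\<Sum>n<M. inverse (1 - w + of_nat n)))
      - (of_real (ln (real M)) - (\<Sum>n<M. inverse (w + of_nat n)))) \<longlonglongrightarrow> Digamma (1 - w) - Digamma w"
    by (intro tendsto_diff Digamma_LIMSEQ w)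
  also have "(\<lambda>M. (of_real (ln (real M)) - (\<Sum>n<M. inverse (1 - w + of_nat n)))
      - (of_real (ln (real M)) - (\<Sum>n<M. inverse (w + of_nat n)))) = (\<lambda>M. \<Sum>k\<in>{- int M..<int M}. 1 / (w + of_int k))"
  proof
    fix M
    have "(\<Sum>k\<in>{- int M..<int M}. 1 / (w + of_int k)) = (\<Sum>k\<in>{0..<int M}. 1 / (w + of_int k)) + (\<Sum>k\<in>{- int M..<0}. 1 / (w + of_int k))"
    proof -
      have "{- int M..<int M} = {0..<int M} \<union> {- int M..<0}" by auto
      thus ?thesis by (simp only:) (rule sum.union_disjoint; auto)
    qed
    also have "(\<Sum>k\<in>{0..<int M}. 1 / (w + of_int k)) = (\<Sum>n<M. inverse (w + of_nat n))"
      by (rule sum.reindex_bij_witness[of _ int nat]) (auto simp: divide_inverse)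
    also have "(\<Sum>k\<in>{- int M..<0}. 1 / (w + of_int k)) = (\<Sum>n<M. - inverse (1 - w + of_nat n))"
    proof (rule sum.reindex_bij_witness[of _ "\<lambda>n. - int n - 1" "\<lambda>k. nat (- k - 1)"])
      fix k assume "k \<in> {- int M..<0}"
      hence "1 - w + of_nat (nat (- k - 1)) = - (w + of_int k)" by (simp add: of_nat_nat)
      thus "- inverse (1 - w + of_nat (nat (- k - 1))) = 1 / (w + of_int k)"
        by (simp only: inverse_minus_eq minus_minus divide_inverse mult_1)
    qed auto
    finally show "(of_real (ln (real M)) - (\<Sum>n<M. inverse (1 - w + of_nat n)))
      - (of_real (ln (real M)) - (\<Sum>n<M. inverse (w + of_nat n))) = (\<Sum>k\<in>{- int M..<int M}. 1 / (w + of_int k))"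
      by (simp add: sum_negf)
  qed
  finally show ?thesis by (simp add: Digamma_reflection[OF assms])
qed

text \<open>The exponent is complex, beyond the real rescaling of
  \<open>has_integral_pos_Gamma_scaled\<close>, so the value comes from the antiderivative; the real
  case provides integrability.\<close>

lemma has_integral_pos_exp:
  fixes a :: complex
  assumes "Re a > 0"
  shows "has_integral_pos (\<lambda>x. exp (- a * of_real x)) (1 / a)"
proof -
  have a: "a \<noteq> 0" using assms by auto
  have lim: "((\<lambda>x. - exp (- a * of_real x) / a) \<longlongrightarrow> 0) at_top"
  proof -
    have "((\<lambda>x. exp (- r * x) / c) \<longlongrightarrow> 0) at_top" if "r > 0" "c > 0" for r c :: real
      using that by real_asymp
    from this[of "Re a" "norm a"] have "((\<lambda>x. exp (- Re a * x) / norm a) \<longlongrightarrow> 0) at_top"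
      using assms a by simp
    hence "((\<lambda>x. norm (- exp (- a * of_real x) / a)) \<longlongrightarrow> 0) at_top"
      by (simp add: norm_divide norm_exp_eq_Re)
    thus ?thesis by (rule tendsto_norm_zero_cancel)
  qed
  have "has_integral_pos (\<lambda>x. rpow x (1 - 1) * of_real (exp (- Re a * x ^ 1))) (rpow (Re a) (- 1 / of_nat 1) * Gamma (1 / of_nat 1) / of_nat 1)"
    by (rule has_integral_pos_Gamma_scaled) (use assms in auto)
  hence "set_integrable lborel {0<..} (\<lambda>x. complex_of_real (exp (- Re a * x)))" by (simp add: has_integral_pos_def)
  hence int: "set_integrable lborel {0<..} (\<lambda>x. exp (- a * of_real x))"
    by (rule set_integrable_bound) (auto simp: set_borel_measurable_def norm_exp_eq_Re)
  have ein: "einterval 0 \<infinity> = {0::real<..}" by (auto simp: einterval_def zero_ereal_def)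
  have "(LBINT x=0..\<infinity>. exp (- a * of_real x)) = 0 - (- 1 / a)"
  proof (rule interval_integral_FTC_integrable)
    show "((\<lambda>x. - exp (- a * of_real x) / a) has_vector_derivative exp (- a * of_real x)) (at x)" for x :: real
      using a by (auto intro!: derivative_eq_intros has_vector_derivative_real_field)
    show "isCont (\<lambda>x. exp (- a * of_real x)) x" for x :: real by (intro continuous_intros)
    show "set_integrable lborel (einterval 0 \<infinity>) (\<lambda>x. exp (- a * of_real x))" using int by (simp add: ein)
    show "(((\<lambda>x. - exp (- a * of_real x) / a) \<circ> real_of_ereal) \<longlongrightarrow> - 1 / a) (at_right 0)"
    proof -
      have "((\<lambda>x::real. - exp (- a * of_real x) / a) \<longlongrightarrow> - exp (- a * of_real 0) / a) (at_right 0)"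
        using a by (intro tendsto_intros)
      thus ?thesis by (simp add: zero_ereal_def ereal_tendsto_simps)
    qed
    show "(((\<lambda>x. - exp (- a * of_real x) / a) \<circ> real_of_ereal) \<longlongrightarrow> 0) (at_left \<infinity>)"
      using lim by (simp add: ereal_tendsto_simps)
  qed auto
  hence "(LINT x:{0<..}|lborel. exp (- a * of_real x)) = 1 / a"
    by (simp add: interval_lebesgue_integral_def ein)
  thus ?thesis using int by (simp add: has_integral_pos_def)
qed

text \<open>The index is opposite to the parity of \<open>chi\<close>: \<open>h = 1\<close> stands
  for even and \<open>h = 0\<close> for odd, so the Gauss sum carries
  \<open>\<i> ^ (1 - h)\<close>.\<close>

locale gauss_kernel =
  fixes q :: nat and chi :: "int \<Rightarrow> complex" and h :: nat
  assumes q1: "q > 1" and h1: "h \<le> 1"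
    and periodic: "\<And>n k. chi (n + int q * k) = chi n"
    and norm_chi: "\<And>n. norm (chi n) \<le> 1"
    and chi_0: "chi 0 = 0"
    and parity: "\<And>n. chi (- n) = - ((-1) ^ h) * chi n"
    and gauss: "\<And>k. (\<Sum>r\<in>{0..<int q}. chi r * cis (2 * pi * of_int (k * r) / real q)) = chi k * of_real (sqrt (real q)) * \<i> ^ (1 - h)"
begin

abbreviation "K \<equiv> char_kernel q chi"

text \<open>In this variable the kernel is the power series with coefficients \<open>chi n\<close>,
  summed by periodicity to a polynomial over \<open>1 - u ^ q\<close>.\<close>

definition decay :: "real \<Rightarrow> real" where "decay x = exp (- (2 * pi / real q) * x)"

lemma decay_pos: "decay x > 0" by (simp add: decay_def)

lemma decay_less_1: "x > 0 \<Longrightarrow> decay x < 1"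
  using q1 by (simp add: decay_def)

lemma decay_power: "decay x ^ n = exp (- (2 * pi * real n / real q) * x)"
  by (simp add: decay_def field_simps flip: exp_of_nat_mult)

lemma decay_power_q: "decay x ^ q = exp (- 2 * pi * x)"
  using q1 by (simp add: decay_power)

definition num :: "real \<Rightarrow> complex" where "num x = (\<Sum>r<q. chi (int r) * of_real (decay x ^ r))"

lemma K_eq: "K x = num x / of_real (1 - decay x ^ q)"
proof -
  have "num x = (\<Sum>r = 1..q - 1. chi (int r) * of_real (decay x ^ r))"
    unfolding num_def using q1 chi_0 by (intro sum.mono_neutral_right) (auto simp: not_less_eq_eq Suc_le_eq)
  thus ?thesis unfolding char_kernel_def decay_power_q
    by (simp add: decay_power divide_inverse mult_ac)
qed

lemma sum_chi: "(\<Sum>r<q. chi (int r)) = 0"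
proof -
  have "(\<Sum>r<q. chi (int r)) = (\<Sum>r\<in>{0..<int q}. chi r)"
    by (rule sum.reindex_bij_witness[of _ nat int]) auto
  thus ?thesis using gauss[of 0] chi_0 by simp
qed

lemma K_measurable [measurable]: "K \<in> borel_measurable borel"
  unfolding char_kernel_def[abs_def] by measurable

text \<open>The numerator vanishes at \<open>u = 1\<close> because \<open>chi\<close> sums to 0 over
  a period, and this cancels the pole of the kernel at \<open>x = 0\<close>. Each of the
  \<open>q\<close> summands is at most \<open>q * u * (1 - u)\<close>, which explains the
  constant.\<close>

lemma K_bound:
  assumes x: "x > 0"
  shows "norm (K x) \<le> (real q)\<^sup>2 * exp (- (2 * pi / real q) * x)"
proof -
  define u where "u = decay x"
  have u: "0 < u" "u < 1" using decay_pos decay_less_1[OF x] by (auto simp: u_def)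
  have pw: "1 - u ^ n \<le> real n * (1 - u)" for n
    using Bernoulli_inequality[of "u - 1" n] u by (simp add: algebra_simps)
  have "num x = (\<Sum>r<q. chi (int r) * of_real (u ^ r - u))"
    using sum_chi by (simp add: num_def u_def right_diff_distrib sum_subtractf flip: sum_distrib_right)
  also have "norm \<dots> \<le> (\<Sum>r<q. real q * (u * (1 - u)))"
  proof (rule sum_norm_le)
    fix r assume r: "r \<in> {..<q}"
    show "norm (chi (int r) * of_real (u ^ r - u)) \<le> real q * (u * (1 - u))"
    proof (cases r)
      case 0
      thus ?thesis using chi_0 u by simp
    next
      case (Suc n)
      have "u ^ n \<le> 1" using u by (intro power_le_one) auto
      hence "u * (1 - u ^ n) \<ge> 0" using u by simp
      moreover have "u ^ r - u = - (u * (1 - u ^ n))" by (simp add: Suc algebra_simps)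
      ultimately have "\<bar>u ^ r - u\<bar> = u * (1 - u ^ n)" by (simp only: abs_minus_cancel abs_of_nonneg)
      also have "\<dots> \<le> u * (real q * (1 - u))"
      proof (rule mult_left_mono)
        have "real n * (1 - u) \<le> real q * (1 - u)" using r Suc u by (intro mult_right_mono) auto
        thus "1 - u ^ n \<le> real q * (1 - u)" using pw[of n] by linarith
      qed (use u in simp)
      finally have "\<bar>u ^ r - u\<bar> \<le> real q * (u * (1 - u))" by (simp add: mult_ac)
      moreover have "norm (chi (int r)) * \<bar>u ^ r - u\<bar> \<le> 1 * \<bar>u ^ r - u\<bar>"
        by (intro mult_right_mono norm_chi) auto
      ultimately show ?thesis by (simp add: norm_mult flip: of_real_diff)
    qed
  qed
  finally have N: "norm (num x) \<le> (real q)\<^sup>2 * u * (1 - u)" by (simp add: power2_eq_square mult_ac)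
  have uq: "u ^ q \<le> u" using u q1 power_decreasing[of 1 q u] by simp
  have "norm (K x) = norm (num x) / (1 - u ^ q)"
  proof -
    have "1 - u ^ q \<ge> 0" using u uq by simp
    thus ?thesis by (simp only: K_eq norm_divide u_def[symmetric] norm_of_real abs_of_nonneg)
  qed
  also have "\<dots> \<le> ((real q)\<^sup>2 * u * (1 - u)) / (1 - u)"
    using u uq N by (intro frac_le) auto
  also have "\<dots> = (real q)\<^sup>2 * u" using u by simp
  finally show ?thesis by (simp add: u_def decay_def)
qed

text \<open>Over whole periods the partial sum is \<open>K x\<close> times a factor between 0 and 1.
  Hence the partial sums are dominated by \<open>K\<close> itself, and all truncations below are at
  multiples of \<open>q\<close>.\<close>

lemma sum_chi_decay: 
  assumes x: "x > 0"
  shows "(\<Sum>n<q * M. chi (int n) * of_real (decay x ^ n)) = K x * of_real (1 - decay x ^ (q * M))"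
proof -
  have dq: "1 - complex_of_real (decay x) ^ q \<noteq> 0"
  proof -
    have "decay x ^ q < 1" using power_less_one_iff[of "decay x" q] decay_pos[of x] decay_less_1[OF x] q1 by simp
    hence "complex_of_real (1 - decay x ^ q) \<noteq> 0" unfolding of_real_eq_0_iff by simp
    thus ?thesis by simp
  qed
  have "(\<Sum>n<q * M. chi (int n) * of_real (decay x ^ n)) * (1 - of_real (decay x) ^ q) = num x * (1 - of_real (decay x) ^ (q * M))"
  proof (induction M)
    case (Suc M)
    have "(\<Sum>n<q * Suc M. chi (int n) * of_real (decay x ^ n)) = (\<Sum>n<q * M. chi (int n) * of_real (decay x ^ n)) + of_real (decay x) ^ (q * M) * num x"
    proof -
      have "(\<Sum>n<q * M + m. chi (int n) * of_real (decay x ^ n)) = (\<Sum>n<q * M. chi (int n) * of_real (decay x ^ n))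
          + (\<Sum>r<m. chi (int (q * M + r)) * of_real (decay x ^ (q * M + r)))" for m
        by (induction m) (simp_all add: add.assoc)
      from this[of q] show ?thesis
        using periodic[of "int r" "int M" for r]
        by (simp add: num_def sum_distrib_left power_add mult_ac add.commute)
    qed
    hence "(\<Sum>n<q * Suc M. chi (int n) * of_real (decay x ^ n)) * (1 - of_real (decay x) ^ q)
       = num x * (1 - of_real (decay x) ^ (q * M)) + of_real (decay x) ^ (q * M) * num x * (1 - of_real (decay x) ^ q)"
      using Suc by (simp only: distrib_right)
    thus ?case by (simp add: algebra_simps power_add)
  qed simp
  thus ?thesis using dq by (simp add: K_eq field_simps)
qed

lemma integral_K_limit:
  assumes [measurable]: "g \<in> borel_measurable borel" and int: "set_integrable lborel {0<..} (\<lambda>x. g x * K x)"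
  shows "(\<lambda>M. LINT x:{0<..}|lborel. g x * (\<Sum>n<q * M. chi (int n) * of_real (decay x ^ n))) \<longlonglongrightarrow> (LINT x:{0<..}|lborel. g x * K x)"
  unfolding set_lebesgue_integral_def
proof (rule integral_dominated_convergence)
  show "integrable lborel (\<lambda>x. norm (indicator {0<..} x *\<^sub>R (g x * K x)))"
    using int by (intro integrable_norm) (simp add: set_integrable_def)
  have [measurable]: "decay \<in> borel_measurable borel" unfolding decay_def[abs_def] by measurable
  show "(\<lambda>x. indicator {0<..} x *\<^sub>R (g x * (\<Sum>n<q * M. chi (int n) * of_real (decay x ^ n)))) \<in> borel_measurable lborel" for M
    by measurable
  show "(\<lambda>x. indicat_real {0<..} x *\<^sub>R (g x * K x)) \<in> borel_measurable lborel" by measurable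
  show "AE x in lborel. (\<lambda>M. indicat_real {0<..} x *\<^sub>R (g x * (\<Sum>n<q * M. chi (int n) * of_real (decay x ^ n)))) \<longlonglongrightarrow> indicat_real {0<..} x *\<^sub>R (g x * K x)"
  proof (rule AE_I2)
    fix x :: real
    show "(\<lambda>M. indicat_real {0<..} x *\<^sub>R (g x * (\<Sum>n<q * M. chi (int n) * of_real (decay x ^ n)))) \<longlonglongrightarrow> indicat_real {0<..} x *\<^sub>R (g x * K x)"
    proof (cases "x > 0")
      case True
      have "decay x ^ q < 1" using power_less_one_iff[of "decay x" q] decay_pos[of x] decay_less_1[OF True] q1 by simp
      moreover have "norm (decay x ^ q) = decay x ^ q" using decay_pos[of x] by simp
      ultimately have "norm (decay x ^ q) < 1" by (simp only:)
      hence "(\<lambda>M. (decay x ^ q) ^ M) \<longlonglongrightarrow> 0" by (rule LIMSEQ_power_zero)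
      moreover have "(\<lambda>M. g x * (K x * of_real (1 - P M))) \<longlonglongrightarrow> g x * (K x * of_real (1 - 0))"
        if "P \<longlonglongrightarrow> 0" for P :: "nat \<Rightarrow> real"
        using that by (intro tendsto_intros)
      ultimately have "(\<lambda>M. g x * (K x * of_real (1 - (decay x ^ q) ^ M))) \<longlonglongrightarrow> g x * (K x * of_real (1 - 0))"
        by blast
      thus ?thesis unfolding sum_chi_decay[OF True] power_mult using True by simp
    qed simp
  qed
  show "AE x in lborel. norm (indicat_real {0<..} x *\<^sub>R (g x * (\<Sum>n<q * M. chi (int n) * of_real (decay x ^ n)))) \<le> norm (indicat_real {0<..} x *\<^sub>R (g x * K x))" for M
  proof (rule AE_I2)
    fix x :: real
    show "norm (indicat_real {0<..} x *\<^sub>R (g x * (\<Sum>n<q * M. chi (int n) * of_real (decay x ^ n)))) \<le> norm (indicat_real {0<..} x *\<^sub>R (g x * K x))"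
    proof (cases "x > 0")
      case True
      have "0 \<le> decay x ^ (q * M)" "decay x ^ (q * M) \<le> 1"
        using decay_pos[of x] decay_less_1[OF True] by (auto intro: power_le_one)
      hence "norm (complex_of_real (1 - decay x ^ (q * M))) \<le> 1" unfolding norm_of_real by simp
      hence "norm (g x * K x) * norm (complex_of_real (1 - decay x ^ (q * M))) \<le> norm (g x * K x)"
        by (intro mult_left_le) auto
      thus ?thesis using True by (simp only: sum_chi_decay) (simp add: norm_mult mult.assoc)
    qed simp
  qed
qed

lemma set_integrable_K_bounded:
  assumes [measurable]: "g \<in> borel_measurable borel" and "\<And>x. norm (g x) \<le> 1"
  shows "set_integrable lborel {0<..} (\<lambda>x. g x * K x)"
proof (rule set_integrable_bound)
  have "has_integral_pos (\<lambda>x. exp (- complex_of_real (2 * pi / real q) * of_real x)) (1 / complex_of_real (2 * pi / real q))"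
    by (rule has_integral_pos_exp) (use q1 in simp)
  thus "set_integrable lborel {0<..} (\<lambda>x. of_real ((real q)\<^sup>2) * exp (- complex_of_real (2 * pi / real q) * of_real x))"
    by (simp add: has_integral_pos_def)
  show "set_borel_measurable lborel {0<..} (\<lambda>x. g x * K x)" unfolding set_borel_measurable_def by measurable
  show "AE x in lborel. x \<in> {0<..} \<longrightarrow> norm (g x * K x) \<le> norm (of_real ((real q)\<^sup>2) * exp (- complex_of_real (2 * pi / real q) * of_real x))"
  proof (intro AE_I2 impI)
    fix x :: real assume x: "x \<in> {0<..}"
    have "norm (g x * K x) \<le> 1 * norm (K x)" unfolding norm_mult by (intro mult_right_mono assms) auto
    also have "\<dots> \<le> (real q)\<^sup>2 * exp (- (2 * pi / real q) * x)" using K_bound[of x] x by simp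
    also have "\<dots> = norm (of_real ((real q)\<^sup>2) * exp (- complex_of_real (2 * pi / real q) * of_real x))"
      by (simp add: norm_mult norm_exp_eq_Re norm_power)
    finally show "norm (g x * K x) \<le> norm (of_real ((real q)\<^sup>2) * exp (- complex_of_real (2 * pi / real q) * of_real x))" .
  qed
qed

lemma integral_cis_K:
  "(\<lambda>M. \<Sum>n<q * M. chi (int n) * (of_nat q / (2 * pi) / (of_nat n - \<i> * of_real y)))
     \<longlonglongrightarrow> (LINT x:{0<..}|lborel. cis (2 * pi * x * y / real q) * K x)"
proof -
  have cism [measurable]: "cis \<in> borel_measurable borel"
    by (intro borel_measurable_continuous_onI continuous_intros)
  have "(\<lambda>M. LINT x:{0<..}|lborel. cis (2 * pi * x * y / real q) * (\<Sum>n<q * M. chi (int n) * of_real (decay x ^ n))) \<longlonglongrightarrow> (LINT x:{0<..}|lborel. cis (2 * pi * x * y / real q) * K x)"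
    by (rule integral_K_limit) (auto intro!: set_integrable_K_bounded)
  moreover have "(LINT x:{0<..}|lborel. cis (2 * pi * x * y / real q) * (\<Sum>n<q * M. chi (int n) * of_real (decay x ^ n)))
     = (\<Sum>n<q * M. chi (int n) * (of_nat q / (2 * pi) / (of_nat n - \<i> * of_real y)))" for M
  proof -
    have H: "has_integral_pos (\<lambda>x. chi (int n) * (cis (2 * pi * x * y / real q) * of_real (decay x ^ n)))
       (chi (int n) * (of_nat q / (2 * pi) / (of_nat n - \<i> * of_real y)))" for n
    \<comment> \<open>For \<open>n = 0\<close> the exponential does not decay, but its coefficient
      \<open>chi 0\<close> is 0.\<close>
    proof (cases "n = 0")
      case False
      define a where "a = complex_of_real (2 * pi / real q) * (of_nat n - \<i> * of_real y)"
      have "Re a > 0" using False q1 by (simp add: a_def)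
      hence "has_integral_pos (\<lambda>x. exp (- a * of_real x)) (1 / a)" by (rule has_integral_pos_exp)
      moreover have "exp (- a * of_real x) = cis (2 * pi * x * y / real q) * of_real (decay x ^ n)" for x
      proof -
        have "- a * of_real x = \<i> * of_real (2 * pi * x * y / real q) + of_real (- (2 * pi * real n / real q) * x)"
          using q1 by (simp add: a_def complex_eq_iff field_simps)
        thus ?thesis by (simp only: cis_conv_exp decay_power exp_add exp_of_real)
      qed
      moreover have "1 / a = of_nat q / (2 * pi) / (of_nat n - \<i> * of_real y)"
        by (simp add: a_def)
      ultimately show ?thesis by (intro has_integral_pos_cmult) simp
    qed (simp add: chi_0 has_integral_pos_def set_integrable_def)
    have "has_integral_pos (\<lambda>x. \<Sum>n<N. chi (int n) * (cis (2 * pi * x * y / real q) * of_real (decay x ^ n)))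
       (\<Sum>n<N. chi (int n) * (of_nat q / (2 * pi) / (of_nat n - \<i> * of_real y)))" for N
    proof (induction N)
      case 0
      show ?case by (simp add: has_integral_pos_def set_integrable_def)
    next
      case (Suc N)
      show ?case unfolding sum.lessThan_Suc by (rule has_integral_pos_add[OF Suc H])
    qed
    from this[of "q * M"] show ?thesis by (simp add: has_integral_pos_def sum_distrib_left mult_ac)
  qed
  ultimately show ?thesis by simp
qed

text \<open>The cotangent is \<open>- \<i> - 2 \<i> e / (1 - e)\<close> with \<open>e\<close> the
  exponential of twice the argument. Since \<open>e ^ q = u ^ q\<close> for every \<open>r\<close>,
  the fraction is a finite geometric sum over one common denominator. Summing over \<open>r\<close>,
  the constant part drops and each power becomes a Gauss sum, which returns the coefficients of the
  kernel.\<close>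

lemma sum_chi_cot:
  assumes y: "y > 0"
  shows "(\<Sum>r<q. chi (int r) * (of_real pi * cos (of_real pi * ((of_nat r + \<i> * of_real y) / of_nat q)) / sin (of_real pi * ((of_nat r + \<i> * of_real y) / of_nat q))))
    = - 2 * \<i> * of_real pi * of_real (sqrt (real q)) * \<i> ^ (1 - h) * K y"
proof -
  define u where "u = decay y"
  define e where "e = (\<lambda>r. cis (2 * pi * real r / real q) * of_real u)"
  have u: "0 < u" "u < 1" using decay_pos decay_less_1[OF y] by (auto simp: u_def)
  have e1: "e r \<noteq> 1" for r
  proof
    assume "e r = 1"
    hence "norm (e r) = 1" by simp
    thus False using u by (simp add: e_def norm_mult)
  qed
  have uq: "u ^ q < 1" using power_less_one_iff[of u q] u q1 by simp
  have eq: "e r ^ q = of_real (u ^ q)" for r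
  proof -
    have "cis (2 * pi * real r / real q) ^ q = cis (real q * (2 * pi * real r / real q))" by (rule Complex.DeMoivre)
    also have "real q * (2 * pi * real r / real q) = 2 * pi * real r" using q1 by simp
    also have "cis (2 * pi * real r) = 1" using cis_multiple_2pi[of "real r"] by simp
    finally show ?thesis by (simp add: e_def power_mult_distrib)
  qed
  have cot: "of_real pi * cos (of_real pi * ((of_nat r + \<i> * of_real y) / of_nat q)) / sin (of_real pi * ((of_nat r + \<i> * of_real y) / of_nat q))
    = - \<i> * of_real pi - 2 * \<i> * of_real pi * (\<Sum>k\<in>{1..q}. e r ^ k) / of_real (1 - u ^ q)" for r
  proof -
    define w where "w = complex_of_real pi * ((of_nat r + \<i> * of_real y) / of_nat q)"
    have ew: "exp (\<i> * w) * exp (\<i> * w) = e r"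
    proof -
      have "\<i> * w + \<i> * w = \<i> * of_real (2 * pi * real r / real q) + of_real (- (2 * pi / real q) * y)"
        using q1 by (simp add: w_def complex_eq_iff field_simps)
      hence "exp (\<i> * w + \<i> * w) = e r"
        by (simp only: e_def u_def decay_def cis_conv_exp exp_of_real exp_add)
      thus ?thesis by (simp only: exp_add)
    qed
    have ne: "exp (\<i> * w) \<noteq> 0" by simp
    have em: "exp (- (\<i> * w)) = exp (\<i> * w) / e r"
      using ew[symmetric] by (simp add: exp_minus field_simps)
    have er: "e r \<noteq> 0" using u by (simp add: e_def)
    have "cos w / sin w = - \<i> * (1 + e r) / (1 - e r)"
    proof -
      have c: "cos w = exp (\<i> * w) * (1 + e r) / (2 * e r)" unfolding cos_exp_eq em using er by (simp add: field_simps)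
      have s: "sin w = exp (\<i> * w) * (e r - 1) / (2 * \<i> * e r)" unfolding sin_exp_eq em using er by (simp add: field_simps)
      show ?thesis unfolding c s using er e1[of r] by (simp add: field_simps)
    qed
    also have "\<dots> = - \<i> - 2 * \<i> * (e r / (1 - e r))"
    proof -
      define D where "D = e r / (1 - e r)"
      have "(1 + e r) / (1 - e r) = 1 + 2 * D" using e1[of r] by (simp add: D_def field_simps)
      moreover have "- \<i> * (1 + e r) / (1 - e r) = - \<i> * ((1 + e r) / (1 - e r))" by (simp only: times_divide_eq_right)
      moreover have "- \<i> * (1 + 2 * D) = - \<i> - 2 * \<i> * D" by (simp add: algebra_simps)
      ultimately show ?thesis by (simp only: D_def)
    qed
    also have "e r / (1 - e r) = (\<Sum>k\<in>{1..q}. e r ^ k) / of_real (1 - u ^ q)"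
    proof -
      have "(\<Sum>k\<in>{1..q}. e r ^ k) = e r * (\<Sum>k<q. e r ^ k)"
        by (simp add: sum_distrib_left sum.atLeast1_atMost_eq)
      also have "(\<Sum>k<q. e r ^ k) = (1 - of_real (u ^ q)) / (1 - e r)"
        using e1[of r] by (simp add: sum_gp_strict eq)
      moreover have "complex_of_real (1 - u ^ q) \<noteq> 0" using uq unfolding of_real_eq_0_iff by simp
      ultimately show ?thesis by simp
    qed
    finally have X: "cos w / sin w = - \<i> - 2 * \<i> * ((\<Sum>k\<in>{1..q}. e r ^ k) / of_real (1 - u ^ q))" .
    define Q where "Q = (\<Sum>k\<in>{1..q}. e r ^ k) / of_real (1 - u ^ q)"
    have "of_real pi * cos w / sin w = of_real pi * (cos w / sin w)" by simp
    also have "\<dots> = of_real pi * (- \<i> - 2 * \<i> * Q)" by (simp only: X Q_def)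
    also have "\<dots> = - \<i> * of_real pi - 2 * \<i> * of_real pi * Q" by (simp add: algebra_simps)
    finally show ?thesis unfolding w_def Q_def by (simp only: times_divide_eq_right)
  qed
  have "(\<Sum>r<q. chi (int r) * (\<Sum>k\<in>{1..q}. e r ^ k)) = of_real (sqrt (real q)) * \<i> ^ (1 - h) * num y"
  proof -
    have "(\<Sum>r<q. chi (int r) * (\<Sum>k\<in>{1..q}. e r ^ k)) = (\<Sum>k\<in>{1..q}. \<Sum>r<q. chi (int r) * e r ^ k)"
      unfolding sum_distrib_left by (rule sum.swap)
    also have "\<dots> = (\<Sum>k\<in>{1..q}. of_real (u ^ k) * (chi (int k) * of_real (sqrt (real q)) * \<i> ^ (1 - h)))"
    proof (intro sum.cong refl)
      fix k
      have "(\<Sum>r<q. chi (int r) * e r ^ k) = of_real (u ^ k) * (\<Sum>r<q. chi (int r) * cis (2 * pi * of_int (int k * int r) / real q))"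
        unfolding sum_distrib_left
        by (intro sum.cong refl) (simp add: e_def power_mult_distrib Complex.DeMoivre mult_ac)
      also have "(\<Sum>r<q. chi (int r) * cis (2 * pi * of_int (int k * int r) / real q)) = (\<Sum>r\<in>{0..<int q}. chi r * cis (2 * pi * of_int (int k * r) / real q))"
        by (rule sum.reindex_bij_witness[of _ nat int]) auto
      finally show "(\<Sum>r<q. chi (int r) * e r ^ k) = of_real (u ^ k) * (chi (int k) * of_real (sqrt (real q)) * \<i> ^ (1 - h))"
        by (simp only: gauss)
    qed
    also have "\<dots> = of_real (sqrt (real q)) * \<i> ^ (1 - h) * (\<Sum>k\<in>{1..q}. chi (int k) * of_real (u ^ k))"
      by (simp add: sum_distrib_left mult_ac)
    also have "(\<Sum>k\<in>{1..q}. chi (int k) * of_real (u ^ k)) = num y"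
    proof -
      have "chi (int q) = 0" using periodic[of 0 1] chi_0 by simp
      thus ?thesis unfolding num_def u_def[symmetric] using chi_0
        by (intro sum.mono_neutral_cong) (auto simp: not_less_eq_eq Suc_le_eq not_less)
    qed
    finally show ?thesis .
  qed
  hence "(\<Sum>r<q. chi (int r) * (- \<i> * of_real pi - 2 * \<i> * of_real pi * (\<Sum>k\<in>{1..q}. e r ^ k) / of_real (1 - u ^ q)))
     = - \<i> * of_real pi * (\<Sum>r<q. chi (int r)) - 2 * \<i> * of_real pi / of_real (1 - u ^ q) * (of_real (sqrt (real q)) * \<i> ^ (1 - h) * num y)"
  proof -
    have "(\<Sum>r<q. chi (int r) * (c - d * A r / R)) = c * (\<Sum>r<q. chi (int r)) - d / R * (\<Sum>r<q. chi (int r) * A r)"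
      for c d R :: complex and A
      by (simp add: sum_distrib_left right_diff_distrib sum_subtractf mult_ac)
    moreover assume "(\<Sum>r<q. chi (int r) * (\<Sum>k\<in>{1..q}. e r ^ k)) = of_real (sqrt (real q)) * \<i> ^ (1 - h) * num y"
    ultimately show ?thesis by (simp only:)
  qed
  thus ?thesis unfolding cot sum_chi K_eq u_def by simp
qed

text \<open>Termwise integration expresses the transform as a limit of sums of
  \<open>chi n / (n + \<i> y)\<close> over integers of both signs. Grouped by residues they are
  partial fractions of cotangents, and the Gauss sum turns the cotangents back into the
  kernel.\<close>

lemma K_self_reciprocal:
  assumes y: "y > 0"
  shows "(LINT x:{0<..}|lborel. K x * hyp h (\<i> * of_real (2 * pi * x * y / real q))) = of_real (sqrt (real q)) / 2 * \<i> ^ h * K y"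
proof -
  have cism [measurable]: "cis \<in> borel_measurable borel"
    by (intro borel_measurable_continuous_onI continuous_intros)
  define J where "J = (\<lambda>y. LINT x:{0<..}|lborel. cis (2 * pi * x * y / real q) * K x)"
  have Ji: "set_integrable lborel {0<..} (\<lambda>x. cis (2 * pi * x * y / real q) * K x)" for y
    by (rule set_integrable_K_bounded) auto
  have "(LINT x:{0<..}|lborel. K x * hyp h (\<i> * of_real (2 * pi * x * y / real q)))
     = (LINT x:{0<..}|lborel. (1/2) * (cis (2 * pi * x * y / real q) * K x) + ((-1) ^ h / 2) * (cis (2 * pi * x * (- y) / real q) * K x))"
    by (intro set_lebesgue_integral_cong) (auto simp: hyp_eq_exp[OF h1] cis_conv_exp algebra_simps)
  also have "\<dots> = (1/2) * J y + ((-1) ^ h / 2) * J (- y)"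
    unfolding J_def set_integral_mult_right[symmetric] by (intro set_integral_add(2) set_integrable_mult_right Ji)
  finally have L: "(LINT x:{0<..}|lborel. K x * hyp h (\<i> * of_real (2 * pi * x * y / real q))) = (1/2) * J y + ((-1) ^ h / 2) * J (- y)" .
  define A where "A = complex_of_nat q / (4 * of_real pi)"
  define S where "S = (\<lambda>N::nat. \<Sum>n\<in>{- int N..<int N}. chi n / (of_int n + \<i> * of_real y))"
  \<comment> \<open>By parity of \<open>chi\<close> the sums for \<open>- y\<close> and
    \<open>y\<close> are the positive and the negative half of one sum over integers; the unmatched
    terms at 0 and at \<open>q M\<close> vanish with \<open>chi\<close>.\<close>
  have S_eq: "(1/2) * (\<Sum>n<q * M. chi (int n) * (of_nat q / (2 * pi) / (of_nat n - \<i> * of_real y)))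
      + ((-1) ^ h / 2) * (\<Sum>n<q * M. chi (int n) * (of_nat q / (2 * pi) / (of_nat n - \<i> * of_real (- y))))
      = A * (-1) ^ h * S (q * M)" for M
  proof -
    define N where "N = q * M"
    have hh: "(-1 :: complex) ^ h * (-1) ^ h = 1" by (simp flip: power_mult_distrib)
    have chiN: "chi (int N) = 0" using periodic[of 0 "int M"] chi_0 by (simp add: N_def)
    have "S N = (\<Sum>n\<in>{0..<int N}. chi n / (of_int n + \<i> * of_real y)) + (\<Sum>n\<in>{- int N..<0}. chi n / (of_int n + \<i> * of_real y))"
    proof -
      have "{- int N..<int N} = {0..<int N} \<union> {- int N..<0}" by auto
      thus ?thesis unfolding S_def by (simp only:) (rule sum.union_disjoint; auto)
    qed
    also have "(\<Sum>n\<in>{0..<int N}. chi n / (of_int n + \<i> * of_real y)) = (\<Sum>n<N. chi (int n) / (of_nat n + \<i> * of_real y))"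
      by (rule sum.reindex_bij_witness[of _ int nat]) auto
    also have "(\<Sum>n\<in>{- int N..<0}. chi n / (of_int n + \<i> * of_real y)) = (\<Sum>n\<in>{1..N}. (-1) ^ h * (chi (int n) / (of_nat n - \<i> * of_real y)))"
    proof (rule sum.reindex_bij_witness[of _ "\<lambda>n. - int n" "\<lambda>n. nat (- n)"])
      fix n assume n: "n \<in> {- int N..<0}"
      define m where "m = nat (- n)"
      have nm: "n = - int m" using n by (simp add: m_def)
      have "chi n / (of_int n + \<i> * of_real y) = (- ((-1) ^ h) * chi (int m)) / (- (of_nat m - \<i> * of_real y))"
        unfolding nm parity by simp
      also have "\<dots> = (-1) ^ h * (chi (int m) / (of_nat m - \<i> * of_real y))"
        by (simp only: mult_minus_left divide_minus_right divide_minus_left minus_minus times_divide_eq_right)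
      finally have "(-1) ^ h * (chi (int m) / (of_nat m - \<i> * of_real y)) = chi n / (of_int n + \<i> * of_real y)" ..
      thus "(-1) ^ h * (chi (int m) / (of_nat m - \<i> * of_real y)) = chi n / (of_int n + \<i> * of_real y)" 
        unfolding m_def .
    qed auto
    also have "\<dots> = (-1) ^ h * (\<Sum>n<N. chi (int n) / (of_nat n - \<i> * of_real y))"
      unfolding sum_distrib_left using chi_0 chiN
      by (intro sum.mono_neutral_cong) (auto simp: not_less_eq_eq Suc_le_eq not_less)
    finally have "S N = (\<Sum>n<N. chi (int n) / (of_nat n + \<i> * of_real y)) + (-1) ^ h * (\<Sum>n<N. chi (int n) / (of_nat n - \<i> * of_real y))" .
    hence "A * (-1) ^ h * S N = A * ((-1) ^ h * (\<Sum>n<N. chi (int n) / (of_nat n + \<i> * of_real y)))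
       + A * (((-1) ^ h * (-1) ^ h) * (\<Sum>n<N. chi (int n) / (of_nat n - \<i> * of_real y)))"
      by (simp only: distrib_left mult.assoc)
    thus ?thesis unfolding N_def hh by (simp add: A_def sum_distrib_left mult_ac)
  qed
  have lim1: "(\<lambda>M. A * (-1) ^ h * S (q * M)) \<longlonglongrightarrow> (1/2) * J y + ((-1) ^ h / 2) * J (- y)"
    unfolding S_eq[symmetric] J_def by (intro tendsto_intros integral_cis_K)
  have "(\<lambda>M. S (q * M)) \<longlonglongrightarrow> (\<Sum>r<q. chi (int r) / of_nat q * (of_real pi * cos (of_real pi * ((of_nat r + \<i> * of_real y) / of_nat q)) / sin (of_real pi * ((of_nat r + \<i> * of_real y) / of_nat q))))"
  proof -
    \<comment> \<open>Writing \<open>n = r + q k\<close> with \<open>k\<close> from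
      \<open>- M\<close> to \<open>M - 1\<close> covers \<open>- q M\<close> to
      \<open>q M - 1\<close> exactly and matches the range of the partial fractions.\<close>
    have "S (q * M) = (\<Sum>r<q. chi (int r) / of_nat q * (\<Sum>k\<in>{- int M..<int M}. 1 / ((of_nat r + \<i> * of_real y) / of_nat q + of_int k)))" for M
    proof -
      have "S (q * M) = (\<Sum>(r, k)\<in>{..<q} \<times> {- int M..<int M}. chi (int r) / (of_int (int r + int q * k) + \<i> * of_real y))"
        unfolding S_def
      proof (rule sum.reindex_bij_witness[of _ "\<lambda>(r, k). int r + int q * k" "\<lambda>n. (nat (n mod int q), n div int q)"])
        fix n assume n: "n \<in> {- int (q * M)..<int (q * M)}"
        show "(case (nat (n mod int q), n div int q) of (r, k) \<Rightarrow> int r + int q * k) = n" using q1 by simp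
        have "(- int M * int q) div int q = - int M" using q1 by (intro nonzero_mult_div_cancel_right) auto
        hence "- int M \<le> n div int q"
          using zdiv_mono1[of "- int M * int q" n "int q"] n q1 by (simp add: mult.commute)
        moreover have "n div int q < int M"
        proof -
          have "n = int q * (n div int q) + n mod int q" by simp
          moreover have "n mod int q \<ge> 0" using q1 by simp
          moreover have "n < int q * int M" using n by simp
          ultimately have "int q * (n div int q) < int q * int M" by linarith
          thus ?thesis using q1 by (simp add: mult_less_cancel_left_pos)
        qed
        ultimately show "(nat (n mod int q), n div int q) \<in> {..<q} \<times> {- int M..<int M}" using q1 by (auto simp: nat_less_iff)
        show "(case (nat (n mod int q), n div int q) of (r, k) \<Rightarrow> chi (int r) / (of_int (int r + int q * k) + \<i> * of_real y)) = chi n / (of_int n + \<i> * of_real y)"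
        proof -
          have "int (nat (n mod int q)) + int q * (n div int q) = n" using q1 by simp
          moreover have "chi (int (nat (n mod int q))) = chi n"
            using periodic[of "n mod int q" "n div int q"] q1 by simp
          ultimately show ?thesis by (simp only: prod.case)
        qed
      next
        fix b assume "b \<in> {..<q} \<times> {- int M..<int M}"
        then obtain r k where b: "b = (r, k)" "r < q" "- int M \<le> k" "k < int M" by auto
        show "(nat ((case b of (r, k) \<Rightarrow> int r + int q * k) mod int q), (case b of (r, k) \<Rightarrow> int r + int q * k) div int q) = b"
          using b by simp
        have "int q * k \<ge> int q * (- int M)" using b by (intro mult_left_mono) auto
        moreover have "int q * k \<le> int q * (int M - 1)" using b by (intro mult_left_mono) auto
        ultimately show "(case b of (r, k) \<Rightarrow> int r + int q * k) \<in> {- int (q * M)..<int (q * M)}"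
          using b by (simp add: algebra_simps)
      qed
      also have "\<dots> = (\<Sum>r<q. \<Sum>k\<in>{- int M..<int M}. chi (int r) / (of_int (int r + int q * k) + \<i> * of_real y))"
        by (simp add: sum.cartesian_product)
      also have "\<dots> = (\<Sum>r<q. chi (int r) / of_nat q * (\<Sum>k\<in>{- int M..<int M}. 1 / ((of_nat r + \<i> * of_real y) / of_nat q + of_int k)))"
        unfolding sum_distrib_left
      proof (intro sum.cong refl)
        fix r k
        have "(of_nat r + \<i> * of_real y) / of_nat q + of_int k = (of_int (int r + int q * k) + \<i> * of_real y) / (of_nat q :: complex)"
          using q1 by (simp add: field_simps)
        thus "chi (int r) / (of_int (int r + int q * k) + \<i> * of_real y) = chi (int r) / of_nat q * (1 / ((of_nat r + \<i> * of_real y) / of_nat q + of_int k))"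
          using q1 by simp
      qed
      finally show ?thesis .
    qed
    moreover have "(of_nat r + \<i> * of_real y) / of_nat q \<notin> (\<int> :: complex set)" for r
    proof
      assume "(of_nat r + \<i> * of_real y) / of_nat q \<in> (\<int> :: complex set)"
      then obtain z where "(of_nat r + \<i> * of_real y) / of_nat q = (of_int z :: complex)" by (elim Ints_cases)
      hence "of_nat r + \<i> * complex_of_real y = of_int z * of_nat q" using q1 by (simp add: field_simps)
      hence "Im (of_nat r + \<i> * complex_of_real y) = Im (of_int z * of_nat q)" by (rule arg_cong)
      thus False using y by simp
    qed
    ultimately show ?thesis by (simp only:) (intro tendsto_intros cot_partial_fractions)
  qed
  moreover have "(\<Sum>r<q. chi (int r) / of_nat q * T r) = (\<Sum>r<q. chi (int r) * T r) / of_nat q" for T :: "nat \<Rightarrow> complex"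
    by (simp add: sum_divide_distrib)
  ultimately have "(\<lambda>M. S (q * M)) \<longlonglongrightarrow> (- 2 * \<i> * of_real pi * of_real (sqrt (real q)) * \<i> ^ (1 - h) * K y) / of_nat q"
    unfolding sum_chi_cot[OF y, symmetric] by (simp only:)
  hence "(\<lambda>M. A * (-1) ^ h * S (q * M)) \<longlonglongrightarrow> A * (-1) ^ h * ((- 2 * \<i> * of_real pi * of_real (sqrt (real q)) * \<i> ^ (1 - h) * K y) / of_nat q)"
    by (rule tendsto_mult_left)
  from LIMSEQ_unique[OF lim1 this] have "(LINT x:{0<..}|lborel. K x * hyp h (\<i> * of_real (2 * pi * x * y / real q)))
     = A * (-1) ^ h * ((- 2 * \<i> * of_real pi * of_real (sqrt (real q)) * \<i> ^ (1 - h) * K y) / of_nat q)"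
    unfolding L .
  also have "\<dots> = of_real (sqrt (real q)) / 2 * \<i> ^ h * K y"
    using q1 h1 by (cases h) (auto simp: A_def field_simps)
  finally show ?thesis .
qed

sublocale self_reciprocal_kernel K "real q" h "(real q)\<^sup>2"
  by unfold_locales (use q1 h1 K_bound K_self_reciprocal in auto)

end

section \<open>The L-function as a Mellin transform\<close>

lemma Gamma_duplication_parity:
  assumes h: "h \<le> 1" and s: "Re s > 0"
  shows "Gamma ((s + of_nat h) / 2) * Gamma ((s + of_nat (1 - h)) / 2) = rpow 2 (1 - s) * of_real (sqrt pi) * Gamma s"
proof -
  have "s / 2 \<notin> \<int>\<^sub>\<le>\<^sub>0" "s / 2 + 1/2 \<notin> \<int>\<^sub>\<le>\<^sub>0"
    using s by (auto elim!: nonpos_Ints_cases simp: complex_eq_iff)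
  from Gamma_legendre_duplication[OF this]
  have "Gamma (s / 2) * Gamma ((s + 1) / 2) = rpow 2 (1 - s) * of_real (sqrt pi) * Gamma s"
    by (simp add: rpow_def add_divide_distrib)
  thus ?thesis using h by (cases h) (auto simp: mult.commute)
qed

context gauss_kernel
begin

definition L_right :: "complex \<Rightarrow> complex" where
  "L_right s = rGamma s * rpow (2 * pi / real q) s * mellin_K s"

definition completed_L :: "complex \<Rightarrow> complex" where
  "completed_L s = rpow (pi / real q) (- (s + of_nat (1 - h)) / 2) * Gamma ((s + of_nat (1 - h)) / 2) * L_right s"

text \<open>Left of the imaginary axis and on it, the functional equation is solved for the
  L-function. Because \<open>rGamma\<close> is entire, the poles of the Gamma factor turn into
  trivial zeros.\<close>

definition L_entire :: "complex \<Rightarrow> complex" where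
  "L_entire s = (if s \<in> {s. Re s > 0} then L_right s
     else rpow (pi / real q) ((s + of_nat (1 - h)) / 2) * rGamma ((s + of_nat (1 - h)) / 2) * completed_L (1 - s))"

text \<open>The termwise Mellin transform gives the limit along multiples of \<open>q\<close> only;
  absolute convergence for \<open>Re s > 1\<close> identifies it with the sum of the whole
  series.\<close>

lemma L_right_sums:
  assumes s: "Re s > 1"
  shows "(\<lambda>n. chi (int (Suc n)) * of_nat (Suc n) powr (-s)) sums L_right s"
proof -
  define f where "f = (\<lambda>n::nat. chi (int n) * rpow (real n) (- s))"
  define r where "r = 2 * pi / real q"
  have r: "r > 0" using q1 by (simp add: r_def)
  have H: "has_integral_pos (\<lambda>x. chi (int n) * (rpow x (s - 1) * of_real (decay x ^ n))) (rpow r (-s) * Gamma s * f n)" for n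
  proof (cases "n = 0")
    case False
    have "has_integral_pos (\<lambda>x. rpow x (s - 1) * of_real (exp (- (r * real n) * x ^ 1))) (rpow (r * real n) (- s / of_nat 1) * Gamma (s / of_nat 1) / of_nat 1)"
      by (rule has_integral_pos_Gamma_scaled) (use s r False in auto)
    hence "has_integral_pos (\<lambda>x. chi (int n) * (rpow x (s - 1) * of_real (decay x ^ n))) (chi (int n) * (rpow (r * real n) (- s) * Gamma s))"
      by (intro has_integral_pos_cmult) (simp add: decay_power r_def mult_ac)
    thus ?thesis using r False by (simp add: f_def rpow_mult mult_ac)
  qed (simp add: f_def chi_0 has_integral_pos_def set_integrable_def)
  have Hs: "has_integral_pos (\<lambda>x. \<Sum>n<N. chi (int n) * (rpow x (s - 1) * of_real (decay x ^ n))) (\<Sum>n<N. rpow r (-s) * Gamma s * f n)" for N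
  proof (induction N)
    case 0
    show ?case by (simp add: has_integral_pos_def set_integrable_def)
  next
    case (Suc N)
    show ?case unfolding sum.lessThan_Suc by (rule has_integral_pos_add[OF Suc H])
  qed
  have "(\<lambda>M. LINT x:{0<..}|lborel. rpow x (s - 1) * (\<Sum>n<q * M. chi (int n) * of_real (decay x ^ n))) \<longlonglongrightarrow> mellin_K s"
    unfolding mellin_K_def by (rule integral_K_limit) (use s in \<open>auto intro!: set_integrable_power_K\<close>)
  moreover have "(LINT x:{0<..}|lborel. rpow x (s - 1) * (\<Sum>n<q * M. chi (int n) * of_real (decay x ^ n))) = (rpow r (-s) * Gamma s) * (\<Sum>n<q * M. f n)" for M
    using Hs[of "q * M"] by (simp add: has_integral_pos_def sum_distrib_left mult_ac)
  ultimately have "(\<lambda>M. (rGamma s * rpow r s) * ((rpow r (-s) * Gamma s) * (\<Sum>n<q * M. f n))) \<longlonglongrightarrow> (rGamma s * rpow r s) * mellin_K s"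
    by (intro tendsto_mult tendsto_const) simp
  moreover have "(rGamma s * rpow r s) * (rpow r (-s) * Gamma s) = 1"
  proof -
    have "Gamma s \<noteq> 0"
      using s by (auto simp: Gamma_eq_zero_iff elim!: nonpos_Ints_cases)
    thus ?thesis by (simp add: rGamma_inverse_Gamma rpow_minus field_simps)
  qed
  ultimately have lim: "(\<lambda>M. \<Sum>n<q * M. f n) \<longlonglongrightarrow> L_right s"
    unfolding mult.assoc[symmetric] L_right_def r_def[symmetric] by simp
  have "summable f"
  proof (rule summable_comparison_test')
    show "summable (\<lambda>n. real n powr (- Re s))" using s by (subst summable_real_powr_iff) simp
    show "norm (f n) \<le> real n powr (- Re s)" if "n \<ge> 1" for n
      using that norm_chi[of "int n"] by (simp add: f_def norm_mult norm_rpow_powr mult_left_le_one_le)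
  qed
  hence fs: "f sums suminf f" by (rule summable_sums)
  have "(\<lambda>M. \<Sum>n<q * M. f n) \<longlonglongrightarrow> suminf f"
    using LIMSEQ_subseq_LIMSEQ[OF fs[unfolded sums_def], of "\<lambda>M. q * M"] q1 by (simp add: strict_mono_def o_def)
  hence "suminf f = L_right s" using lim LIMSEQ_unique by blast
  hence "f sums L_right s" using fs by simp
  hence "(\<lambda>n. f (Suc n)) sums L_right s" by (subst sums_Suc_iff) (simp add: f_def chi_0)
  moreover have "f (Suc n) = chi (int (Suc n)) * of_nat (Suc n) powr (-s)" for n
    using powr_conv_rpow[of "real (Suc n)" "-s"] unfolding f_def of_real_of_nat_eq by simp
  ultimately show ?thesis by (simp only:)
qed

lemma holomorphic_L_right: "L_right holomorphic_on {s. Re s > 0}"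
  unfolding L_right_def[abs_def] rpow_def by (intro holomorphic_intros holomorphic_mellin_K)

lemma Gamma_parity_nonzero: "Re s > 0 \<Longrightarrow> (s + of_nat k) / 2 \<notin> \<int>\<^sub>\<le>\<^sub>0"
proof
  assume "Re s > 0" "(s + of_nat k) / 2 \<in> \<int>\<^sub>\<le>\<^sub>0"
  then obtain n where n: "(s + of_nat k) / 2 = of_int n" "n \<le> 0" by (elim nonpos_Ints_cases)
  hence "Re ((s + of_nat k) / 2) \<le> 0" unfolding n by simp
  thus False using \<open>Re s > 0\<close> by simp
qed

lemma holomorphic_completed_L: "completed_L holomorphic_on {s. Re s > 0}"
  unfolding completed_L_def[abs_def] rpow_def
  by (intro holomorphic_intros holomorphic_L_right) (auto dest: Gamma_parity_nonzero)

text \<open>The duplication formula trades \<open>Gamma s\<close> against the Gamma factor of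
  \<open>completed_L\<close> and leaves the reciprocal Gamma of the opposite parity. In this form
  the functional equation of \<open>mellin_K\<close> is the symmetry of
  \<open>completed_L\<close>.\<close>

lemma completed_L_conv_mellin_K:
  assumes s: "Re s > 0"
  shows "completed_L s = 2 * of_real (sqrt pi) * rpow (pi / real q) ((s - of_nat (1 - h)) / 2) * mellin_K s * rGamma ((s + of_nat h) / 2)"
proof -
  define a where "a = 1 - h"
  define P where "P = pi / real q"
  have P: "P > 0" using q1 by (simp add: P_def)
  have nz: "Gamma s \<noteq> 0" "Gamma ((s + of_nat h) / 2) \<noteq> 0"
    using s Gamma_parity_nonzero[OF s, of h] by (auto simp: Gamma_eq_zero_iff elim!: nonpos_Ints_cases)
  have "Gamma ((s + of_nat a) / 2) * rGamma s = rpow 2 (1 - s) * of_real (sqrt pi) * rGamma ((s + of_nat h) / 2)"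
    using Gamma_duplication_parity[OF h1 s] nz by (simp add: a_def rGamma_inverse_Gamma field_simps)
  moreover have "rpow (2 * pi / real q) s = rpow 2 s * rpow P s"
    using rpow_mult[of 2 P s] P by (simp add: P_def)
  ultimately have "completed_L s = (rpow P (- (s + of_nat a) / 2) * rpow P s) * (rpow 2 (1 - s) * rpow 2 s) * of_real (sqrt pi) * rGamma ((s + of_nat h) / 2) * mellin_K s"
    unfolding completed_L_def L_right_def a_def[symmetric] P_def[symmetric] by (simp add: mult_ac)
  also have "rpow P (- (s + of_nat a) / 2) * rpow P s = rpow P ((s - of_nat a) / 2)"
    unfolding rpow_add[symmetric] by (rule arg_cong[of _ _ "rpow P"]) (simp add: field_simps)
  also have "rpow 2 (1 - s) * rpow 2 s = 2" using rpow_of_nat[of 2 1] by (simp flip: rpow_add)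
  finally show ?thesis by (simp add: a_def P_def mult_ac)
qed

lemma completed_L_reflect:
  assumes s: "0 < Re s" "Re s < 1"
  shows "completed_L (1 - s) = completed_L s"
proof -
  define P where "P = pi / real q"
  have s': "Re (1 - s) > 0" using s by simp
  define g where "g = Gamma ((s + of_nat h) / 2)"
  define g' where "g' = Gamma ((1 - s + of_nat h) / 2)"
  have nz: "g \<noteq> 0" "g' \<noteq> 0"
    unfolding g_def g'_def using Gamma_parity_nonzero[OF s(1), of h] Gamma_parity_nonzero[OF s', of h] by (auto simp: Gamma_eq_zero_iff)
  have FE: "g' * rpow P (- (of_nat h + 1 - s) / 2) * mellin_K s = g * rpow P (- (of_nat h + s) / 2) * mellin_K (1 - s)"
    using mellin_K_functional_equation[OF s] unfolding g_def g'_def P_def by (simp add: algebra_simps)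
  have ah: "(of_nat (1 - h) :: complex) = 1 - of_nat h" using h1 by (simp add: of_nat_diff)
  have e1: "rpow P ((s - of_nat (1 - h)) / 2) = rpow P (- (of_nat h + 1 - s) / 2) * rpow P (of_nat h)"
    unfolding rpow_add[symmetric] ah by (rule arg_cong[of _ _ "rpow P"]) (simp add: field_simps)
  have e2: "rpow P ((1 - s - of_nat (1 - h)) / 2) = rpow P (- (of_nat h + s) / 2) * rpow P (of_nat h)"
    unfolding rpow_add[symmetric] ah by (rule arg_cong[of _ _ "rpow P"]) (simp add: field_simps)
  have "rpow P (- (of_nat h + s) / 2) * mellin_K (1 - s) * inverse g' = rpow P (- (of_nat h + 1 - s) / 2) * mellin_K s * inverse g"
    using FE nz by (simp add: field_simps)
  thus ?thesis
    unfolding completed_L_conv_mellin_K[OF s(1)] completed_L_conv_mellin_K[OF s'] P_def[symmetric] e1 e2 rGamma_inverse_Gamma g_def[symmetric] g'_def[symmetric]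
    by (simp add: mult_ac)
qed

text \<open>Two holomorphic functions on overlapping open half planes are glued; on the common strip
  they agree by \<open>completed_L_reflect\<close>.\<close>

lemma holomorphic_L_entire: "L_entire holomorphic_on UNIV"
proof -
  define R where "R = (\<lambda>s. rpow (pi / real q) ((s + of_nat (1 - h)) / 2) * rGamma ((s + of_nat (1 - h)) / 2) * completed_L (1 - s))"
  have "(\<lambda>s. completed_L (1 - s)) holomorphic_on {s. Re s < 1}"
  proof -
    have "(\<lambda>s. 1 - s) holomorphic_on {s. Re s < 1}" by (intro holomorphic_intros)
    moreover have "(\<lambda>s. 1 - s) ` {s. Re s < 1} \<subseteq> {s. Re s > 0}" by auto
    ultimately show ?thesis
      using holomorphic_on_compose_gen[OF _ holomorphic_completed_L] unfolding o_def by blast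
  qed
  hence "R holomorphic_on {s. Re s < 1}" unfolding R_def rpow_def by (intro holomorphic_intros) auto
  hence "(\<lambda>s. if s \<in> {s. Re s > 0} then L_right s else R s) holomorphic_on {s. Re s > 0} \<union> {s. Re s < 1}"
  proof (rule holomorphic_on_If_Un[OF holomorphic_L_right])
    fix s assume "s \<in> {s. Re s > 0}" "s \<in> {s. Re s < 1}"
    hence s: "Re s > 0" "Re s < 1" by auto
    have "rGamma ((s + of_nat (1 - h)) / 2) * Gamma ((s + of_nat (1 - h)) / 2) = 1"
      using Gamma_parity_nonzero[OF s(1), of "1 - h"] by (simp add: rGamma_inverse_Gamma Gamma_eq_zero_iff)
    moreover have "rpow (pi / real q) ((s + of_nat (1 - h)) / 2) * rpow (pi / real q) (- (s + of_nat (1 - h)) / 2) = 1"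
    proof -
      have "a / 2 + - a / 2 = 0" for a :: complex by simp
      thus ?thesis by (simp only: rpow_add[symmetric] rpow_0)
    qed
    moreover have "R s = (rpow (pi / real q) ((s + of_nat (1 - h)) / 2) * rpow (pi / real q) (- (s + of_nat (1 - h)) / 2))
        * (rGamma ((s + of_nat (1 - h)) / 2) * Gamma ((s + of_nat (1 - h)) / 2)) * L_right s"
      unfolding R_def completed_L_reflect[OF s] unfolding completed_L_def by (simp only: mult_ac)
    ultimately show "L_right s = R s" by simp
  qed (auto simp: open_halfspace_Re_gt open_halfspace_Re_lt)
  also have "{s. Re s > 0} \<union> {s. Re s < 1} = UNIV" by auto
  finally show ?thesis unfolding R_def L_entire_def[abs_def] .
qed

lemma dirichlet_L_eq: "dirichlet_L chi = L_entire"
proof (rule dirichlet_L_eqI)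
  show "L_entire nicely_meromorphic_on UNIV"
    by (intro analytic_on_imp_nicely_meromorphic_on) (simp add: analytic_on_open holomorphic_L_entire)
  show "(\<lambda>n. chi (int (Suc n)) * of_nat (Suc n) powr - s) sums L_entire s" if "Re s > 1" for s
    using L_right_sums[OF that] that by (simp add: L_entire_def)
qed

lemma xi_char_eq:
  assumes "chi 1 = 1" "Re s > 0"
  shows "xi_char q chi s = completed_L s"
proof -
  have "chi (-1) = - ((-1) ^ h)" using parity[of 1] assms(1) by simp
  hence "character_parity chi = 1 - h" using h1 by (cases h) (auto simp: character_parity_def)
  moreover have "dirichlet_L chi s = L_right s" using assms(2) by (simp add: dirichlet_L_eq L_entire_def)
  moreover have "pi / real q > 0" using q1 by simp
  ultimately show ?thesis
    unfolding xi_char_def completed_L_def Let_def by (simp only: powr_conv_rpow)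
qed

lemma kummer_at_0: "kummer_1F1 a c 0 = 1"
proof -
  have "(\<lambda>n. pochhammer a n / pochhammer c n * 0 ^ n / fact n) = (\<lambda>n. if n = 0 then 1 else 0 :: complex)"
    by (auto simp: fun_eq_iff power_0_left)
  moreover have "(\<lambda>n::nat. if n = 0 then 1 else 0 :: complex) sums 1" using sums_single[of 0 "\<lambda>_. 1"] by simp
  ultimately show ?thesis by (simp add: kummer_1F1_def sums_iff)
qed

text \<open>\<open>gauss_mellin\<close> without the factor \<open>z ^ h / 2\<close>. The integral
  over \<open>\<Xi>\<close> has this factor outside, and its integrand must be controlled at
  \<open>z = 0\<close> too.\<close>

definition kummer_factor :: "real \<Rightarrow> complex \<Rightarrow> complex \<Rightarrow> complex" where
  "kummer_factor c z s = rpow c (- s / 2) * Gamma ((s + of_nat h) / 2) * kummer_1F1 ((s + of_nat h) / 2) (of_nat h + 1/2) (z\<^sup>2 / 4)"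

lemma gauss_mellin_eq_kummer_factor:
  assumes c: "c > 0"
  shows "gauss_mellin c h (of_real (sqrt c) * z) s = z ^ h / 2 * kummer_factor c z s"
proof -
  have "(of_real (sqrt c) * z)\<^sup>2 / (4 * of_real c) = z\<^sup>2 / 4"
    using c by (simp add: power_mult_distrib flip: of_real_power)
  moreover have "(of_real (sqrt c) * z) ^ h * rpow c (- (s + of_nat h) / 2) = z ^ h * rpow c (- s / 2)"
  proof -
    have "rpow c (of_nat h / 2) = of_real (sqrt c) ^ h"
      using h1 rpow_of_real[OF c, of "1/2"] by (cases h) (auto simp: powr_half_sqrt c less_imp_le)
    moreover have "rpow c (- (s + of_nat h) / 2) * rpow c (of_nat h / 2) = rpow c (- s / 2)"
      unfolding rpow_add[symmetric] by (rule arg_cong[of _ _ "rpow c"]) (simp add: field_simps)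
    ultimately show ?thesis by (simp add: power_mult_distrib mult_ac)
  qed
  ultimately show ?thesis unfolding gauss_mellin_def kummer_factor_def by (simp only: times_divide_eq_left times_divide_eq_right mult_ac)
qed

text \<open>For \<open>z ^ h\<close> nonzero this is a multiple of \<open>gauss_mellin\<close>. In
  the remaining case \<open>h = 1\<close>, \<open>z = 0\<close>, where \<open>gauss_mellin\<close>
  vanishes, the factor is a multiple of the transform of the plain Gaussian on the line
  \<open>Re s = 3/2\<close>.\<close>

lemma integrable_kummer_factor:
  assumes c: "c > 0"
  shows "integrable lborel (\<lambda>\<tau>. kummer_factor c z (Complex (1/2) \<tau>))"
proof (cases "z ^ h = 0")
  case False
  have "integrable lborel (\<lambda>\<tau>. 2 / z ^ h * gauss_mellin c h (of_real (sqrt c) * z) (Complex (1/2) \<tau>))"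
    by (intro integrable_mult_right gauss_mellin_inversion(1) h1 c)
  moreover have "2 / w * (w / 2 * x) = x" if "w \<noteq> 0" for w x :: complex using that by simp
  note this[OF False]
  ultimately show ?thesis unfolding gauss_mellin_eq_kummer_factor[OF c] by (simp only:)
next
  case True
  hence h: "h = 1" "z = 0" using h1 by (cases h; auto)+
  have C: "Complex (1/2) \<tau> = 1/2 + \<i> * of_real \<tau>" for \<tau> by (simp add: complex_eq_iff)
  have eq: "kummer_factor c z (Complex (1/2) \<tau>) = 2 * rpow c (1/2) * gauss_mellin c 0 0 (Complex (3/2) \<tau>)" for \<tau>
  proof -
    have e: "Complex (1/2) \<tau> + 1 = Complex (3/2) \<tau>" by (simp add: complex_eq_iff)
    have "rpow c (- Complex (1/2) \<tau> / 2) = rpow c (1/2) * rpow c (- Complex (3/2) \<tau> / 2)"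
      unfolding rpow_add[symmetric] by (rule arg_cong[of _ _ "rpow c"]) (simp add: complex_eq_iff)
    thus ?thesis unfolding kummer_factor_def gauss_mellin_def by (simp add: h kummer_at_0 e)
  qed
  obtain B where B: "\<And>\<tau>. norm (gauss_mellin c 0 0 (Complex (3/2) \<tau>)) \<le> B / (1 + \<tau>\<^sup>2)"
    using gauss_mellin_bound[of 0 "3/2" c 0] c by auto
  have "integrable lborel (\<lambda>\<tau>::real. B * inverse (1 + \<tau>\<^sup>2))"
    using integrable_inverse_1_plus_square by (simp add: set_integrable_def)
  hence "integrable lborel (\<lambda>\<tau>. gauss_mellin c 0 0 (Complex (3/2) \<tau>))"
  proof (rule Bochner_Integration.integrable_bound)
    have hol: "gauss_mellin c 0 0 holomorphic_on {s. Re s > 0}"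
      unfolding gauss_mellin_def[abs_def] rpow_def using Gamma_parity_nonzero[of _ 0]
      by (auto simp: kummer_at_0 intro!: holomorphic_intros)
    have C3: "Complex (3/2) \<tau> = 3/2 + \<i> * of_real \<tau>" for \<tau> by (simp add: complex_eq_iff)
    have "continuous_on UNIV (\<lambda>\<tau>. gauss_mellin c 0 0 (Complex (3/2) \<tau>))" unfolding C3
      by (rule continuous_on_compose2[OF holomorphic_on_imp_continuous_on[OF hol]])
         (auto intro!: continuous_intros)
    thus "(\<lambda>\<tau>. gauss_mellin c 0 0 (Complex (3/2) \<tau>)) \<in> borel_measurable lborel"
      by (simp add: borel_measurable_continuous_onI)
    show "AE \<tau> in lborel. norm (gauss_mellin c 0 0 (Complex (3/2) \<tau>)) \<le> norm (B * inverse (1 + \<tau>\<^sup>2))"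
    proof (rule AE_I2)
      fix \<tau> :: real
      have "norm (gauss_mellin c 0 0 (Complex (3/2) \<tau>)) \<le> B / (1 + \<tau>\<^sup>2)" by (rule B)
      also have "\<dots> \<le> \<bar>B / (1 + \<tau>\<^sup>2)\<bar>" by (rule abs_ge_self)
      finally show "norm (gauss_mellin c 0 0 (Complex (3/2) \<tau>)) \<le> norm (B * inverse (1 + \<tau>\<^sup>2))"
        by (simp only: real_norm_def divide_inverse)
    qed
  qed
  thus ?thesis unfolding eq by (intro integrable_mult_right)
qed

text \<open>\<open>gauss_hyp_parseval\<close> gives this only after multiplication by
  \<open>z ^ h\<close>; bounding \<open>mellin_K\<close> on the critical line by its absolute
  integral covers \<open>z = 0\<close> as well.\<close>

lemma integrable_kummer_factor_mellin_K:
  assumes c: "c > 0"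
  shows "integrable lborel (\<lambda>\<tau>. kummer_factor c z (Complex (1/2) \<tau>) * mellin_K (1 - Complex (1/2) \<tau>))"
proof -
  define B where "B = (LINT x:{0<..}|lborel. norm (rpow x (1/2 - 1) * K x))"
  have bd: "norm (mellin_K (1 - Complex (1/2) \<tau>)) \<le> B" for \<tau>
  proof -
    have "norm (mellin_K (1 - Complex (1/2) \<tau>)) \<le> (LINT x:{0<..}|lborel. norm (rpow x (1 - Complex (1/2) \<tau> - 1) * K x))"
      unfolding mellin_K_def by (intro set_integral_norm_bound set_integrable_power_K) simp
    also have "\<dots> = B" unfolding B_def
      by (intro set_lebesgue_integral_cong) (auto simp: norm_mult norm_rpow_powr)
    finally show ?thesis .
  qed
  have K [measurable]: "(\<lambda>\<tau>. mellin_K (1 - Complex (1/2) \<tau>)) \<in> borel_measurable borel"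
  proof (rule borel_measurable_continuous_onI)
    have C: "1 - Complex (1/2) \<tau> = 1/2 - \<i> * of_real \<tau>" for \<tau> by (simp add: complex_eq_iff)
    show "continuous_on UNIV (\<lambda>\<tau>. mellin_K (1 - Complex (1/2) \<tau>))" unfolding C
      by (rule continuous_on_compose2[OF holomorphic_on_imp_continuous_on[OF holomorphic_mellin_K]])
         (auto intro!: continuous_intros)
  qed
  have I: "integrable lborel (\<lambda>\<tau>. B * norm (kummer_factor c z (Complex (1/2) \<tau>)))"
    by (intro integrable_mult_right integrable_norm integrable_kummer_factor c)
  have [measurable]: "(\<lambda>\<tau>. kummer_factor c z (Complex (1/2) \<tau>)) \<in> borel_measurable borel"
    using borel_measurable_integrable[OF integrable_kummer_factor[OF c]] by simp
  show ?thesis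
  proof (rule Bochner_Integration.integrable_bound[OF I])
    show "AE \<tau> in lborel. norm (kummer_factor c z (Complex (1/2) \<tau>) * mellin_K (1 - Complex (1/2) \<tau>)) \<le> norm (B * norm (kummer_factor c z (Complex (1/2) \<tau>)))"
    proof (rule AE_I2)
      fix \<tau>
      have "norm (mellin_K (1 - Complex (1/2) \<tau>)) * norm (kummer_factor c z (Complex (1/2) \<tau>)) \<le> B * norm (kummer_factor c z (Complex (1/2) \<tau>))"
        by (intro mult_right_mono bd) auto
      thus "norm (kummer_factor c z (Complex (1/2) \<tau>) * mellin_K (1 - Complex (1/2) \<tau>)) \<le> norm (B * norm (kummer_factor c z (Complex (1/2) \<tau>)))"
        by (simp add: norm_mult mult.commute)
    qed
  qed measurable
qed

text \<open>By the symmetry of \<open>completed_L\<close> the integrand splits as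
  \<open>H t = f t + f (- t)\<close>, where \<open>f\<close> is up to a constant the Parseval
  integrand on the critical line. The half-line integral of \<open>H\<close> is thus the full
  integral of \<open>f\<close>.\<close>

theorem gauss_hyp_Xi_integral:
  fixes z :: complex and \<alpha> \<beta> :: real
  assumes \<alpha>: "\<alpha> > 0" "\<beta> > 0" "\<alpha> * \<beta> = 1" and chi1: "chi 1 = 1"
  defines "\<omega> \<equiv> (\<lambda>s. of_real \<alpha> powr (1/2 - s) * exp (- z\<^sup>2 / 8) * kummer_1F1 ((of_nat h + 1 - s) / 2) (of_nat h + 1/2) (z\<^sup>2 / 4))"
  defines "H \<equiv> (\<lambda>t::real. Gamma ((of_nat h + (1 + \<i> * of_real t) / 2) / 2) * Gamma ((of_nat h + 1 - (1 + \<i> * of_real t) / 2) / 2)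
      * Xi_char q chi (of_real t / 2) * (\<omega> ((1 + \<i> * of_real t) / 2) + \<omega> (1 - (1 + \<i> * of_real t) / 2)))"
  shows "set_integrable lborel {0<..} H"
    and "of_real (sqrt \<beta>) * exp (- z\<^sup>2 / 8) * (LINT x:{0<..}|lborel. of_real (exp (- (pi * \<beta>\<^sup>2 / q) * x\<^sup>2)) * hyp h (of_real (sqrt pi * \<beta> / sqrt q) * z * of_real x) * K x)
      = z ^ h * of_real (sqrt (real q / pi)) ^ h / of_real (16 * pi powr (3/2)) * (LINT t:{0<..}|lborel. H t)"
proof -
  define P where "P = pi / real q"
  define c where "c = P * \<beta>\<^sup>2"
  have P: "P > 0" using q1 by (simp add: P_def)
  have c: "c > 0" using P \<alpha> by (simp add: c_def)
  have \<alpha>\<beta>: "\<alpha> = inverse \<beta>" using \<alpha> by (simp add: field_simps)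
  define E where "E = (\<lambda>\<tau>. kummer_factor c z (Complex (1/2) \<tau>) * mellin_K (1 - Complex (1/2) \<tau>))"
  have E: "integrable lborel E" unfolding E_def by (rule integrable_kummer_factor_mellin_K[OF c])
  define \<kappa> where "\<kappa> = 2 * of_real (sqrt pi) * rpow P (of_nat h / 2) * of_real (sqrt \<beta>) * exp (- z\<^sup>2 / 8)"
  \<comment> \<open>The half of \<open>H\<close> that contains \<open>\<omega> (1 - s)\<close>; the
    other half is \<open>Q (1 - s)\<close>.\<close>
  define Q where "Q = (\<lambda>s. Gamma ((s + of_nat h) / 2) * Gamma ((1 - s + of_nat h) / 2) * \<omega> (1 - s) * completed_L (1 - s))"
  have Q: "Q (Complex (1/2) \<tau>) = \<kappa> * E \<tau>" for \<tau>
  proof -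
    define s where "s = Complex (1/2) \<tau>"
    have s: "Re (1 - s) > 0" by (simp add: s_def)
    define g' where "g' = Gamma ((1 - s + of_nat h) / 2)"
    have nz: "g' \<noteq> 0" unfolding g'_def using Gamma_parity_nonzero[OF s, of h] by (auto simp: Gamma_eq_zero_iff)
    \<comment> \<open>The Gamma factor cancels the reciprocal Gamma in \<open>completed_L\<close>
      and leaves the plain Mellin transform of the kernel.\<close>
    have cL: "g' * completed_L (1 - s) = 2 * of_real (sqrt pi) * rpow P ((1 - s - of_nat (1 - h)) / 2) * mellin_K (1 - s)"
      unfolding completed_L_conv_mellin_K[OF s] rGamma_inverse_Gamma g'_def[symmetric] P_def[symmetric] using nz by simp
    \<comment> \<open>Since \<open>\<beta>\<close> is the inverse of \<open>\<alpha>\<close>, this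
      power supplies both the prefactor \<open>sqrt \<beta>\<close> and the scale of the Gaussian
      with parameter \<open>\<beta>\<close>.\<close>
    have "complex_of_real \<alpha> powr (1/2 - (1 - s)) = rpow \<beta> (1/2) * rpow \<beta> (- s)"
    proof -
      have "complex_of_real \<alpha> powr (1/2 - (1 - s)) = rpow \<alpha> (1/2 - (1 - s))" using \<alpha>(1) by (rule powr_conv_rpow)
      also have "\<dots> = rpow \<beta> (- (1/2 - (1 - s)))" unfolding \<alpha>\<beta> by (rule rpow_inverse[OF \<alpha>(2)])
      also have "- (1/2 - (1 - s)) = 1/2 + - s" by simp
      finally show ?thesis by (simp only: rpow_add)
    qed
    moreover have "rpow \<beta> (1/2) = of_real (sqrt \<beta>)"
      using rpow_of_real[OF \<alpha>(2), of "1/2"] \<alpha> by (simp add: powr_half_sqrt)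
    moreover have "of_nat h + 1 - (1 - s) = s + of_nat h" by simp
    ultimately have w: "\<omega> (1 - s) = of_real (sqrt \<beta>) * rpow \<beta> (- s) * exp (- z\<^sup>2 / 8) * kummer_1F1 ((s + of_nat h) / 2) (of_nat h + 1/2) (z\<^sup>2 / 4)"
      unfolding \<omega>_def by (simp only:)
    have rc: "rpow c (- s / 2) = rpow P (- s / 2) * rpow \<beta> (- s)"
      using rpow_mult[OF P, of "\<beta>\<^sup>2"] rpow_power[OF \<alpha>(2), of 2] \<alpha> by (simp add: c_def)
    have ah: "(of_nat (1 - h) :: complex) = 1 - of_nat h" using h1 by (simp add: of_nat_diff)
    have rP: "rpow P ((1 - s - of_nat (1 - h)) / 2) = rpow P (of_nat h / 2) * rpow P (- s / 2)"
      unfolding rpow_add[symmetric] ah by (rule arg_cong[of _ _ "rpow P"]) (simp add: field_simps)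
    have "Q s = Gamma ((s + of_nat h) / 2) * \<omega> (1 - s) * (g' * completed_L (1 - s))"
      unfolding Q_def g'_def by (simp only: mult_ac)
    also have "\<dots> = \<kappa> * (kummer_factor c z s * mellin_K (1 - s))"
      unfolding cL w kummer_factor_def rc rP \<kappa>_def by (simp only: mult_ac)
    finally show ?thesis by (simp add: E_def s_def)
  qed
  \<comment> \<open>The argument of \<open>\<Xi>\<close> is \<open>t / 2\<close>, so
    \<open>\<tau> = t / 2\<close> on the critical line and the substitution contributes a factor
    2.\<close>
  define f where "f = (\<lambda>t. Q (Complex (1/2) (t / 2)))"
  have fE: "f = (\<lambda>t. \<kappa> * E (0 + 1/2 * t))" by (simp add: f_def Q fun_eq_iff)
  have fi: "integrable lborel f" unfolding fE
    by (intro integrable_mult_right lborel_integrable_real_affine E) simp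
  have fint: "(LINT t|lborel. f t) = 2 * \<kappa> * (LINT \<tau>|lborel. E \<tau>)"
  proof -
    have "Y = 2 * X" if "X = \<bar>1/2::real\<bar> *\<^sub>R Y" for X Y :: complex
      unfolding that by (simp add: scaleR_conv_of_real)
    from this[OF lborel_integral_real_affine[of "1/2" E 0]]
    show ?thesis unfolding fE by simp
  qed
  have H: "H t = f t + f (- t)" for t
  proof -
    define s where "s = (1 + \<i> * complex_of_real t) / 2"
    have s1: "Complex (1/2) (t / 2) = s" "Complex (1/2) (- t / 2) = 1 - s" by (simp_all add: s_def complex_eq_iff)
    have "1/2 + \<i> * (of_real t / 2) = s" by (simp add: s_def field_simps)
    moreover have s2: "0 < Re s" "Re s < 1" by (simp_all add: s_def)
    ultimately have Xi: "Xi_char q chi (of_real t / 2) = completed_L s"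
      unfolding Xi_char_def using xi_char_eq[OF chi1] by simp
    have "H t = Gamma ((of_nat h + s) / 2) * Gamma ((of_nat h + 1 - s) / 2) * completed_L s * (\<omega> s + \<omega> (1 - s))"
      unfolding H_def s_def[symmetric] Xi ..
    also have "\<dots> = Q s + Q (1 - s)"
      unfolding Q_def completed_L_reflect[OF s2] by (simp add: algebra_simps)
    finally show ?thesis by (simp only: f_def s1)
  qed
  show "set_integrable lborel {0<..} H" unfolding H[abs_def] by (rule lborel_integral_fold(1)[OF fi])
  define G where "G = (LINT x:{0<..}|lborel. of_real (exp (- c * x\<^sup>2)) * hyp h (of_real (sqrt c) * z * of_real x) * K x)"
  have "z ^ h / 2 * (LINT \<tau>|lborel. E \<tau>) = 2 * pi * G"
    using gauss_hyp_parseval(2)[OF c, of "of_real (sqrt c) * z"]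
    unfolding gauss_mellin_eq_kummer_factor[OF c] mult.assoc[of "z ^ h / 2"] E_def[symmetric] integral_mult_right_zero G_def .
  hence 1: "z ^ h * (LINT \<tau>|lborel. E \<tau>) = 4 * pi * G" by simp
  have "(LINT t:{0<..}|lborel. H t) = 2 * \<kappa> * (LINT \<tau>|lborel. E \<tau>)"
    unfolding H[abs_def] using lborel_integral_fold(2)[OF fi] fint by simp
  hence 2: "z ^ h * (LINT t:{0<..}|lborel. H t) = 2 * \<kappa> * (4 * pi * G)" using 1 by (simp add: mult_ac)
  have "z ^ h * of_real (sqrt (real q / pi)) ^ h / of_real (16 * pi powr (3/2)) * (LINT t:{0<..}|lborel. H t)
     = of_real (sqrt (real q / pi)) ^ h / of_real (16 * pi powr (3/2)) * (2 * \<kappa> * (4 * pi * G))"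
  proof -
    have "a * S / W * I = S / W * (a * I)" for a S W I :: complex by simp
    thus ?thesis using 2 by (simp only:)
  qed
  also have "\<dots> = of_real (sqrt \<beta>) * exp (- z\<^sup>2 / 8) * G"
  proof -
    have "rpow P (of_nat h / 2) = of_real (sqrt P) ^ h"
      using h1 rpow_of_real[OF P, of "1/2"] P by (cases h) (auto simp: powr_half_sqrt)
    moreover have "complex_of_real (sqrt (real q / pi)) ^ h * of_real (sqrt P) ^ h = 1"
    proof -
      have "sqrt (real q / pi) * sqrt P = 1" using q1 by (simp add: P_def flip: real_sqrt_mult)
      thus ?thesis by (simp flip: power_mult_distrib of_real_mult)
    qed
    moreover have "pi powr (3/2) = pi * sqrt pi"
      using powr_add[of pi 1 "1/2"] by (simp add: powr_half_sqrt)
    moreover have "of_real (sqrt (real q / pi)) ^ h / of_real (16 * (pi * sqrt pi)) * (2 * \<kappa> * (4 * pi * G))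
       = (complex_of_real (sqrt (real q / pi)) ^ h * rpow P (of_nat h / 2)) * (of_real (sqrt \<beta>) * exp (- z\<^sup>2 / 8) * G)"
      by (simp add: \<kappa>_def field_simps)
    ultimately show ?thesis by simp
  qed
  also have "G = (LINT x:{0<..}|lborel. of_real (exp (- (pi * \<beta>\<^sup>2 / q) * x\<^sup>2)) * hyp h (of_real (sqrt pi * \<beta> / sqrt q) * z * of_real x) * K x)"
  proof -
    have "sqrt c = sqrt pi * \<beta> / sqrt q" "c = pi * \<beta>\<^sup>2 / q"
      using \<alpha> by (simp_all add: c_def P_def real_sqrt_mult real_sqrt_divide)
    thus ?thesis unfolding G_def by (simp only:)
  qed
  finally show "of_real (sqrt \<beta>) * exp (- z\<^sup>2 / 8) * (LINT x:{0<..}|lborel. of_real (exp (- (pi * \<beta>\<^sup>2 / q) * x\<^sup>2)) * hyp h (of_real (sqrt pi * \<beta> / sqrt q) * z * of_real x) * K x)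
      = z ^ h * of_real (sqrt (real q / pi)) ^ h / of_real (16 * pi powr (3/2)) * (LINT t:{0<..}|lborel. H t)"
    by (simp only:)
qed

end

section \<open>Specialisation to even and odd real primitive characters\<close>

lemma gauss_kernel_character:
  assumes q: "q > 1" and prim: "primitive_dirichlet_character q chi" and real: "real_character chi"
    and h: "h \<le> 1" and parity: "chi (-1) = - ((-1) ^ h)"
  shows "gauss_kernel q chi h"
proof
  have d: "dirichlet_character q chi" using prim by (simp add: primitive_dirichlet_character_def)
  show "q > 1" "h \<le> 1" by fact+
  show "chi (n + int q * k) = chi n" for n k by (rule dirichlet_character_periodic[OF d])
  show "norm (chi n) \<le> 1" for n using real_character_cases[OF d real, of n] dirichlet_character_eq_0_iff[OF d, of n] by auto
  show "chi 0 = 0" using q dirichlet_character_eq_0_iff[OF d, of 0] by simp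
  show "chi (- n) = - ((-1) ^ h) * chi n" for n
    using dirichlet_character_uminus[OF d, of n] parity by simp
  show "(\<Sum>r\<in>{0..<int q}. chi r * cis (2 * pi * of_int (k * r) / real q)) = chi k * of_real (sqrt (real q)) * \<i> ^ (1 - h)" for k
    using real_primitive_gauss_sum[of q chi k] prim real parity h
    by (cases h) (auto simp: real_primitive_def unit_char_def)
qed

text \<open>\<open>hyp h\<close> at \<open>\<i> w\<close>, divided by \<open>\<i> ^ h\<close>, is
  the sine or cosine of \<open>w\<close>, which brings \<open>gauss_transform\<close> to the form of
  the theorem. The factor \<open>exp (- z^2 / 4)\<close> is shared evenly between the two sides, and
  \<open>sqrt \<alpha> * \<beta> = sqrt \<beta>\<close>.\<close>

lemma (in gauss_kernel) gauss_hyp_theta_Xi_identity: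
  fixes z :: complex and \<alpha> \<beta> :: real
  assumes \<alpha>: "\<alpha> > 0" "\<beta> > 0" "\<alpha> * \<beta> = 1" and chi1: "chi 1 = 1"
  defines "F \<equiv> (\<lambda>x::real. of_real (exp (- pi * \<alpha>\<^sup>2 * x\<^sup>2 / real q))
                   * (hyp h (\<i> * (of_real (sqrt pi * \<alpha> * x) * z / of_real (sqrt (real q)))) / \<i> ^ h) * K x)"
  defines "G \<equiv> (\<lambda>x::real. of_real (exp (- pi * \<beta>\<^sup>2 * x\<^sup>2 / real q))
                   * hyp h (of_real (sqrt pi * \<beta> * x) * z / of_real (sqrt (real q))) * K x)"
  shows "set_integrable lborel {0<..} F" and "set_integrable lborel {0<..} G"
    and "of_real (sqrt \<alpha>) * exp (z\<^sup>2 / 8) * (LINT x:{0<..}|lborel. F x)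
             = of_real (sqrt \<beta>) * exp (- z\<^sup>2 / 8) * (LINT x:{0<..}|lborel. G x)"
    and "G = (\<lambda>x. of_real (exp (- (pi * \<beta>\<^sup>2 / q) * x\<^sup>2)) * hyp h (of_real (sqrt pi * \<beta> / sqrt q) * z * of_real x) * K x)"
proof -
  define F' where "F' = (\<lambda>x::real. of_real (exp (- (pi * \<alpha>\<^sup>2 / q) * x\<^sup>2)) * hyp h (\<i> * (of_real (sqrt pi * \<alpha> / sqrt q) * z) * of_real x) * K x)"
  have F: "F = (\<lambda>x. inverse (\<i> ^ h) * F' x)"
    unfolding F_def F'_def by (simp add: fun_eq_iff divide_inverse mult_ac)
  show G: "G = (\<lambda>x. of_real (exp (- (pi * \<beta>\<^sup>2 / q) * x\<^sup>2)) * hyp h (of_real (sqrt pi * \<beta> / sqrt q) * z * of_real x) * K x)"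
    unfolding G_def by (simp add: fun_eq_iff divide_inverse mult_ac)
  have c: "pi * \<alpha>\<^sup>2 / real q > 0" "pi * \<beta>\<^sup>2 / real q > 0" using \<alpha> q1 by simp_all
  have "set_integrable lborel {0<..} F'" unfolding F'_def by (rule set_integrable_gauss_hyp_K[OF c(1)])
  thus "set_integrable lborel {0<..} F" unfolding F by (rule set_integrable_mult_right)
  show "set_integrable lborel {0<..} G" unfolding G by (rule set_integrable_gauss_hyp_K[OF c(2)])
  have "sqrt \<alpha> * \<beta> = sqrt \<beta>"
  proof -
    have "sqrt \<alpha> * \<beta> = (sqrt \<alpha> * sqrt \<beta>) * sqrt \<beta>" using \<alpha> by simp
    also have "sqrt \<alpha> * sqrt \<beta> = 1" using \<alpha> by (simp flip: real_sqrt_mult)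
    finally show ?thesis by simp
  qed
  moreover have "exp (z\<^sup>2 / 8) * exp (- z\<^sup>2 / 4) = exp (- z\<^sup>2 / 8)"
    unfolding exp_add[symmetric] by (rule arg_cong[of _ _ exp]) (simp add: field_simps)
  moreover have "(LINT x:{0<..}|lborel. F x) = inverse (\<i> ^ h) * (\<i> ^ h * of_real \<beta> * exp (- z\<^sup>2 / 4) * (LINT x:{0<..}|lborel. G x))"
    unfolding F set_integral_mult_right G F'_def gauss_transform[OF \<alpha>] ..
  moreover have "inverse (\<i> ^ h) * \<i> ^ h = 1" by simp
  moreover have "a * b * (c * (d * e * f * J)) = (a * e) * (b * f) * (c * d) * J" for a b c d e f J :: complex
    by (simp only: mult_ac)
  ultimately show "of_real (sqrt \<alpha>) * exp (z\<^sup>2 / 8) * (LINT x:{0<..}|lborel. F x)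
             = of_real (sqrt \<beta>) * exp (- z\<^sup>2 / 8) * (LINT x:{0<..}|lborel. G x)"
    by (simp only: of_real_mult[symmetric] mult_1_right)
qed

text \<open>The integrability clauses assert convergence, which an equation between integrals alone
  does not express. The condition \<open>q > 1\<close> leaves out the trivial character, whose
  kernel is an empty sum while its L-function is the zeta function.\<close>

theorem theorem1p3:
  fixes z :: complex and \<alpha> \<beta> :: real and q :: nat and chi :: "int \<Rightarrow> complex"
  assumes "\<alpha> > 0" and "\<beta> > 0" and "\<alpha> * \<beta> = 1"
    and "q > 1"
    and "primitive_dirichlet_character q chi" and "real_character chi"
  shows
    "(even_character chi \<longrightarrow>
       (let F = (\<lambda>x::real. of_real (exp (- pi * \<alpha>\<^sup>2 * x\<^sup>2 / real q))
                   * sin (of_real (sqrt pi * \<alpha> * x) * z / of_real (sqrt (real q)))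
                   * char_kernel q chi x);
            G = (\<lambda>x::real. of_real (exp (- pi * \<beta>\<^sup>2 * x\<^sup>2 / real q))
                   * sinh (of_real (sqrt pi * \<beta> * x) * z / of_real (sqrt (real q)))
                   * char_kernel q chi x);
            H = (\<lambda>t::real. Gamma ((3 + \<i> * of_real t) / 4) * Gamma ((3 - \<i> * of_real t) / 4)
                   * Xi_char q chi (of_real t / 2)
                   * Delta_fn \<alpha> z ((1 + \<i> * of_real t) / 2))
        in set_integrable lborel {0<..} F \<and>
           set_integrable lborel {0<..} G \<and>
           set_integrable lborel {0<..} H \<and>
           of_real (sqrt \<alpha>) * exp (z\<^sup>2 / 8) * (LINT x:{0<..}|lborel. F x)
             = of_real (sqrt \<beta>) * exp (- z\<^sup>2 / 8) * (LINT x:{0<..}|lborel. G x) \<and>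
           of_real (sqrt \<beta>) * exp (- z\<^sup>2 / 8) * (LINT x:{0<..}|lborel. G x)
             = z * of_real (sqrt (real q)) / of_real (16 * pi\<^sup>2)
                 * (LINT t:{0<..}|lborel. H t)))
     \<and>
     (odd_character chi \<longrightarrow>
       (let F = (\<lambda>x::real. of_real (exp (- pi * \<alpha>\<^sup>2 * x\<^sup>2 / real q))
                   * cos (of_real (sqrt pi * \<alpha> * x) * z / of_real (sqrt (real q)))
                   * char_kernel q chi x);
            G = (\<lambda>x::real. of_real (exp (- pi * \<beta>\<^sup>2 * x\<^sup>2 / real q))
                   * cosh (of_real (sqrt pi * \<beta> * x) * z / of_real (sqrt (real q)))
                   * char_kernel q chi x);
            H = (\<lambda>t::real. Gamma ((1 + \<i> * of_real t) / 4) * Gamma ((1 - \<i> * of_real t) / 4)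
                   * Xi_char q chi (of_real t / 2)
                   * Nabla_fn \<alpha> z ((1 + \<i> * of_real t) / 2))
        in set_integrable lborel {0<..} F \<and>
           set_integrable lborel {0<..} G \<and>
           set_integrable lborel {0<..} H \<and>
           of_real (sqrt \<alpha>) * exp (z\<^sup>2 / 8) * (LINT x:{0<..}|lborel. F x)
             = of_real (sqrt \<beta>) * exp (- z\<^sup>2 / 8) * (LINT x:{0<..}|lborel. G x) \<and>
           of_real (sqrt \<beta>) * exp (- z\<^sup>2 / 8) * (LINT x:{0<..}|lborel. G x)
             = 1 / of_real (16 * pi powr (3/2)) * (LINT t:{0<..}|lborel. H t)))"
proof (intro conjI impI)
  have d: "dirichlet_character q chi" using assms by (simp add: primitive_dirichlet_character_def)
  have chi1: "chi 1 = 1" by (rule dirichlet_character_one[OF d])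
  have arg: "(1 + (1 + \<i> * complex_of_real t) / 2) / 2 = (3 + \<i> * of_real t) / 4"
    "(1 + 1 - (1 + \<i> * complex_of_real t) / 2) / 2 = (3 - \<i> * of_real t) / 4"
    "(1 + \<i> * complex_of_real t) / 2 / 2 = (1 + \<i> * of_real t) / 4"
    "(1 - (1 + \<i> * complex_of_real t) / 2) / 2 = (1 - \<i> * of_real t) / 4" for t
    by (simp_all add: field_simps)
  show "let F = (\<lambda>x::real. of_real (exp (- pi * \<alpha>\<^sup>2 * x\<^sup>2 / real q)) * sin (of_real (sqrt pi * \<alpha> * x) * z / of_real (sqrt (real q))) * char_kernel q chi x);
            G = (\<lambda>x::real. of_real (exp (- pi * \<beta>\<^sup>2 * x\<^sup>2 / real q)) * sinh (of_real (sqrt pi * \<beta> * x) * z / of_real (sqrt (real q))) * char_kernel q chi x);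
            H = (\<lambda>t::real. Gamma ((3 + \<i> * of_real t) / 4) * Gamma ((3 - \<i> * of_real t) / 4) * Xi_char q chi (of_real t / 2) * Delta_fn \<alpha> z ((1 + \<i> * of_real t) / 2))
        in set_integrable lborel {0<..} F \<and> set_integrable lborel {0<..} G \<and> set_integrable lborel {0<..} H \<and>
           of_real (sqrt \<alpha>) * exp (z\<^sup>2 / 8) * (LINT x:{0<..}|lborel. F x) = of_real (sqrt \<beta>) * exp (- z\<^sup>2 / 8) * (LINT x:{0<..}|lborel. G x) \<and>
           of_real (sqrt \<beta>) * exp (- z\<^sup>2 / 8) * (LINT x:{0<..}|lborel. G x)
             = z * of_real (sqrt (real q)) / of_real (16 * pi\<^sup>2) * (LINT t:{0<..}|lborel. H t)"
    if "even_character chi"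
  proof -
    interpret gauss_kernel q chi 1
      by (rule gauss_kernel_character) (use assms that in \<open>auto simp: even_character_def\<close>)
    have sin: "sinh (\<i> * w) / \<i> ^ 1 = sin w" "hyp 1 w = sinh w" for w
      by (simp_all add: hyp_def sin_conv_sinh field_simps)
    have om: "of_real \<alpha> powr (1/2 - s) * exp (- z\<^sup>2 / 8) * kummer_1F1 ((of_nat 1 + 1 - s) / 2) (of_nat 1 + 1/2) (z\<^sup>2 / 4) = omega_fn \<alpha> z s" for s
    proof -
      have "(of_nat 1 + 1 - s) / 2 = 1 - s / 2" "of_nat 1 + 1/2 = (3/2 :: complex)" by (simp_all add: field_simps)
      thus ?thesis unfolding omega_fn_def by (simp only:)
    qed
    \<comment> \<open>For \<open>h = 1\<close> the factor \<open>sqrt (q / pi)\<close> raises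
      \<open>pi powr (3/2)\<close> in the denominator to the square of \<open>pi\<close>.\<close>
    have k: "z ^ 1 * of_real (sqrt (real q / pi)) ^ 1 / of_real (16 * pi powr (3/2)) = z * of_real (sqrt (real q)) / of_real (16 * pi\<^sup>2)"
    proof -
      have "pi powr (3/2) = pi * sqrt pi" using powr_add[of pi 1 "1/2"] by (simp add: powr_half_sqrt)
      hence "sqrt (real q / pi) / (16 * pi powr (3/2)) = sqrt (real q) / (16 * pi\<^sup>2)"
        by (simp add: real_sqrt_divide power2_eq_square)
      hence "complex_of_real (sqrt (real q / pi)) / of_real (16 * pi powr (3/2)) = of_real (sqrt (real q)) / of_real (16 * pi\<^sup>2)"
        by (simp only: flip: of_real_divide)
      thus ?thesis by (simp only: power_one_right flip: times_divide_eq_right)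
    qed
    note I = gauss_hyp_theta_Xi_identity[OF assms(1-3) chi1, of z, unfolded sin]
    note X = gauss_hyp_Xi_integral[OF assms(1-3) chi1, of z, unfolded om k sin I(4)[symmetric] Delta_fn_def[symmetric]]
    show ?thesis unfolding Let_def
      using I(1-3) X unfolding of_nat_1 arg by blast
  qed
  show "let F = (\<lambda>x::real. of_real (exp (- pi * \<alpha>\<^sup>2 * x\<^sup>2 / real q)) * cos (of_real (sqrt pi * \<alpha> * x) * z / of_real (sqrt (real q))) * char_kernel q chi x);
            G = (\<lambda>x::real. of_real (exp (- pi * \<beta>\<^sup>2 * x\<^sup>2 / real q)) * cosh (of_real (sqrt pi * \<beta> * x) * z / of_real (sqrt (real q))) * char_kernel q chi x);
            H = (\<lambda>t::real. Gamma ((1 + \<i> * of_real t) / 4) * Gamma ((1 - \<i> * of_real t) / 4) * Xi_char q chi (of_real t / 2) * Nabla_fn \<alpha> z ((1 + \<i> * of_real t) / 2))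
        in set_integrable lborel {0<..} F \<and> set_integrable lborel {0<..} G \<and> set_integrable lborel {0<..} H \<and>
           of_real (sqrt \<alpha>) * exp (z\<^sup>2 / 8) * (LINT x:{0<..}|lborel. F x) = of_real (sqrt \<beta>) * exp (- z\<^sup>2 / 8) * (LINT x:{0<..}|lborel. G x) \<and>
           of_real (sqrt \<beta>) * exp (- z\<^sup>2 / 8) * (LINT x:{0<..}|lborel. G x)
             = 1 / of_real (16 * pi powr (3/2)) * (LINT t:{0<..}|lborel. H t)"
    if "odd_character chi"
  proof -
    interpret gauss_kernel q chi 0
      by (rule gauss_kernel_character) (use assms that in \<open>auto simp: odd_character_def\<close>)
    have cos: "cosh (\<i> * w) / \<i> ^ 0 = cos w" "hyp 0 w = cosh w" for w
      by (simp_all add: hyp_def cos_conv_cosh)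
    have om: "of_real \<alpha> powr (1/2 - s) * exp (- z\<^sup>2 / 8) * kummer_1F1 ((of_nat 0 + 1 - s) / 2) (of_nat 0 + 1/2) (z\<^sup>2 / 4) = rho_fn \<alpha> z s" for s
      unfolding rho_fn_def by (simp only: of_nat_0 add_0_left)
    have k: "z ^ 0 * of_real (sqrt (real q / pi)) ^ 0 / of_real (16 * pi powr (3/2)) = 1 / of_real (16 * pi powr (3/2))"
      by (simp only: power_0 mult_1)
    note I = gauss_hyp_theta_Xi_identity[OF assms(1-3) chi1, of z, unfolded cos]
    note X = gauss_hyp_Xi_integral[OF assms(1-3) chi1, of z, unfolded om k cos I(4)[symmetric] Nabla_fn_def[symmetric]]
    show ?thesis unfolding Let_def
      using I(1-3) X unfolding of_nat_0 add_0_left arg by blast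
  qed
qed

end
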